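(* Let $R$ be a commutative Noetherian ring, $\mathfrak{a}$ an ideal of $R$, $M$ a finitely generated $R$-module and $t$ a non-negative integer. Suppose that the local cohomology module $H_{\mathfrak{a}}^{t}(M)$ is Artinian and that $H_{\mathfrak{a}}^{i}(M)$ is $\mathfrak{a}$-cofinite for all $i<t$. Then $H_{\mathfrak{a}}^{t}(M)$ is $\mathfrak{a}$-cofinite.
   Context: $H_{\mathfrak{a}}^{i}(-)$ denotes the $i$-th local cohomology functor with respect to $\mathfrak{a}$. An $R$-module $N$ (not necessarily finitely generated) is called $\mathfrak{a}$-cofinite if $\operatorname{Supp}_R(N)\subseteq V(\mathfrak{a})=\{\mathfrak{p}\in\operatorname{Spec} R:\mathfrak{a}\subseteq\mathfrak{p}\}$ and $\operatorname{Ext}_R^{j}(R/\mathfrak{a},N)$ is a finitely generated $R$-module for all $j\ge 0$. *)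

theory Defs
  imports "HOL-Algebra.Algebra"
begin

text \<open>
  Modules are the records of \<^theory>\<open>HOL-Algebra.Module\<close>. That record type extends rings, so every
  module carries the fields \<^const>\<open>monoid.mult\<close> and \<^const>\<open>monoid.one\<close>; they play no role, and the constructions
  below leave them \<^const>\<open>undefined\<close>.
\<close>

section \<open>Modules\<close>

definition module_hom ::
    "('a, 'r) ring_scheme \<Rightarrow> ('a, 'b, 'm) module_scheme \<Rightarrow> ('a, 'c, 'n) module_scheme \<Rightarrow> ('b \<Rightarrow> 'c) set"
  where "module_hom R M N =
    {f \<in> carrier M \<rightarrow> carrier N.
       (\<forall>x\<in>carrier M. \<forall>y\<in>carrier M. f (x \<oplus>\<^bsub>M\<^esub> y) = f x \<oplus>\<^bsub>N\<^esub> f y) \<and>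
       (\<forall>r\<in>carrier R. \<forall>x\<in>carrier M. f (r \<odot>\<^bsub>M\<^esub> x) = r \<odot>\<^bsub>N\<^esub> f x)}"

definition submodule_span ::
    "('a, 'r) ring_scheme \<Rightarrow> ('a, 'b, 'm) module_scheme \<Rightarrow> 'b set \<Rightarrow> 'b set"
  where "submodule_span R M A = \<Inter>{H. submodule H R M \<and> A \<subseteq> H}"

definition finitely_generated_module ::
    "('a, 'r) ring_scheme \<Rightarrow> ('a, 'b, 'm) module_scheme \<Rightarrow> bool"
  where "finitely_generated_module R M \<longleftrightarrow>
    module R M \<and> (\<exists>A \<subseteq> carrier M. finite A \<and> submodule_span R M A = carrier M)"

definition artinian_module ::
    "('a, 'r) ring_scheme \<Rightarrow> ('a, 'b, 'm) module_scheme \<Rightarrow> bool"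
  where "artinian_module R M \<longleftrightarrow>
    module R M \<and>
    (\<forall>H :: nat \<Rightarrow> 'b set. (\<forall>n. submodule (H n) R M \<and> H (Suc n) \<subseteq> H n) \<longrightarrow>
       (\<exists>n. \<forall>m\<ge>n. H m = H n))"

definition regular_module :: "('a, 'r) ring_scheme \<Rightarrow> ('a, 'a) module"
  where "regular_module R =
    \<lparr>carrier = carrier R, monoid.mult = undefined, monoid.one = undefined,
     ring.zero = \<zero>\<^bsub>R\<^esub>, add = add R, smult = (\<otimes>\<^bsub>R\<^esub>)\<rparr>"

definition quotient_module ::
    "('a, 'r) ring_scheme \<Rightarrow> ('a, 'b, 'm) module_scheme \<Rightarrow> 'b set \<Rightarrow> ('a, 'b set) module"
  where "quotient_module R M H =
    \<lparr>carrier = a_rcosets\<^bsub>M\<^esub> H, monoid.mult = undefined, monoid.one = undefined,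
     ring.zero = H, add = set_add M, smult = (\<lambda>r C. \<Union>x\<in>C. H +>\<^bsub>M\<^esub> (r \<odot>\<^bsub>M\<^esub> x))\<rparr>"

text \<open>Homomorphisms are taken extensional, so that equality of maps is equality on the carrier.\<close>

definition Hom_module ::
    "('a, 'r) ring_scheme \<Rightarrow> ('a, 'b, 'm) module_scheme \<Rightarrow> ('a, 'c, 'n) module_scheme
      \<Rightarrow> ('a, 'b \<Rightarrow> 'c) module"
  where "Hom_module R M N =
    \<lparr>carrier = module_hom R M N \<inter> extensional (carrier M), monoid.mult = undefined, monoid.one = undefined,
     ring.zero = (\<lambda>x\<in>carrier M. \<zero>\<^bsub>N\<^esub>),
     add = (\<lambda>f g. \<lambda>x\<in>carrier M. f x \<oplus>\<^bsub>N\<^esub> g x),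
     smult = (\<lambda>r f. \<lambda>x\<in>carrier M. r \<odot>\<^bsub>N\<^esub> f x)\<rparr>"

text \<open>The free module $R^n$: sequences in $R$ that vanish from index $n$ on.\<close>

definition free_module :: "('a, 'r) ring_scheme \<Rightarrow> nat \<Rightarrow> ('a, nat \<Rightarrow> 'a) module"
  where "free_module R n =
    \<lparr>carrier = {f. (\<forall>i<n. f i \<in> carrier R) \<and> (\<forall>i\<ge>n. f i = \<zero>\<^bsub>R\<^esub>)},
     monoid.mult = undefined, monoid.one = undefined, ring.zero = (\<lambda>i. \<zero>\<^bsub>R\<^esub>),
     add = (\<lambda>f g i. f i \<oplus>\<^bsub>R\<^esub> g i), smult = (\<lambda>r f i. r \<otimes>\<^bsub>R\<^esub> f i)\<rparr>"


section \<open>Localization and support\<close>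

text \<open>The fraction $x/s$ in $S^{-1}N$, as an equivalence class of pairs.\<close>

definition module_frac ::
    "('a, 'r) ring_scheme \<Rightarrow> 'a set \<Rightarrow> ('a, 'b, 'm) module_scheme \<Rightarrow> 'b \<Rightarrow> 'a \<Rightarrow> ('b \<times> 'a) set"
  where "module_frac R S N x s =
    {(y, t). y \<in> carrier N \<and> t \<in> S \<and>
       (\<exists>u\<in>S. u \<odot>\<^bsub>N\<^esub> (t \<odot>\<^bsub>N\<^esub> x) = u \<odot>\<^bsub>N\<^esub> (s \<odot>\<^bsub>N\<^esub> y))}"

definition localized_module ::
    "('a, 'r) ring_scheme \<Rightarrow> 'a set \<Rightarrow> ('a, 'b, 'm) module_scheme \<Rightarrow> ('a, ('b \<times> 'a) set) module"
  where "localized_module R S N =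
    \<lparr>carrier = {module_frac R S N x s | x s. x \<in> carrier N \<and> s \<in> S},
     monoid.mult = undefined, monoid.one = undefined,
     ring.zero = module_frac R S N \<zero>\<^bsub>N\<^esub> \<one>\<^bsub>R\<^esub>,
     add = (\<lambda>U V. \<Union>(x, s)\<in>U. \<Union>(y, t)\<in>V.
              module_frac R S N (t \<odot>\<^bsub>N\<^esub> x \<oplus>\<^bsub>N\<^esub> s \<odot>\<^bsub>N\<^esub> y) (s \<otimes>\<^bsub>R\<^esub> t)),
     smult = (\<lambda>r U. \<Union>(x, s)\<in>U. module_frac R S N (r \<odot>\<^bsub>N\<^esub> x) s)\<rparr>"

definition Spec :: "('a, 'r) ring_scheme \<Rightarrow> 'a set set"
  where "Spec R = {\<pp>. primeideal \<pp> R}"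

definition Supp :: "('a, 'r) ring_scheme \<Rightarrow> ('a, 'b, 'm) module_scheme \<Rightarrow> 'a set set"
  where "Supp R N =
    {\<pp> \<in> Spec R. let L = localized_module R (carrier R - \<pp>) N in carrier L \<noteq> {\<zero>\<^bsub>L\<^esub>}}"

definition zero_locus :: "('a, 'r) ring_scheme \<Rightarrow> 'a set \<Rightarrow> 'a set set"
  where "zero_locus R \<aa> = {\<pp> \<in> Spec R. \<aa> \<subseteq> \<pp>}"


section \<open>Cohomology of complexes\<close>

text \<open>
  Cohomology of a complex $C^0 \to C^1 \to \cdots$ with \<open>d i\<close> mapping \<open>C i\<close> to \<open>C (Suc i)\<close>; the term
  in degree $-1$ is zero.
\<close>

definition cocycles ::
    "(nat \<Rightarrow> ('a, 'b) module) \<Rightarrow> (nat \<Rightarrow> 'b \<Rightarrow> 'b) \<Rightarrow> nat \<Rightarrow> 'b set"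
  where "cocycles C d i = {x \<in> carrier (C i). d i x = \<zero>\<^bsub>C (Suc i)\<^esub>}"

definition coboundaries ::
    "(nat \<Rightarrow> ('a, 'b) module) \<Rightarrow> (nat \<Rightarrow> 'b \<Rightarrow> 'b) \<Rightarrow> nat \<Rightarrow> 'b set"
  where "coboundaries C d i =
    (case i of 0 \<Rightarrow> {\<zero>\<^bsub>C 0\<^esub>} | Suc k \<Rightarrow> d k ` carrier (C k))"

definition cohomology ::
    "('a, 'r) ring_scheme \<Rightarrow> (nat \<Rightarrow> ('a, 'b) module) \<Rightarrow> (nat \<Rightarrow> 'b \<Rightarrow> 'b) \<Rightarrow> nat
      \<Rightarrow> ('a, 'b set) module"
  where "cohomology R C d i =
    quotient_module R ((C i)\<lparr>carrier := cocycles C d i\<rparr>) (coboundaries C d i)"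


section \<open>Ext\<close>

text \<open>
  A resolution $\cdots \to R^{n_1} \to R^{n_0} \to L \to 0$ by finitely generated free modules, with
  differentials \<open>\<delta> i\<close> from \<open>R^(n (Suc i))\<close> to \<open>R^(n i)\<close> and augmentation \<open>\<epsilon>\<close>.
\<close>

definition finite_free_resolution ::
    "('a, 'r) ring_scheme \<Rightarrow> ('a, 'b, 'm) module_scheme \<Rightarrow>
      (nat \<Rightarrow> nat) \<Rightarrow> (nat \<Rightarrow> (nat \<Rightarrow> 'a) \<Rightarrow> nat \<Rightarrow> 'a) \<Rightarrow> ((nat \<Rightarrow> 'a) \<Rightarrow> 'b) \<Rightarrow> bool"
  where "finite_free_resolution R L n \<delta> \<epsilon> \<longleftrightarrow>
    \<epsilon> \<in> module_hom R (free_module R (n 0)) L \<and>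
    (\<forall>i. \<delta> i \<in> module_hom R (free_module R (n (Suc i))) (free_module R (n i))) \<and>
    \<epsilon> ` carrier (free_module R (n 0)) = carrier L \<and>
    a_kernel (free_module R (n 0)) L \<epsilon> = \<delta> 0 ` carrier (free_module R (n 1)) \<and>
    (\<forall>i. a_kernel (free_module R (n (Suc i))) (free_module R (n i)) (\<delta> i)
           = \<delta> (Suc i) ` carrier (free_module R (n (Suc (Suc i)))))"

definition Ext_of_resolution ::
    "('a, 'r) ring_scheme \<Rightarrow> (nat \<Rightarrow> nat) \<Rightarrow> (nat \<Rightarrow> (nat \<Rightarrow> 'a) \<Rightarrow> nat \<Rightarrow> 'a) \<Rightarrow>
      ('a, 'c, 'n) module_scheme \<Rightarrow> nat \<Rightarrow> ('a, ((nat \<Rightarrow> 'a) \<Rightarrow> 'c) set) module"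
  where "Ext_of_resolution R n \<delta> N j =
    cohomology R
      (\<lambda>i. Hom_module R (free_module R (n i)) N)
      (\<lambda>i f. \<lambda>x\<in>carrier (free_module R (n (Suc i))). f (\<delta> i x)) j"

text \<open>
  $\mathrm{Ext}^j_R(L,N)$ for a finitely generated module $L$ over a Noetherian ring $R$: such an $L$
  has a resolution as above (\<open>finite_free_resolution_exists\<close> below), and the choice does not matter
  up to isomorphism.
\<close>

definition Ext_module ::
    "('a, 'r) ring_scheme \<Rightarrow> ('a, 'b, 'm) module_scheme \<Rightarrow> ('a, 'c, 'n) module_scheme \<Rightarrow> nat
      \<Rightarrow> ('a, ((nat \<Rightarrow> 'a) \<Rightarrow> 'c) set) module"
  where "Ext_module R L N j =
    (let (n, \<delta>) = (SOME (n, \<delta>). \<exists>\<epsilon>. finite_free_resolution R L n \<delta> \<epsilon>)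
     in Ext_of_resolution R n \<delta> N j)"

definition cofinite_module ::
    "('a, 'r) ring_scheme \<Rightarrow> 'a set \<Rightarrow> ('a, 'b, 'm) module_scheme \<Rightarrow> bool"
  where "cofinite_module R \<aa> N \<longleftrightarrow>
    module R N \<and>
    Supp R N \<subseteq> zero_locus R \<aa> \<and>
    (\<forall>j. finitely_generated_module R
           (Ext_module R (quotient_module R (regular_module R) \<aa>) N j))"


section \<open>Local cohomology\<close>

text \<open>
  The test modules range over the type of ring elements, because a definition cannot quantify over
  types. This is no restriction: $R$ and its ideals are among the test modules, so by Baer's
  criterion the extension property holds for modules on all types.
\<close>

definition injective_module ::
    "('a, 'r) ring_scheme \<Rightarrow> ('a, 'b, 'm) module_scheme \<Rightarrow> bool"
  where "injective_module R E \<longleftrightarrow>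
    module R E \<and>
    (\<forall>(A :: ('a, 'a) module) (B :: ('a, 'a) module) f g.
       module R A \<and> module R B \<and> f \<in> module_hom R A B \<and> inj_on f (carrier A) \<and>
       g \<in> module_hom R A E \<longrightarrow>
       (\<exists>h \<in> module_hom R B E. \<forall>x\<in>carrier A. h (f x) = g x))"

definition injective_resolution ::
    "('a, 'r) ring_scheme \<Rightarrow> ('a, 'b, 'm) module_scheme \<Rightarrow>
      (nat \<Rightarrow> ('a, 'c) module) \<Rightarrow> (nat \<Rightarrow> 'c \<Rightarrow> 'c) \<Rightarrow> ('b \<Rightarrow> 'c) \<Rightarrow> bool"
  where "injective_resolution R M I d \<eta> \<longleftrightarrow>
    (\<forall>i. injective_module R (I i)) \<and>
    \<eta> \<in> module_hom R M (I 0) \<and>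
    (\<forall>i. d i \<in> module_hom R (I i) (I (Suc i))) \<and>
    inj_on \<eta> (carrier M) \<and>
    a_kernel (I 0) (I 1) (d 0) = \<eta> ` carrier M \<and>
    (\<forall>i. a_kernel (I (Suc i)) (I (Suc (Suc i))) (d (Suc i)) = d i ` carrier (I i))"

definition torsion_part ::
    "('a, 'r) ring_scheme \<Rightarrow> 'a set \<Rightarrow> ('a, 'b, 'm) module_scheme \<Rightarrow> ('a, 'b, 'm) module_scheme"
  where "torsion_part R \<aa> N =
    N\<lparr>carrier := {x \<in> carrier N. \<exists>n::nat. \<forall>r \<in> \<aa> [^]\<^bsub>ideals_set R\<^esub> n. r \<odot>\<^bsub>N\<^esub> x = \<zero>\<^bsub>N\<^esub>}\<rparr>"

text \<open>
  $H^i_{\mathfrak a}(M)$ is the $i$-th right derived functor of the torsion functor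
  $\Gamma_{\mathfrak a}$ at $M$, computed from an injective resolution \<open>(I, d)\<close> of $M$. The resolution
  is an explicit argument because no single type hosts injective resolutions of all modules;
  resolutions of the same module give isomorphic results.
\<close>

definition local_cohomology ::
    "('a, 'r) ring_scheme \<Rightarrow> 'a set \<Rightarrow> (nat \<Rightarrow> ('a, 'c) module) \<Rightarrow> (nat \<Rightarrow> 'c \<Rightarrow> 'c) \<Rightarrow> nat
      \<Rightarrow> ('a, 'c set) module"
  where "local_cohomology R \<aa> I d i = cohomology R (\<lambda>k. torsion_part R \<aa> (I k)) d i"


section \<open>Well-definedness\<close>

lemma module_homD:
  assumes "f \<in> module_hom R M N"
  shows "x \<in> carrier M \<Longrightarrow> f x \<in> carrier N"
    and "x \<in> carrier M \<Longrightarrow> y \<in> carrier M \<Longrightarrow> f (x \<oplus>\<^bsub>M\<^esub> y) = f x \<oplus>\<^bsub>N\<^esub> f y"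
    and "r \<in> carrier R \<Longrightarrow> x \<in> carrier M \<Longrightarrow> f (r \<odot>\<^bsub>M\<^esub> x) = r \<odot>\<^bsub>N\<^esub> f x"
  using assms by (auto simp: module_hom_def)

lemma module_hom_zero:
  assumes "module R M" "module R N" "f \<in> module_hom R M N"
  shows "f \<zero>\<^bsub>M\<^esub> = \<zero>\<^bsub>N\<^esub>"
proof -
  interpret M: module R M by fact
  interpret N: module R N by fact
  have "f (\<zero>\<^bsub>R\<^esub> \<odot>\<^bsub>M\<^esub> \<zero>\<^bsub>M\<^esub>) = \<zero>\<^bsub>R\<^esub> \<odot>\<^bsub>N\<^esub> f \<zero>\<^bsub>M\<^esub>"
    by (intro module_homD(3)[OF assms(3)]) auto
  then show ?thesis using module_homD(1)[OF assms(3), of "\<zero>\<^bsub>M\<^esub>"] by simp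
qed

lemma moduleI':
  fixes M (structure)
  assumes "cring R" "\<And>x y. x \<in> carrier M \<Longrightarrow> y \<in> carrier M \<Longrightarrow> x \<oplus> y \<in> carrier M"
    "\<zero> \<in> carrier M"
    "\<And>x y z. x \<in> carrier M \<Longrightarrow> y \<in> carrier M \<Longrightarrow> z \<in> carrier M \<Longrightarrow> (x \<oplus> y) \<oplus> z = x \<oplus> (y \<oplus> z)"
    "\<And>x y. x \<in> carrier M \<Longrightarrow> y \<in> carrier M \<Longrightarrow> x \<oplus> y = y \<oplus> x"
    "\<And>x. x \<in> carrier M \<Longrightarrow> \<zero> \<oplus> x = x"
    "\<And>x. x \<in> carrier M \<Longrightarrow> \<exists>y\<in>carrier M. y \<oplus> x = \<zero>"
    "\<And>a x. a \<in> carrier R \<Longrightarrow> x \<in> carrier M \<Longrightarrow> a \<odot> x \<in> carrier M"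
    "\<And>a b x. a \<in> carrier R \<Longrightarrow> b \<in> carrier R \<Longrightarrow> x \<in> carrier M \<Longrightarrow> (a \<oplus>\<^bsub>R\<^esub> b) \<odot> x = a \<odot> x \<oplus> b \<odot> x"
    "\<And>a x y. a \<in> carrier R \<Longrightarrow> x \<in> carrier M \<Longrightarrow> y \<in> carrier M \<Longrightarrow> a \<odot> (x \<oplus> y) = a \<odot> x \<oplus> a \<odot> y"
    "\<And>a b x. a \<in> carrier R \<Longrightarrow> b \<in> carrier R \<Longrightarrow> x \<in> carrier M \<Longrightarrow> (a \<otimes>\<^bsub>R\<^esub> b) \<odot> x = a \<odot> (b \<odot> x)"
    "\<And>x. x \<in> carrier M \<Longrightarrow> \<one>\<^bsub>R\<^esub> \<odot> x = x"
  shows "module R M"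
  by (rule moduleI, fact, rule abelian_groupI) (use assms in auto)

lemma module_regular: assumes "cring R" shows "module R (regular_module R)"
proof -
  interpret cring R by fact
  show ?thesis
    by (rule moduleI', fact) (auto simp: regular_module_def a_ac m_ac l_distr r_distr intro: l_neg bexI[of _ "\<ominus>\<^bsub>R\<^esub> _"])
qed

lemma module_free: assumes "cring R" shows "module R (free_module R n)"
proof -
  interpret cring R by fact
  have c: "f i \<in> carrier R" if "(\<forall>i<n. f i \<in> carrier R) \<and> (\<forall>i\<ge>n. f i = \<zero>\<^bsub>R\<^esub>)" for f i
    using that by (cases "i < n") auto
  show ?thesis
  proof (rule moduleI', fact, goal_cases)
    case (6 x)
    then show ?case unfolding free_module_def
      by (auto intro!: exI[of _ "\<lambda>i. \<ominus>\<^bsub>R\<^esub> x i"] simp: l_neg c fun_eq_iff)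
  qed (auto simp: free_module_def fun_eq_iff c a_ac m_ac l_distr r_distr)
qed

lemma module_Hom: assumes "module R M" "module R N" shows "module R (Hom_module R M N)"
proof -
  interpret M: module R M by fact
  interpret N: module R N by fact
  have R: "cring R" ..
  show ?thesis
  proof (rule moduleI', fact, goal_cases)
    case (1 x y)
    then show ?case by (auto simp: Hom_module_def module_hom_def Pi_iff N.a_ac N.smult_r_distr)
  next
    case 2 then show ?case by (auto simp: Hom_module_def module_hom_def)
  next
    case 3 then show ?case by (auto simp: Hom_module_def module_hom_def fun_eq_iff N.a_ac Pi_iff)
  next
    case 4 then show ?case by (auto simp: Hom_module_def module_hom_def fun_eq_iff N.a_ac Pi_iff)
  next
    case 5 then show ?case by (auto simp: Hom_module_def module_hom_def fun_eq_iff Pi_iff extensional_def)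
  next
    case (6 x)
    then show ?case
      by (intro bexI[of _ "\<lambda>i\<in>carrier M. \<ominus>\<^bsub>N\<^esub> x i"])
        (auto simp: Hom_module_def module_hom_def fun_eq_iff Pi_iff N.l_neg N.minus_add N.smult_r_minus)
  next
    case 7 then show ?case by (auto simp: Hom_module_def module_hom_def Pi_iff N.smult_r_distr N.smult_assoc1[symmetric] M.m_comm)
  next
    case 8 then show ?case by (auto simp: Hom_module_def module_hom_def Pi_iff N.smult_l_distr)
  next
    case 9 then show ?case by (auto simp: Hom_module_def module_hom_def Pi_iff N.smult_r_distr)
  next
    case 10 then show ?case by (auto simp: Hom_module_def module_hom_def Pi_iff N.smult_assoc1)
  next
    case 11 then show ?case by (auto simp: Hom_module_def module_hom_def Pi_iff extensional_def fun_eq_iff)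
  qed
qed

lemma 
  assumes "module R M" "submodule H R M"
  shows module_quotient: "module R (quotient_module R M H)"
    and quotient_smult: "\<And>r x. r \<in> carrier R \<Longrightarrow> x \<in> carrier M \<Longrightarrow>
       r \<odot>\<^bsub>quotient_module R M H\<^esub> (H +>\<^bsub>M\<^esub> x) = H +>\<^bsub>M\<^esub> (r \<odot>\<^bsub>M\<^esub> x)"
proof -
  interpret M: module R M by fact
  interpret H: submodule H R M by fact
  have H: "subgroup H (add_monoid M)" ..
  interpret A: abelian_subgroup H M
    by (rule abelian_subgroupI3) (auto intro: additive_subgroup.intro H M.abelian_group_axioms)
  have eq: "H +>\<^bsub>M\<^esub> x = H +>\<^bsub>M\<^esub> y" if "x \<in> H +>\<^bsub>M\<^esub> y" "y \<in> carrier M" for x y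
    using M.a_repr_independence[OF that H] by simp
  have sm: "(\<Union>y\<in>H +>\<^bsub>M\<^esub> x. H +>\<^bsub>M\<^esub> (r \<odot>\<^bsub>M\<^esub> y)) = H +>\<^bsub>M\<^esub> (r \<odot>\<^bsub>M\<^esub> x)"
    if r: "r \<in> carrier R" "x \<in> carrier M" for r x
  proof -
    have "H +>\<^bsub>M\<^esub> (r \<odot>\<^bsub>M\<^esub> y) = H +>\<^bsub>M\<^esub> (r \<odot>\<^bsub>M\<^esub> x)" if "y \<in> H +>\<^bsub>M\<^esub> x" for y
    proof -
      from that obtain h where h: "h \<in> H" "y = h \<oplus>\<^bsub>M\<^esub> x" by (auto simp: a_r_coset_def')
      then have "r \<odot>\<^bsub>M\<^esub> y = (r \<odot>\<^bsub>M\<^esub> h) \<oplus>\<^bsub>M\<^esub> (r \<odot>\<^bsub>M\<^esub> x)"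
        using r A.a_subset by (auto simp: M.smult_r_distr)
      then show ?thesis using r h by (intro eq) (auto simp: a_r_coset_def')
    qed
    moreover have "x \<in> H +>\<^bsub>M\<^esub> x" using r A.a_rcos_self by auto
    ultimately show ?thesis by blast
  qed
  show qs: "r \<odot>\<^bsub>quotient_module R M H\<^esub> (H +>\<^bsub>M\<^esub> x) = H +>\<^bsub>M\<^esub> (r \<odot>\<^bsub>M\<^esub> x)"
    if "r \<in> carrier R" "x \<in> carrier M" for r x
    using sm[OF that] by (simp add: quotient_module_def)
  have add: "(H +>\<^bsub>M\<^esub> x) \<oplus>\<^bsub>quotient_module R M H\<^esub> (H +>\<^bsub>M\<^esub> y) = H +>\<^bsub>M\<^esub> (x \<oplus>\<^bsub>M\<^esub> y)" if "x \<in> carrier M" "y \<in> carrier M" for x y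
    using that A.a_rcos_sum by (simp add: quotient_module_def)
  have z: "\<zero>\<^bsub>quotient_module R M H\<^esub> = H +>\<^bsub>M\<^esub> \<zero>\<^bsub>M\<^esub>"
    using A.a_rcos_const[OF A.zero_closed] by (simp add: quotient_module_def )
  have car: "carrier (quotient_module R M H) = (\<lambda>x. H +>\<^bsub>M\<^esub> x) ` carrier M"
    by (auto simp: quotient_module_def A_RCOSETS_def')
  have R: "cring R" ..
  show "module R (quotient_module R M H)"
  proof (rule moduleI', fact, goal_cases)
    case (6 x)
    then obtain y where "y \<in> carrier M" "x = H +>\<^bsub>M\<^esub> y" by (auto simp: car)
    then show ?case
      by (intro bexI[of _ "H +>\<^bsub>M\<^esub> (\<ominus>\<^bsub>M\<^esub> y)"]) (auto simp: add z M.l_neg car)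
  qed (auto simp: car add z qs M.smult_l_distr M.smult_r_distr M.smult_assoc1 M.a_ac)
qed


lemma submoduleI':
  assumes "module R M" "H \<subseteq> carrier M" "\<zero>\<^bsub>M\<^esub> \<in> H"
    "\<And>a b. a \<in> H \<Longrightarrow> b \<in> H \<Longrightarrow> a \<oplus>\<^bsub>M\<^esub> b \<in> H"
    "\<And>a x. a \<in> carrier R \<Longrightarrow> x \<in> H \<Longrightarrow> a \<odot>\<^bsub>M\<^esub> x \<in> H"
  shows "submodule H R M"
proof -
  interpret M: module R M by fact
  show ?thesis
  proof (rule M.submoduleI)
    fix a assume a: "a \<in> H"
    then have "\<ominus>\<^bsub>M\<^esub> a = (\<ominus>\<^bsub>R\<^esub> \<one>\<^bsub>R\<^esub>) \<odot>\<^bsub>M\<^esub> a" using assms(2) by (auto simp: M.smult_l_minus)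
    then show "\<ominus>\<^bsub>M\<^esub> a \<in> H" using assms(5)[OF _ a] by simp
  qed (use assms in auto)
qed

lemma submoduleD:
  assumes "module R M" "submodule H R M"
  shows "H \<subseteq> carrier M" "\<zero>\<^bsub>M\<^esub> \<in> H"
    "\<And>a b. a \<in> H \<Longrightarrow> b \<in> H \<Longrightarrow> a \<oplus>\<^bsub>M\<^esub> b \<in> H"
    "\<And>a x. a \<in> carrier R \<Longrightarrow> x \<in> H \<Longrightarrow> a \<odot>\<^bsub>M\<^esub> x \<in> H"
    "\<And>a. a \<in> H \<Longrightarrow> \<ominus>\<^bsub>M\<^esub> a \<in> H"
proof -
  interpret M: module R M by fact
  interpret H: submodule H R M by fact
  show "H \<subseteq> carrier M" "\<zero>\<^bsub>M\<^esub> \<in> H"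
    "\<And>a b. a \<in> H \<Longrightarrow> b \<in> H \<Longrightarrow> a \<oplus>\<^bsub>M\<^esub> b \<in> H"
    "\<And>a x. a \<in> carrier R \<Longrightarrow> x \<in> H \<Longrightarrow> a \<odot>\<^bsub>M\<^esub> x \<in> H"
    "\<And>a. a \<in> H \<Longrightarrow> \<ominus>\<^bsub>M\<^esub> a \<in> H"
    using H.subset H.one_closed H.m_closed M.submoduleE[OF assms(2)] by auto
qed

lemma submodule_span_least: "submodule H R M \<Longrightarrow> A \<subseteq> H \<Longrightarrow> submodule_span R M A \<subseteq> H"
  by (auto simp: submodule_span_def)

lemma submodule_image:
  assumes "module R M" "module R N" "f \<in> module_hom R M N"
  shows "submodule (f ` carrier M) R N"
proof (rule submoduleI'[OF assms(2)])
  interpret M: module R M by fact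
  show "f ` carrier M \<subseteq> carrier N" using module_homD(1)[OF assms(3)] by auto
  show "\<zero>\<^bsub>N\<^esub> \<in> f ` carrier M" using module_hom_zero[OF assms] by (metis M.zero_closed imageI)
  show "a \<oplus>\<^bsub>N\<^esub> b \<in> f ` carrier M" if "a \<in> f ` carrier M" "b \<in> f ` carrier M" for a b
    using that module_homD(2)[OF assms(3), symmetric] by auto
  show "a \<odot>\<^bsub>N\<^esub> b \<in> f ` carrier M" if "a \<in> carrier R" "b \<in> f ` carrier M" for a b
    using that module_homD(3)[OF assms(3), symmetric] by auto
qed


subsection \<open>Finite free resolutions over Noetherian rings\<close>

lemma free_carrierD:
  assumes "cring R" "f \<in> carrier (free_module R n)" shows "f i \<in> carrier R"
proof -
  interpret cring R by fact
  show ?thesis using assms by (cases "i < n") (auto simp: free_module_def)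
qed

lemma free_hom_extend:
  assumes "module R M" "p \<in> module_hom R (free_module R n) M" "a \<in> carrier M"
  defines "q \<equiv> \<lambda>f. p (f(n := \<zero>\<^bsub>R\<^esub>)) \<oplus>\<^bsub>M\<^esub> f n \<odot>\<^bsub>M\<^esub> a"
  shows "q \<in> module_hom R (free_module R (Suc n)) M"
    and "insert a (p ` carrier (free_module R n)) \<subseteq> q ` carrier (free_module R (Suc n))"
proof -
  interpret M: module R M by fact
  have R: "cring R" ..
  note c = free_carrierD[OF R]
  have r: "f(n := \<zero>\<^bsub>R\<^esub>) \<in> carrier (free_module R n)" if "f \<in> carrier (free_module R (Suc n))" for f
    using that by (auto simp: free_module_def)
  have add: "(f \<oplus>\<^bsub>free_module R (Suc n)\<^esub> g)(n := \<zero>\<^bsub>R\<^esub>) = f(n := \<zero>\<^bsub>R\<^esub>) \<oplus>\<^bsub>free_module R n\<^esub> g(n := \<zero>\<^bsub>R\<^esub>)"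
    for f g by (auto simp: free_module_def)
  have sm: "(r \<odot>\<^bsub>free_module R (Suc n)\<^esub> f)(n := \<zero>\<^bsub>R\<^esub>) = r \<odot>\<^bsub>free_module R n\<^esub> f(n := \<zero>\<^bsub>R\<^esub>)"
    if "r \<in> carrier R" for f r using that by (auto simp: free_module_def)
  have n: "(f \<oplus>\<^bsub>free_module R (Suc n)\<^esub> g) n = f n \<oplus>\<^bsub>R\<^esub> g n" "(s \<odot>\<^bsub>free_module R (Suc n)\<^esub> f) n = s \<otimes>\<^bsub>R\<^esub> f n" for f g s
    by (auto simp: free_module_def)
  have pc: "p f \<in> carrier M" if "f \<in> carrier (free_module R n)" for f using module_homD(1)[OF assms(2) that] .
  show "q \<in> module_hom R (free_module R (Suc n)) M"
    unfolding module_hom_def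
    using assms(3) r c pc module_homD(2,3)[OF assms(2)]
    by (auto simp: q_def add sm n M.smult_l_distr M.smult_r_distr M.smult_assoc1 M.a_ac)
  have z: "\<zero>\<^bsub>free_module R n\<^esub> = (\<lambda>i. \<zero>\<^bsub>R\<^esub>)" by (simp add: free_module_def)
  have p0: "p (\<lambda>i. \<zero>\<^bsub>R\<^esub>) = \<zero>\<^bsub>M\<^esub>"
    using module_hom_zero[OF module_free[OF R] assms(1,2)] z by simp
  have "a \<in> q ` carrier (free_module R (Suc n))"
    by (rule image_eqI[of _ _ "(\<lambda>i. \<zero>\<^bsub>R\<^esub>)(n := \<one>\<^bsub>R\<^esub>)"])
      (auto simp: q_def p0 assms(3) free_module_def fun_upd_idem)
  moreover have "p f \<in> q ` carrier (free_module R (Suc n))" if f: "f \<in> carrier (free_module R n)" for f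
  proof (rule image_eqI)
    have "f n = \<zero>\<^bsub>R\<^esub>" using f by (simp add: free_module_def)
    moreover then have "f(n := \<zero>\<^bsub>R\<^esub>) = f" by auto
    ultimately show "p f = q f" using assms(3) pc[OF f] by (simp add: q_def)
    show "f \<in> carrier (free_module R (Suc n))" using f \<open>f n = \<zero>\<^bsub>R\<^esub>\<close> unfolding free_module_def
      by (auto simp: less_Suc_eq)
  qed
  ultimately show "insert a (p ` carrier (free_module R n)) \<subseteq> q ` carrier (free_module R (Suc n))" by auto
qed

lemma free_cover:
  assumes "module R M" "submodule H R M" "finite A" "A \<subseteq> H"
  shows "\<exists>n. \<exists>p \<in> module_hom R (free_module R n) M. A \<subseteq> p ` carrier (free_module R n) \<and> p ` carrier (free_module R n) \<subseteq> H"
  using assms(3,4)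
proof (induction A)
  case empty
  interpret M: module R M by fact
  show ?case
    by (intro exI[of _ 0] bexI[of _ "\<lambda>_. \<zero>\<^bsub>M\<^esub>"]) (auto simp: module_hom_def submoduleD[OF assms(1,2)])
next
  case (insert a A)
  interpret M: module R M by fact
  have R: "cring R" ..
  from insert obtain n p where p: "p \<in> module_hom R (free_module R n) M"
    "A \<subseteq> p ` carrier (free_module R n)" "p ` carrier (free_module R n) \<subseteq> H" by auto
  have a: "a \<in> carrier M" using insert.prems submoduleD[OF assms(1,2)] by auto
  note q = free_hom_extend[OF assms(1) p(1) a]
  have r: "f(n := \<zero>\<^bsub>R\<^esub>) \<in> carrier (free_module R n)" "f n \<in> carrier R" if "f \<in> carrier (free_module R (Suc n))" for f
    using that by (auto simp: free_module_def)
  show ?case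
  proof (intro exI bexI conjI)
    show "(\<lambda>f. p (f(n := \<zero>\<^bsub>R\<^esub>)) \<oplus>\<^bsub>M\<^esub> f n \<odot>\<^bsub>M\<^esub> a) ` carrier (free_module R (Suc n)) \<subseteq> H"
      using r p(3) insert.prems by (auto intro!: submoduleD(3,4)[OF assms(1,2)])
    show "insert a A \<subseteq> (\<lambda>f. p (f(n := \<zero>\<^bsub>R\<^esub>)) \<oplus>\<^bsub>M\<^esub> f n \<odot>\<^bsub>M\<^esub> a) ` carrier (free_module R (Suc n))"
      using q(2) p(2) by auto
  qed (rule q(1))
qed

lemma fg_cover:
  assumes "cring R" "finitely_generated_module R M"
  shows "\<exists>n. \<exists>p \<in> module_hom R (free_module R n) M. p ` carrier (free_module R n) = carrier M"
proof -
  from assms obtain A where M: "module R M" and A: "A \<subseteq> carrier M" "finite A" "submodule_span R M A = carrier M"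
    by (auto simp: finitely_generated_module_def)
  have "submodule (carrier M) R M" using M by (rule module.carrier_is_submodule)
  from free_cover[OF M this A(2,1)] obtain n p where p: "p \<in> module_hom R (free_module R n) M"
    "A \<subseteq> p ` carrier (free_module R n)" "p ` carrier (free_module R n) \<subseteq> carrier M" by auto
  with submodule_span_least[OF submodule_image[OF module_free[OF assms(1)] M p(1)] p(2)] A(3)
  show ?thesis by auto
qed

lemma free_last_ideal:
  assumes "cring R" "submodule K R (free_module R (Suc n))"
  shows "ideal ((\<lambda>f. f n) ` K) R"
    and "\<And>f. f \<in> K \<Longrightarrow> (\<ominus>\<^bsub>free_module R (Suc n)\<^esub> f) n = \<ominus>\<^bsub>R\<^esub> f n"
proof -
  interpret cring R by fact
  interpret F: module R "free_module R (Suc n)" using module_free[OF assms(1)] .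
  note F = module_free[OF assms(1), of "Suc n"]
  note K = submoduleD[OF F assms(2)]
  define J where "J = (\<lambda>f. f n) ` K"
  have n: "(f \<oplus>\<^bsub>free_module R (Suc n)\<^esub> g) n = f n \<oplus>\<^bsub>R\<^esub> g n" "(s \<odot>\<^bsub>free_module R (Suc n)\<^esub> f) n = s \<otimes>\<^bsub>R\<^esub> f n"
     "\<zero>\<^bsub>free_module R (Suc n)\<^esub> n = \<zero>\<^bsub>R\<^esub>" for f g s
    by (auto simp: free_module_def)
  have cn: "f n \<in> carrier R" if "f \<in> K" for f using that K(1) free_carrierD[OF assms(1)] by blast
  have neg: "(\<ominus>\<^bsub>free_module R (Suc n)\<^esub> f) n = \<ominus>\<^bsub>R\<^esub> f n" if "f \<in> K" for f
  proof -
    have "(\<ominus>\<^bsub>free_module R (Suc n)\<^esub> f) n \<oplus>\<^bsub>R\<^esub> f n = \<zero>\<^bsub>R\<^esub>"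
      using n(1)[of "\<ominus>\<^bsub>free_module R (Suc n)\<^esub> f" f] F.l_neg[of f] that K(1) n(3) by auto
    then show ?thesis using cn[OF that] cn[OF K(5)[OF that]] by (simp add: minus_equality)
  qed
  show "\<And>f. f \<in> K \<Longrightarrow> (\<ominus>\<^bsub>free_module R (Suc n)\<^esub> f) n = \<ominus>\<^bsub>R\<^esub> f n" by (rule neg)
  have "ideal J R"
  proof (rule idealI)
    show "subgroup J (add_monoid R)"
    proof (rule add.subgroupI)
      show "J \<subseteq> carrier R" "J \<noteq> {}" using cn K(2) by (auto simp: J_def)
      show "\<ominus>\<^bsub>R\<^esub> a \<in> J" if "a \<in> J" for a using that unfolding J_def by (elim imageE) (metis K(5) neg imageI)
      show "a \<oplus>\<^bsub>R\<^esub> b \<in> J" if "a \<in> J" "b \<in> J" for a b using that unfolding J_def by (elim imageE) (metis K(3) n(1) imageI)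
    qed
    show l: "x \<otimes>\<^bsub>R\<^esub> a \<in> J" if "a \<in> J" "x \<in> carrier R" for a x using that unfolding J_def by (elim imageE) (metis K(4) n(2) imageI)
    show "a \<otimes>\<^bsub>R\<^esub> x \<in> J" if "a \<in> J" "x \<in> carrier R" for a x using l[OF that] that cn m_comm by (auto simp: J_def)
  qed (rule ring_axioms)
  then show "ideal ((\<lambda>f. f n) ` K) R" by (simp add: J_def)
qed

lemma free_submodule_fg:
  assumes "cring R" "noetherian_ring R" "submodule K R (free_module R n)"
  shows "\<exists>A. finite A \<and> A \<subseteq> K \<and> (\<forall>H. submodule H R (free_module R n) \<longrightarrow> A \<subseteq> H \<longrightarrow> K \<subseteq> H)"
  using assms(3)
proof (induction n arbitrary: K)
  case 0
  note K = submoduleD[OF module_free[OF assms(1)] 0]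
  have "carrier (free_module R 0) = {\<zero>\<^bsub>free_module R 0\<^esub>}" by (auto simp: free_module_def)
  then have "K \<subseteq> H" if "submodule H R (free_module R 0)" for H
    using K(1) submoduleD(2)[OF module_free[OF assms(1)] that] by auto
  then show ?case by (intro exI[of _ "{}"]) auto
next
  case (Suc n)
  interpret cring R by fact
  interpret F: module R "free_module R (Suc n)" using module_free[OF assms(1)] .
  note F = module_free[OF assms(1), of "Suc n"] and F' = module_free[OF assms(1), of n]
  note K = submoduleD[OF F Suc.prems]
  define K' where "K' = {f \<in> K. f n = \<zero>\<^bsub>R\<^esub>}"
  have sub: "carrier (free_module R n) \<subseteq> carrier (free_module R (Suc n))"
    by (auto simp: free_module_def less_Suc_eq)
  have ops: "add (free_module R n) = add (free_module R (Suc n))" "smult (free_module R n) = smult (free_module R (Suc n))"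
    "\<zero>\<^bsub>free_module R n\<^esub> = \<zero>\<^bsub>free_module R (Suc n)\<^esub>" by (auto simp: free_module_def)
  have n: "(f \<oplus>\<^bsub>free_module R (Suc n)\<^esub> g) n = f n \<oplus>\<^bsub>R\<^esub> g n" "(s \<odot>\<^bsub>free_module R (Suc n)\<^esub> f) n = s \<otimes>\<^bsub>R\<^esub> f n"
     "\<zero>\<^bsub>free_module R (Suc n)\<^esub> n = \<zero>\<^bsub>R\<^esub>" for f g s
    by (auto simp: free_module_def)
  have cn: "f n \<in> carrier R" if "f \<in> K" for f using that K(1) free_carrierD[OF assms(1)] by blast
  note neg = free_last_ideal(2)[OF assms(1) Suc.prems]
  have mem: "f \<in> carrier (free_module R n)" if "f \<in> carrier (free_module R (Suc n))" "f n = \<zero>\<^bsub>R\<^esub>" for f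
  proof -
    have "f i = \<zero>\<^bsub>R\<^esub>" if "i \<ge> n" for i
      using that \<open>f n = _\<close> \<open>f \<in> _\<close> by (cases "i = n") (auto simp: free_module_def)
    with that(1) show ?thesis by (simp add: free_module_def)
  qed
  have "submodule K' R (free_module R n)"
    by (rule submoduleI'[OF F']) (use K mem in \<open>auto simp: K'_def ops n\<close>)
  from Suc.IH[OF this] obtain A where A: "finite A" "A \<subseteq> K'"
    "\<And>H. submodule H R (free_module R n) \<Longrightarrow> A \<subseteq> H \<Longrightarrow> K' \<subseteq> H" by auto
  define J where "J = (\<lambda>f. f n) ` K"
  have "ideal J R" unfolding J_def by (rule free_last_ideal(1)[OF assms(1) Suc.prems])
  from noetherian_ring.finetely_gen[OF assms(2) this] obtain S where S: "S \<subseteq> carrier R" "finite S" "J = Idl\<^bsub>R\<^esub> S" by auto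
  have "S \<subseteq> (\<lambda>f. f n) ` K" using S genideal_self[OF S(1)] by (simp add: J_def)
  from finite_subset_image[OF S(2) this] obtain B where B: "B \<subseteq> K" "finite B" "S = (\<lambda>f. f n) ` B" by auto
  show ?case
  proof (intro exI[of _ "A \<union> B"] conjI allI impI)
    fix H assume H: "submodule H R (free_module R (Suc n))" "A \<union> B \<subseteq> H"
    note Hd = submoduleD[OF F H(1)]
    define L where "L = {f \<in> H. f n = \<zero>\<^bsub>R\<^esub> \<and> f \<in> K}"
    have "submodule L R (free_module R n)"
      by (rule submoduleI'[OF F']) (use K Hd mem in \<open>auto simp: L_def ops n\<close>)
    with A(3)[of L] A(2) H(2) have K': "K' \<subseteq> H" by (auto simp: L_def K'_def)
    let ?J = "(\<lambda>f. f n) ` (H \<inter> K)"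
    have "submodule (H \<inter> K) R (free_module R (Suc n))"
      by (rule submoduleI'[OF F]) (use K Hd in auto)
    from free_last_ideal(1)[OF assms(1) this] have "ideal ?J R" .
    then have "J \<subseteq> ?J" unfolding S(3) by (rule genideal_minimal) (use B H in auto)
    show "K \<subseteq> H"
    proof
      fix k assume k: "k \<in> K"
      then obtain h where h: "h \<in> H" "h \<in> K" "k n = h n" using \<open>J \<subseteq> ?J\<close> by (auto simp: J_def)
      let ?d = "k \<oplus>\<^bsub>free_module R (Suc n)\<^esub> (\<ominus>\<^bsub>free_module R (Suc n)\<^esub> h)"
      have "?d \<in> K'" using k h K(3,5) neg cn by (auto simp: K'_def n r_neg)
      then have "?d \<oplus>\<^bsub>free_module R (Suc n)\<^esub> h \<in> H" using K' h Hd(3) by auto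
      moreover have "?d \<oplus>\<^bsub>free_module R (Suc n)\<^esub> h = k"
        using k h K(1) by (simp add: F.a_assoc F.l_neg subset_iff)
      ultimately show "k \<in> H" by simp
    qed
  qed (use A B in \<open>auto simp: K'_def\<close>)
qed

lemma kernel_cover:
  assumes "cring R" "noetherian_ring R" "module R M" "p \<in> module_hom R (free_module R n) M"
  shows "\<exists>m. \<exists>q \<in> module_hom R (free_module R m) (free_module R n).
     a_kernel (free_module R n) M p = q ` carrier (free_module R m)"
proof -
  note F = module_free[OF assms(1)]
  interpret F: module R "free_module R n" by (rule F)
  interpret M: module R M by fact
  let ?K = "a_kernel (free_module R n) M p"
  have K: "submodule ?K R (free_module R n)"
    by (rule submoduleI'[OF F]) (auto simp: a_kernel_def kernel_def module_homD(2,3)[OF assms(4)]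
       module_hom_zero[OF F assms(3,4)])
  from free_submodule_fg[OF assms(1,2) this] obtain A where A: "finite A" "A \<subseteq> ?K"
    "\<And>H. submodule H R (free_module R n) \<Longrightarrow> A \<subseteq> H \<Longrightarrow> ?K \<subseteq> H" by auto
  from free_cover[OF F K A(1,2)] obtain m q where q: "q \<in> module_hom R (free_module R m) (free_module R n)"
    "A \<subseteq> q ` carrier (free_module R m)" "q ` carrier (free_module R m) \<subseteq> ?K" by auto
  with A(3)[OF submodule_image[OF F F q(1)] q(2)] show ?thesis by blast
qed

lemma finite_free_resolution_exists:
  assumes "cring R" "noetherian_ring R" "finitely_generated_module R L"
  shows "\<exists>n \<delta> \<epsilon>. finite_free_resolution R L n \<delta> \<epsilon>"
proof -
  have L: "module R L" using assms(3) by (simp add: finitely_generated_module_def)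
  from fg_cover[OF assms(1,3)] obtain n0 \<epsilon> where e: "\<epsilon> \<in> module_hom R (free_module R n0) L"
    "\<epsilon> ` carrier (free_module R n0) = carrier L" by auto
  from kernel_cover[OF assms(1,2) L e(1)] obtain n1 d0 where d0: "d0 \<in> module_hom R (free_module R n1) (free_module R n0)"
    "a_kernel (free_module R n0) L \<epsilon> = d0 ` carrier (free_module R n1)" by auto
  define P where "P = (\<lambda>(i::nat) (a, b, d). d \<in> module_hom R (free_module R b) (free_module R a)
     \<and> (i = 0 \<longrightarrow> a = n0 \<and> b = n1 \<and> d = d0))"
  have "\<exists>f. \<forall>i. P i (f i) \<and>
     (case (f i, f (Suc i)) of ((a, b, d), (a', b', d')) \<Rightarrow>
        a' = b \<and> a_kernel (free_module R b) (free_module R a) d = d' ` carrier (free_module R b'))"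
  proof (rule dependent_nat_choice)
    show "\<exists>x. P 0 x" using d0 by (auto simp: P_def)
  next
    fix x i assume "P i x"
    then obtain a b d where x: "x = (a, b, d)" "d \<in> module_hom R (free_module R b) (free_module R a)"
      by (cases x) (auto simp: P_def)
    from kernel_cover[OF assms(1,2) module_free[OF assms(1)] x(2)]
    obtain c q where "q \<in> module_hom R (free_module R c) (free_module R b)"
       "a_kernel (free_module R b) (free_module R a) d = q ` carrier (free_module R c)" by auto
    then show "\<exists>y. P (Suc i) y \<and> (case (x, y) of ((a, b, d), (a', b', d')) \<Rightarrow>
        a' = b \<and> a_kernel (free_module R b) (free_module R a) d = d' ` carrier (free_module R b'))"
      by (intro exI[of _ "(b, c, q)"]) (auto simp: x P_def)
  qed
  then obtain f where f0: "\<forall>i. P i (f i) \<and>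
     (case (f i, f (Suc i)) of ((a, b, d), (a', b', d')) \<Rightarrow>
        a' = b \<and> a_kernel (free_module R b) (free_module R a) d = d' ` carrier (free_module R b'))" ..
  note f = conjunct1[OF spec[OF f0]] conjunct2[OF spec[OF f0]]
  define n where "n i = fst (f i)" for i
  define \<delta> where "\<delta> i = snd (snd (f i))" for i
  have b: "fst (snd (f i)) = n (Suc i)" for i using f(2)[of i] by (auto simp: n_def split: prod.splits)
  have fi: "f i = (n i, n (Suc i), \<delta> i)" for i
    using b[of i] by (simp add: n_def \<delta>_def prod_eq_iff)
  have P: "P i (n i, n (Suc i), \<delta> i)" for i using f(1)[of i] unfolding fi .
  have "\<delta> i \<in> module_hom R (free_module R (n (Suc i))) (free_module R (n i))" for i
    using P[of i] unfolding P_def by simp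
  moreover have "a_kernel (free_module R (n (Suc i))) (free_module R (n i)) (\<delta> i)
           = \<delta> (Suc i) ` carrier (free_module R (n (Suc (Suc i))))" for i
    using f(2)[of i] unfolding fi by simp
  moreover have "n 0 = n0" "n 1 = n1" "\<delta> 0 = d0"
    using P[of 0] unfolding P_def by simp_all
  ultimately have "finite_free_resolution R L n \<delta> \<epsilon>"
    using e d0 by (simp add: finite_free_resolution_def)
  then show ?thesis by blast
qed

end

theory Submission
  imports Defs
begin

text \<open>
  Write $E^j(N) = \mathrm{Ext}^j(R/\mathfrak a, N)$. Over a Noetherian ring the modules
  $\Gamma_{\mathfrak a}(I^i)$ satisfy Baer's criterion, so $E^j$ vanishes on them for $j > 0$.
  Dimension shifting along cocycles and coboundaries of $\Gamma_{\mathfrak a}(I^\bullet)$ and along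
  the cosyzygies of \<open>M\<close> shows that $E^0(H^t)$ is finitely generated as soon as all $E^j(H^i)$ with
  $i < t$ are. An Artinian module \<open>N\<close> with $E^0(N)$ finitely generated has all $E^j(N)$ finitely
  generated, by induction on the number of generators of the ideal that do not act nilpotently.

  Maps that depend on choices, such as connecting homomorphisms, are replaced by linear relations.
\<close>

section \<open>Linear relations and homomorphisms\<close>

text \<open>The sequence Hom(R/a, Z^t) -> Hom(R/a, H^t) -> Ext^1(R/a, B^t), with Z^t and B^t the
  cocycles and coboundaries of the torsion complex, does not settle degree zero by itself: for t > 0
  the module Hom(R/a, Z^t) depends on the resolution and need not be finitely generated. Only its
  image in Hom(R/a, H^t) is under control. A map R/a -> Z^t determines a class in Ext^1(R/a,
  Omega^(t-1)); if the class vanishes, the map lifts to I^(t-1) with values killed by the ideal,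
  hence torsion, and their images under the differential are coboundaries. For this reason
  \<open>ext_fg_extension\<close> and \<open>ext_fg_quotient\<close> take a set \<open>T\<close>
  bounding an image where a textbook sequence has a whole Ext module. The choice \<open>T\<close> =
  \<open>ext_B\<close> covers the other use, multiplication by an element that annihilates Ext.

  Finiteness of Ext is stated on the cochains Hom(F j, N) of one fixed resolution, as cocycles
  modulo coboundaries. All exact sequences then reduce to \<open>fg_mod_rel\<close>, where
  Noetherianness enters through submodules of R^n.\<close>

definition linear_rel ::
    "('a, 'r) ring_scheme \<Rightarrow> ('a, 'b, 'm) module_scheme \<Rightarrow> ('a, 'c, 'n) module_scheme
      \<Rightarrow> ('b \<Rightarrow> 'c \<Rightarrow> bool) \<Rightarrow> bool"
  where "linear_rel R M N \<rho> \<longleftrightarrow>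
    (\<forall>x y. \<rho> x y \<longrightarrow> x \<in> carrier M \<and> y \<in> carrier N) \<and>
    (\<forall>x y x' y'. \<rho> x y \<longrightarrow> \<rho> x' y' \<longrightarrow> \<rho> (x \<oplus>\<^bsub>M\<^esub> x') (y \<oplus>\<^bsub>N\<^esub> y')) \<and>
    (\<forall>r\<in>carrier R. \<forall>x y. \<rho> x y \<longrightarrow> \<rho> (r \<odot>\<^bsub>M\<^esub> x) (r \<odot>\<^bsub>N\<^esub> y))"

lemma linear_relD:
  assumes "linear_rel R M N \<rho>" "\<rho> x y"
  shows "x \<in> carrier M" "y \<in> carrier N"
    and "\<rho> x' y' \<Longrightarrow> \<rho> (x \<oplus>\<^bsub>M\<^esub> x') (y \<oplus>\<^bsub>N\<^esub> y')"
    and "r \<in> carrier R \<Longrightarrow> \<rho> (r \<odot>\<^bsub>M\<^esub> x) (r \<odot>\<^bsub>N\<^esub> y)"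
  using assms unfolding linear_rel_def by blast+

lemma linear_relI:
  assumes "\<And>x y. \<rho> x y \<Longrightarrow> x \<in> carrier M \<and> y \<in> carrier N"
    and "\<And>x y x' y'. \<rho> x y \<Longrightarrow> \<rho> x' y' \<Longrightarrow> \<rho> (x \<oplus>\<^bsub>M\<^esub> x') (y \<oplus>\<^bsub>N\<^esub> y')"
    and "\<And>r x y. r \<in> carrier R \<Longrightarrow> \<rho> x y \<Longrightarrow> \<rho> (r \<odot>\<^bsub>M\<^esub> x) (r \<odot>\<^bsub>N\<^esub> y)"
  shows "linear_rel R M N \<rho>"
  using assms unfolding linear_rel_def by blast

lemma module_neg_eq_smult:
  assumes "module R M" "x \<in> carrier M"
  shows "\<ominus>\<^bsub>M\<^esub> x = (\<ominus>\<^bsub>R\<^esub> \<one>\<^bsub>R\<^esub>) \<odot>\<^bsub>M\<^esub> x"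
proof -
  interpret module R M by fact
  show ?thesis using assms(2) by (simp add: smult_l_minus)
qed

lemma linear_rel_diff:
  assumes "module R M" "module R N" "linear_rel R M N \<rho>" "\<rho> x y" "\<rho> x' y'"
  shows "\<rho> (x \<ominus>\<^bsub>M\<^esub> x') (y \<ominus>\<^bsub>N\<^esub> y')"
proof -
  interpret M: module R M by fact
  have "\<rho> ((\<ominus>\<^bsub>R\<^esub> \<one>\<^bsub>R\<^esub>) \<odot>\<^bsub>M\<^esub> x') ((\<ominus>\<^bsub>R\<^esub> \<one>\<^bsub>R\<^esub>) \<odot>\<^bsub>N\<^esub> y')"
    by (rule linear_relD(4)[OF assms(3,5)]) simp
  then show ?thesis
    using linear_relD[OF assms(3,5)] linear_relD(3)[OF assms(3,4)]
    by (simp add: a_minus_def module_neg_eq_smult[OF assms(1)] module_neg_eq_smult[OF assms(2)])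
qed

text \<open>The empty relation counts as linear, so one related pair must be given; scaling it by
  zero produces the pair of zeros.\<close>

lemma linear_rel_zero:
  assumes "module R M" "module R N" "linear_rel R M N \<rho>" "\<rho> x y"
  shows "\<rho> \<zero>\<^bsub>M\<^esub> \<zero>\<^bsub>N\<^esub>"
proof -
  interpret M: module R M by fact
  interpret N: module R N by fact
  show ?thesis using linear_relD[OF assms(3,4)] linear_relD(4)[OF assms(3,4), of "\<zero>\<^bsub>R\<^esub>"] by simp
qed

lemma module_hom_diff:
  assumes "module R M" "module R N" "f \<in> module_hom R M N" "x \<in> carrier M" "y \<in> carrier M"
  shows "f (x \<ominus>\<^bsub>M\<^esub> y) = f x \<ominus>\<^bsub>N\<^esub> f y"
proof -
  \<comment> \<open>The difference rule for relations is applied to the graph of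
    \<open>f\<close>.\<close>
  have "linear_rel R M N (\<lambda>x y. x \<in> carrier M \<and> y = f x)"
    using assms(1) by (intro linear_relI)
      (auto simp: module_homD[OF assms(3)] module.smult_closed abelian_monoid.a_closed
        module.axioms(2) abelian_group.axioms(1))
  from linear_rel_diff[OF assms(1,2) this, of x "f x" y "f y"] assms(4,5) show ?thesis by simp
qed

lemma module_hom_comp:
  assumes "f \<in> module_hom R M N" "g \<in> module_hom R N P"
  shows "(\<lambda>x. g (f x)) \<in> module_hom R M P"
  using module_homD[OF assms(1)] module_homD[OF assms(2)] by (auto simp: module_hom_def)

lemma module_hom_id: "(\<lambda>x. x) \<in> module_hom R M M"
  by (auto simp: module_hom_def)

lemma module_hom_smult:
  assumes "module R M" "r \<in> carrier R"
  shows "(\<lambda>x. r \<odot>\<^bsub>M\<^esub> x) \<in> module_hom R M M"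
proof -
  interpret module R M by fact
  show ?thesis using assms(2)
    by (auto simp: module_hom_def smult_r_distr smult_assoc1[symmetric] m_comm)
qed

lemma module_hom_add:
  assumes "module R M" "module R N" "f \<in> module_hom R M N" "g \<in> module_hom R M N"
  shows "(\<lambda>x. f x \<oplus>\<^bsub>N\<^esub> g x) \<in> module_hom R M N"
proof -
  interpret N: module R N by fact
  show ?thesis using module_homD[OF assms(3)] module_homD[OF assms(4)]
    by (auto simp: module_hom_def N.smult_r_distr N.a_ac)
qed

lemma module_hom_minus:
  assumes "module R M" "module R N" "f \<in> module_hom R M N" "g \<in> module_hom R M N"
  shows "(\<lambda>x. f x \<ominus>\<^bsub>N\<^esub> g x) \<in> module_hom R M N"
proof -
  interpret M: module R M by fact
  interpret N: module R N by fact
  have "(\<lambda>x. (\<ominus>\<^bsub>R\<^esub> \<one>\<^bsub>R\<^esub>) \<odot>\<^bsub>N\<^esub> g x) \<in> module_hom R M N"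
    by (rule module_hom_comp[OF assms(4) module_hom_smult[OF assms(2)]]) simp
  from module_hom_add[OF assms(1,2,3) this] have "(\<lambda>x. f x \<oplus>\<^bsub>N\<^esub> (\<ominus>\<^bsub>R\<^esub> \<one>\<^bsub>R\<^esub>) \<odot>\<^bsub>N\<^esub> g x) \<in> module_hom R M N" .
  then show ?thesis
    using module_neg_eq_smult[OF assms(2)] module_homD(1)[OF assms(4)] M.a_closed M.smult_closed
    by (simp add: module_hom_def Pi_iff a_minus_def)
qed

lemma submodule_module:
  assumes "module R M" "submodule H R M"
  shows "module R (M\<lparr>carrier := H\<rparr>)"
  by (rule submodule.submodule_is_module[OF assms(2,1)])

lemma submodule_diff:
  assumes "module R M" "submodule H R M" "x \<in> H" "y \<in> H"
  shows "x \<ominus>\<^bsub>M\<^esub> y \<in> H"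
  using submoduleD[OF assms(1,2)] assms(3,4) by (simp add: a_minus_def)

lemma module_hom_carrier_update:
  "f \<in> module_hom R M (N\<lparr>carrier := K\<rparr>) \<longleftrightarrow>
     (\<forall>x\<in>carrier M. f x \<in> K) \<and>
     (\<forall>x\<in>carrier M. \<forall>y\<in>carrier M. f (x \<oplus>\<^bsub>M\<^esub> y) = f x \<oplus>\<^bsub>N\<^esub> f y) \<and>
     (\<forall>r\<in>carrier R. \<forall>x\<in>carrier M. f (r \<odot>\<^bsub>M\<^esub> x) = r \<odot>\<^bsub>N\<^esub> f x)"
  by (auto simp: module_hom_def)

text \<open>A submodule is turned into a module by replacing the carrier and keeping the operations,
  so being a submodule does not depend on the ambient module.\<close>

lemma submodule_carrier_update:
  assumes "module R M" "submodule K R M" "W \<subseteq> K"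
  shows "submodule W R (M\<lparr>carrier := K\<rparr>) \<longleftrightarrow> submodule W R M"
proof
  assume W: "submodule W R M"
  show "submodule W R (M\<lparr>carrier := K\<rparr>)"
    by (rule submoduleI'[OF submodule_module[OF assms(1,2)]])
      (use submoduleD[OF assms(1) W] assms(3) in auto)
next
  assume W: "submodule W R (M\<lparr>carrier := K\<rparr>)"
  show "submodule W R M"
    by (rule submoduleI'[OF assms(1)])
      (use submoduleD[OF submodule_module[OF assms(1,2)] W] submoduleD(1)[OF assms(1,2)] in auto)
qed

lemma submodule_zero:
  assumes "module R M" shows "submodule {\<zero>\<^bsub>M\<^esub>} R M"
proof -
  interpret module R M by fact
  show ?thesis by (rule submoduleI'[OF assms]) auto
qed

lemma submodule_preimage:
  assumes "module R M" "module R N" "f \<in> module_hom R M N" "submodule H R N"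
  shows "submodule {x \<in> carrier M. f x \<in> H} R M"
proof -
  interpret module R M by fact
  show ?thesis using submoduleD[OF assms(2,4)] module_homD[OF assms(3)] module_hom_zero[OF assms(1-3)]
    by (intro submoduleI'[OF assms(1)]) auto
qed

lemma submodule_kernel:
  assumes "module R M" "module R N" "f \<in> module_hom R M N"
  shows "submodule {x \<in> carrier M. f x = \<zero>\<^bsub>N\<^esub>} R M"
  using submodule_preimage[OF assms submodule_zero[OF assms(2)]] by simp

lemma submodule_Int:
  assumes "module R M" "submodule H R M" "submodule K R M"
  shows "submodule (H \<inter> K) R M"
  by (rule submoduleI'[OF assms(1)])
    (use submoduleD[OF assms(1,2)] submoduleD[OF assms(1,3)] in auto)

section \<open>Maps out of free modules\<close>

definition unit_vec :: "('a, 'r) ring_scheme \<Rightarrow> nat \<Rightarrow> nat \<Rightarrow> 'a"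
  where "unit_vec R n = (\<lambda>i. \<zero>\<^bsub>R\<^esub>)(n := \<one>\<^bsub>R\<^esub>)"

lemma free_ops:
  "add (free_module R n) = (\<lambda>f g i. f i \<oplus>\<^bsub>R\<^esub> g i)"
  "smult (free_module R n) = (\<lambda>r f i. r \<otimes>\<^bsub>R\<^esub> f i)"
  "\<zero>\<^bsub>free_module R n\<^esub> = (\<lambda>i. \<zero>\<^bsub>R\<^esub>)"
  by (auto simp: free_module_def)

text \<open>Sequences that vanish from index \<open>n\<close> on also vanish from
  \<open>Suc n\<close> on, so R^n is literally a subset of R^(n+1) with the same operations, and
  \<open>unit_vec R n\<close> is the new basis vector. Inductions on the rank rest on this
  splitting.\<close>

lemma free_Suc:
  assumes "cring R"
  shows "carrier (free_module R n) \<subseteq> carrier (free_module R (Suc n))"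
    and "unit_vec R n \<in> carrier (free_module R (Suc n))"
    and "v \<in> carrier (free_module R (Suc n)) \<Longrightarrow> v(n := \<zero>\<^bsub>R\<^esub>) \<in> carrier (free_module R n)"
    and "v \<in> carrier (free_module R n) \<Longrightarrow> v n = \<zero>\<^bsub>R\<^esub>"
    and "v \<in> carrier (free_module R (Suc n)) \<Longrightarrow>
      v = v(n := \<zero>\<^bsub>R\<^esub>) \<oplus>\<^bsub>free_module R (Suc n)\<^esub> v n \<odot>\<^bsub>free_module R (Suc n)\<^esub> unit_vec R n"
proof -
  interpret cring R by fact
  show "carrier (free_module R n) \<subseteq> carrier (free_module R (Suc n))"
    by (auto simp: free_module_def less_Suc_eq)
  show "unit_vec R n \<in> carrier (free_module R (Suc n))"
    by (auto simp: free_module_def unit_vec_def)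
  show "v(n := \<zero>\<^bsub>R\<^esub>) \<in> carrier (free_module R n)" if "v \<in> carrier (free_module R (Suc n))"
    using that by (auto simp: free_module_def)
  show "v n = \<zero>\<^bsub>R\<^esub>" if "v \<in> carrier (free_module R n)" using that by (auto simp: free_module_def)
  show "v = v(n := \<zero>\<^bsub>R\<^esub>) \<oplus>\<^bsub>free_module R (Suc n)\<^esub> v n \<odot>\<^bsub>free_module R (Suc n)\<^esub> unit_vec R n"
    if v: "v \<in> carrier (free_module R (Suc n))"
    using free_carrierD[OF assms v] by (auto simp: free_ops unit_vec_def fun_eq_iff)
qed

lemma module_hom_free_Suc:
  assumes "cring R" "q \<in> module_hom R (free_module R (Suc n)) N"
  shows "q \<in> module_hom R (free_module R n) N"
    and "v \<in> carrier (free_module R (Suc n)) \<Longrightarrow> q v = q (v(n := \<zero>\<^bsub>R\<^esub>)) \<oplus>\<^bsub>N\<^esub> v n \<odot>\<^bsub>N\<^esub> q (unit_vec R n)"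
proof -
  note s = free_Suc[OF assms(1), where n=n]
  show "q \<in> module_hom R (free_module R n) N"
    using module_homD[OF assms(2)] s(1) unfolding module_hom_def
    by (auto simp: free_ops subset_iff)
  assume v: "v \<in> carrier (free_module R (Suc n))"
  have m: "module R (free_module R (Suc n))" by (rule module_free[OF assms(1)])
  have "q v = q (v(n := \<zero>\<^bsub>R\<^esub>) \<oplus>\<^bsub>free_module R (Suc n)\<^esub> v n \<odot>\<^bsub>free_module R (Suc n)\<^esub> unit_vec R n)"
    using s(5)[OF v] by simp
  also have "\<dots> = q (v(n := \<zero>\<^bsub>R\<^esub>)) \<oplus>\<^bsub>N\<^esub> v n \<odot>\<^bsub>N\<^esub> q (unit_vec R n)"
    using module_homD[OF assms(2)] s(1-3) v free_carrierD[OF assms(1) v] module.smult_closed[OF m]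
    by (auto simp: subset_iff)
  finally show "q v = q (v(n := \<zero>\<^bsub>R\<^esub>)) \<oplus>\<^bsub>N\<^esub> v n \<odot>\<^bsub>N\<^esub> q (unit_vec R n)" .
qed

text \<open>Projectivity of R^n for relations: \<open>\<rho>\<close> plays the role of a surjection
  onto the values of \<open>q\<close>. Related elements are chosen for the basis vectors, and
  linearity of \<open>\<rho>\<close> keeps all combinations related.\<close>

lemma free_lift:
  assumes "module R N" "module R N'" "linear_rel R N N' \<rho>"
    and "q \<in> module_hom R (free_module R n) N'"
    and "\<And>v. v \<in> carrier (free_module R n) \<Longrightarrow> \<exists>z. \<rho> z (q v)"
  shows "\<exists>p \<in> module_hom R (free_module R n) N. \<forall>v\<in>carrier (free_module R n). \<rho> (p v) (q v)"
  using assms(4,5)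
proof (induction n)
  interpret N: module R N by fact
  have R: "cring R" ..
  case 0
  have F: "carrier (free_module R 0) = {\<zero>\<^bsub>free_module R 0\<^esub>}" by (auto simp: free_module_def)
  from 0(2)[of "\<zero>\<^bsub>free_module R 0\<^esub>"] F obtain z where "\<rho> z (q \<zero>\<^bsub>free_module R 0\<^esub>)" by auto
  from linear_rel_zero[OF assms(1-3) this] have "\<rho> \<zero>\<^bsub>N\<^esub> (q \<zero>\<^bsub>free_module R 0\<^esub>)"
    using module_hom_zero[OF module_free[OF R] assms(2) 0(1)] by simp
  then show ?case
    by (intro bexI[of _ "\<lambda>_. \<zero>\<^bsub>N\<^esub>"]) (auto simp: F module_hom_def)
next
  interpret N: module R N by fact
  have R: "cring R" ..
  case (Suc n)
  note s = free_Suc[OF R, where n=n]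
  from Suc.IH[OF module_hom_free_Suc(1)[OF R Suc.prems(1)]] Suc.prems(2) s(1)
  obtain p where p: "p \<in> module_hom R (free_module R n) N" "\<forall>v\<in>carrier (free_module R n). \<rho> (p v) (q v)"
    by (auto simp: subset_iff)
  from Suc.prems(2)[OF s(2)] obtain z where z: "\<rho> z (q (unit_vec R n))" by auto
  have zc: "z \<in> carrier N" by (rule linear_relD(1)[OF assms(3) z])
  show ?case
  proof (intro bexI[OF _ free_hom_extend(1)[OF assms(1) p(1) zc]] ballI)
    fix v assume v: "v \<in> carrier (free_module R (Suc n))"
    show "\<rho> (p (v(n := \<zero>\<^bsub>R\<^esub>)) \<oplus>\<^bsub>N\<^esub> v n \<odot>\<^bsub>N\<^esub> z) (q v)"
      unfolding module_hom_free_Suc(2)[OF R Suc.prems(1) v]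
      using p(2) s(3)[OF v] linear_relD(3)[OF assms(3)] linear_relD(4)[OF assms(3) z] free_carrierD[OF R v]
      by blast
  qed
qed

text \<open>Cutting a vector of R^(m+n) after \<open>m\<close> coordinates lets two families of
  generators be used together.\<close>

lemma free_append:
  assumes "module R N" "p \<in> module_hom R (free_module R m) N" "q \<in> module_hom R (free_module R n) N"
  shows "\<exists>s\<in>module_hom R (free_module R (m + n)) N.
    s ` carrier (free_module R (m + n)) =
      {x \<oplus>\<^bsub>N\<^esub> y | x y. x \<in> p ` carrier (free_module R m) \<and> y \<in> q ` carrier (free_module R n)}"
proof -
  interpret N: module R N by fact
  have R: "cring R" ..
  define a where "a v = (\<lambda>i::nat. if i < m then v i else \<zero>\<^bsub>R\<^esub>)" for v
  define b where "b v = (\<lambda>i::nat. v (m + i) :: 'a)" for v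
  have a: "a \<in> module_hom R (free_module R (m + n)) (free_module R m)"
    by (auto simp: module_hom_def a_def free_module_def fun_eq_iff)
  have b: "b \<in> module_hom R (free_module R (m + n)) (free_module R n)"
    by (auto simp: module_hom_def b_def free_module_def fun_eq_iff)
  have s: "(\<lambda>v. p (a v) \<oplus>\<^bsub>N\<^esub> q (b v)) \<in> module_hom R (free_module R (m + n)) N"
    by (rule module_hom_add[OF module_free[OF R] assms(1) module_hom_comp[OF a assms(2)] module_hom_comp[OF b assms(3)]])
  show ?thesis
  proof (intro bexI[OF _ s] equalityI subsetI)
    fix z assume "z \<in> (\<lambda>v. p (a v) \<oplus>\<^bsub>N\<^esub> q (b v)) ` carrier (free_module R (m + n))"
    then show "z \<in> {x \<oplus>\<^bsub>N\<^esub> y | x y. x \<in> p ` carrier (free_module R m) \<and> y \<in> q ` carrier (free_module R n)}"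
      using module_homD(1)[OF a] module_homD(1)[OF b] by blast
  next
    fix z assume "z \<in> {x \<oplus>\<^bsub>N\<^esub> y | x y. x \<in> p ` carrier (free_module R m) \<and> y \<in> q ` carrier (free_module R n)}"
    then obtain u w where u: "u \<in> carrier (free_module R m)" and w: "w \<in> carrier (free_module R n)"
      and z: "z = p u \<oplus>\<^bsub>N\<^esub> q w" by auto
    define v where "v = (\<lambda>i. if i < m then u i else w (i - m))"
    have "v \<in> carrier (free_module R (m + n))" "a v = u" "b v = w"
      using u w by (auto simp: v_def a_def b_def free_module_def fun_eq_iff)
    then show "z \<in> (\<lambda>v. p (a v) \<oplus>\<^bsub>N\<^esub> q (b v)) ` carrier (free_module R (m + n))" using z by force
  qed
qed

section \<open>Finite generation modulo a submodule\<close>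

text \<open>For submodules \<open>B \<subseteq> Z\<close> this says that \<open>Z / B\<close> is finitely generated.\<close>

definition fg_mod ::
    "('a, 'r) ring_scheme \<Rightarrow> ('a, 'b, 'm) module_scheme \<Rightarrow> 'b set \<Rightarrow> 'b set \<Rightarrow> bool"
  where "fg_mod R M Z B \<longleftrightarrow>
    (\<exists>n. \<exists>p \<in> module_hom R (free_module R n) M.
       p ` carrier (free_module R n) \<subseteq> Z \<and>
       (\<forall>z\<in>Z. \<exists>v\<in>carrier (free_module R n). \<exists>b\<in>B. z = p v \<oplus>\<^bsub>M\<^esub> b))"

lemma fg_modE:
  assumes "fg_mod R M Z B"
  obtains n p where "p \<in> module_hom R (free_module R n) M" "p ` carrier (free_module R n) \<subseteq> Z"
    "\<And>z. z \<in> Z \<Longrightarrow> \<exists>v\<in>carrier (free_module R n). \<exists>b\<in>B. z = p v \<oplus>\<^bsub>M\<^esub> b"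
  using assms unfolding fg_mod_def by (elim exE bexE conjE) (rule that, assumption+, erule bspec)

lemma fg_mod_carrier_update:
  assumes "Z \<subseteq> K" "K \<subseteq> carrier M"
  shows "fg_mod R (M\<lparr>carrier := K\<rparr>) Z B \<longleftrightarrow> fg_mod R M Z B"
proof
  assume "fg_mod R (M\<lparr>carrier := K\<rparr>) Z B"
  then obtain n p where p: "p \<in> module_hom R (free_module R n) (M\<lparr>carrier := K\<rparr>)"
     "p ` carrier (free_module R n) \<subseteq> Z \<and>
       (\<forall>z\<in>Z. \<exists>v\<in>carrier (free_module R n). \<exists>b\<in>B. z = p v \<oplus>\<^bsub>M\<^esub> b)" unfolding fg_mod_def by auto
  from p(1) assms have "p \<in> module_hom R (free_module R n) M" unfolding module_hom_def by auto
  with p(2) show "fg_mod R M Z B" unfolding fg_mod_def by blast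
next
  assume "fg_mod R M Z B"
  then obtain n p where p: "p \<in> module_hom R (free_module R n) M"
     "p ` carrier (free_module R n) \<subseteq> Z \<and>
       (\<forall>z\<in>Z. \<exists>v\<in>carrier (free_module R n). \<exists>b\<in>B. z = p v \<oplus>\<^bsub>M\<^esub> b)" unfolding fg_mod_def by auto
  from p assms have "p \<in> module_hom R (free_module R n) (M\<lparr>carrier := K\<rparr>)" unfolding module_hom_def by auto
  with p(2) show "fg_mod R (M\<lparr>carrier := K\<rparr>) Z B" unfolding fg_mod_def by auto
qed

lemma fg_mod_self:
  assumes "module R M" "submodule B R M"
  shows "fg_mod R M B B"
proof -
  interpret module R M by fact
  note B = submoduleD[OF assms]
  have "(\<lambda>_. \<zero>\<^bsub>M\<^esub>) \<in> module_hom R (free_module R 0) M" by (auto simp: module_hom_def)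
  moreover have "z = \<zero>\<^bsub>M\<^esub> \<oplus>\<^bsub>M\<^esub> z" if "z \<in> B" for z using that B by auto
  ultimately show ?thesis using B unfolding fg_mod_def
    by (intro exI[of _ 0] bexI[of _ "\<lambda>_. \<zero>\<^bsub>M\<^esub>"]) (auto simp: free_module_def intro!: exI[of _ "\<lambda>_. \<zero>\<^bsub>R\<^esub>"])
qed

lemma submodule_cover:
  assumes "cring R" "noetherian_ring R" "submodule K R (free_module R n)"
  shows "\<exists>m. \<exists>q \<in> module_hom R (free_module R m) (free_module R n). q ` carrier (free_module R m) = K"
proof -
  note F = module_free[OF assms(1)]
  from free_submodule_fg[OF assms] obtain A where A: "finite A" "A \<subseteq> K"
    "\<And>H. submodule H R (free_module R n) \<Longrightarrow> A \<subseteq> H \<Longrightarrow> K \<subseteq> H" by auto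
  from free_cover[OF F assms(3) A(1,2)] obtain m q where q: "q \<in> module_hom R (free_module R m) (free_module R n)"
    "A \<subseteq> q ` carrier (free_module R m)" "q ` carrier (free_module R m) \<subseteq> K" by auto
  with A(3)[OF submodule_image[OF F F q(1)] q(2)] show ?thesis by blast
qed

text \<open>\<open>\<rho>\<close> acts as a map from Z to Z'/B' whose kernel lies in Y + B. Its
  image is a submodule of a finitely generated module over a Noetherian ring; preimages of
  generators of the image, together with generators of Y modulo B, generate Z modulo B.\<close>

lemma fg_mod_rel:
  fixes R :: "('a, 'r) ring_scheme" and C :: "('a, 'b, 'm) module_scheme" and C' :: "('a, 'c, 'n) module_scheme"
  assumes R: "cring R" "noetherian_ring R"
    and mods: "module R C" "module R C'"
    and sub: "submodule Z R C" "submodule B R C" "submodule Y R C" "submodule B' R C'"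
    and fg: "fg_mod R C Y B" "fg_mod R C' Z' B'"
    and YZ: "Y \<subseteq> Z"
    and rel: "linear_rel R C C' \<rho>"
    and total: "\<And>z. z \<in> Z \<Longrightarrow> \<exists>z'\<in>Z'. \<rho> z z'"
    and ker: "\<And>z b'. z \<in> Z \<Longrightarrow> \<rho> z b' \<Longrightarrow> b' \<in> B' \<Longrightarrow> \<exists>y\<in>Y. \<exists>b\<in>B. z = y \<oplus>\<^bsub>C\<^esub> b"
  shows "fg_mod R C Z B"
proof -
  interpret C: module R C by (rule mods(1))
  interpret C': module R C' by (rule mods(2))
  note Z = submoduleD[OF mods(1) sub(1)] and B = submoduleD[OF mods(1) sub(2)]
    and Y = submoduleD[OF mods(1) sub(3)] and B' = submoduleD[OF mods(2) sub(4)]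
  from fg(2) obtain n p' where p': "p' \<in> module_hom R (free_module R n) C'"
     "p' ` carrier (free_module R n) \<subseteq> Z'"
     "\<And>z. z\<in>Z' \<Longrightarrow> \<exists>v\<in>carrier (free_module R n). \<exists>b\<in>B'. z = p' v \<oplus>\<^bsub>C'\<^esub> b"
    by (rule fg_modE) (rule that)
  interpret F: module R "free_module R n" by (rule module_free[OF R(1)])
  \<comment> \<open>\<open>\<tau>\<close> attaches to \<open>z\<close> the coordinate vectors
    \<open>v\<close> that describe some \<open>\<rho>\<close>-image of \<open>z\<close> modulo B',
    moving the problem into R^n.\<close>
  define \<tau> where "\<tau> z v \<longleftrightarrow> z \<in> Z \<and> v \<in> carrier (free_module R n) \<and> (\<exists>b\<in>B'. \<rho> z (p' v \<oplus>\<^bsub>C'\<^esub> b))" for z v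
  have lin: "linear_rel R C (free_module R n) \<tau>"
  proof (rule linear_relI)
    fix x y assume "\<tau> x y" then show "x \<in> carrier C \<and> y \<in> carrier (free_module R n)" using Z by (auto simp: \<tau>_def)
  next
    fix x y x' y' assume 1: "\<tau> x y" "\<tau> x' y'"
    then obtain b b' where b: "b \<in> B'" "\<rho> x (p' y \<oplus>\<^bsub>C'\<^esub> b)" "b' \<in> B'" "\<rho> x' (p' y' \<oplus>\<^bsub>C'\<^esub> b')" by (auto simp: \<tau>_def)
    have "\<rho> (x \<oplus>\<^bsub>C\<^esub> x') ((p' y \<oplus>\<^bsub>C'\<^esub> b) \<oplus>\<^bsub>C'\<^esub> (p' y' \<oplus>\<^bsub>C'\<^esub> b'))"
      by (rule linear_relD(3)[OF rel b(2,4)])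
    also have "(p' y \<oplus>\<^bsub>C'\<^esub> b) \<oplus>\<^bsub>C'\<^esub> (p' y' \<oplus>\<^bsub>C'\<^esub> b') = p' (y \<oplus>\<^bsub>free_module R n\<^esub> y') \<oplus>\<^bsub>C'\<^esub> (b \<oplus>\<^bsub>C'\<^esub> b')"
    proof -
      have "p' y \<in> carrier C'" "p' y' \<in> carrier C'" "b \<in> carrier C'" "b' \<in> carrier C'"
        "p' (y \<oplus>\<^bsub>free_module R n\<^esub> y') = p' y \<oplus>\<^bsub>C'\<^esub> p' y'"
        using 1 b B'(1) module_homD(1,2)[OF p'(1)] by (auto simp: \<tau>_def)
      then show ?thesis by (simp add: C'.a_ac)
    qed
    finally show "\<tau> (x \<oplus>\<^bsub>C\<^esub> x') (y \<oplus>\<^bsub>free_module R n\<^esub> y')"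
      using 1 b Z B' by (auto simp: \<tau>_def)
  next
    fix r x y assume r: "r \<in> carrier R" and 1: "\<tau> x y"
    then obtain b where b: "b \<in> B'" "\<rho> x (p' y \<oplus>\<^bsub>C'\<^esub> b)" by (auto simp: \<tau>_def)
    have "\<rho> (r \<odot>\<^bsub>C\<^esub> x) (r \<odot>\<^bsub>C'\<^esub> (p' y \<oplus>\<^bsub>C'\<^esub> b))" by (rule linear_relD(4)[OF rel b(2) r])
    also have "r \<odot>\<^bsub>C'\<^esub> (p' y \<oplus>\<^bsub>C'\<^esub> b) = p' (r \<odot>\<^bsub>free_module R n\<^esub> y) \<oplus>\<^bsub>C'\<^esub> r \<odot>\<^bsub>C'\<^esub> b"
      using r 1 b B'(1) module_homD(1,3)[OF p'(1)] by (auto simp: \<tau>_def C'.smult_r_distr)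
    finally show "\<tau> (r \<odot>\<^bsub>C\<^esub> x) (r \<odot>\<^bsub>free_module R n\<^esub> y)"
      using r 1 b Z B' by (auto simp: \<tau>_def)
  qed
  \<comment> \<open>The vectors that occur form a submodule of R^n, hence the image of some R^m; its
    covering map is then lifted back into Z along \<open>\<tau>\<close>.\<close>
  define K where "K = {v. \<exists>z. \<tau> z v}"
  have tot: "\<exists>v. \<tau> z v" if z: "z \<in> Z" for z
    using total[OF z] p'(3) z unfolding \<tau>_def by metis
  have "submodule K R (free_module R n)"
  proof (rule submoduleI'[OF module_free[OF R(1)]])
    show "K \<subseteq> carrier (free_module R n)" by (auto simp: K_def \<tau>_def)
    show "\<zero>\<^bsub>free_module R n\<^esub> \<in> K"
      using linear_rel_zero[OF mods(1) module_free[OF R(1)] lin] tot[OF Z(2)] by (auto simp: K_def)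
    show "a \<oplus>\<^bsub>free_module R n\<^esub> b \<in> K" if "a \<in> K" "b \<in> K" for a b
      using that linear_relD(3)[OF lin] by (auto simp: K_def) blast
    show "a \<odot>\<^bsub>free_module R n\<^esub> b \<in> K" if "a \<in> carrier R" "b \<in> K" for a b
      using that linear_relD(4)[OF lin] by (auto simp: K_def)
  qed
  from submodule_cover[OF R this] obtain m q where q: "q \<in> module_hom R (free_module R m) (free_module R n)"
    "q ` carrier (free_module R m) = K" by auto
  from free_lift[OF mods(1) module_free[OF R(1)] lin q(1)] q(2) obtain P where
    P: "P \<in> module_hom R (free_module R m) C" "\<And>w. w \<in> carrier (free_module R m) \<Longrightarrow> \<tau> (P w) (q w)"
    by (auto simp: K_def)
  from fg(1) obtain l p where p: "p \<in> module_hom R (free_module R l) C" "p ` carrier (free_module R l) \<subseteq> Y"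
     "\<And>z. z\<in>Y \<Longrightarrow> \<exists>v\<in>carrier (free_module R l). \<exists>b\<in>B. z = p v \<oplus>\<^bsub>C\<^esub> b"
    by (rule fg_modE) (rule that)
  from free_append[OF mods(1) P(1) p(1)] obtain s where s: "s\<in>module_hom R (free_module R (m + l)) C"
    "s ` carrier (free_module R (m + l)) =
      {x \<oplus>\<^bsub>C\<^esub> y | x y. x \<in> P ` carrier (free_module R m) \<and> y \<in> p ` carrier (free_module R l)}" by auto
  have PZ: "P w \<in> Z" if "w \<in> carrier (free_module R m)" for w using P(2)[OF that] by (simp add: \<tau>_def)
  have "s ` carrier (free_module R (m + l)) \<subseteq> Z"
    unfolding s(2) using PZ p(2) YZ Z(3) by blast
  moreover have "\<exists>v\<in>carrier (free_module R (m + l)). \<exists>b\<in>B. z = s v \<oplus>\<^bsub>C\<^esub> b" if z: "z \<in> Z" for z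
  proof -
    from tot[OF z] obtain v where v: "\<tau> z v" ..
    then have "v \<in> K" by (auto simp: K_def)
    then obtain w where w: "w \<in> carrier (free_module R m)" "v = q w" using q(2) by auto
    \<comment> \<open>\<open>z\<close> and its approximation \<open>P w\<close> have the same
      coordinate vector, so their difference is \<open>\<tau>\<close>-related to zero, that is,
      \<open>\<rho>\<close>-related to an element of B'. This is the situation of
      \<open>ker\<close>.\<close>
    from linear_rel_diff[OF mods(1) module_free[OF R(1)] lin, OF v P(2)[OF w(1)]] w(2) v
    have "\<tau> (z \<ominus>\<^bsub>C\<^esub> P w) \<zero>\<^bsub>free_module R n\<^esub>"
      by (simp add: a_minus_def F.r_neg \<tau>_def)
    then obtain b' where "z \<ominus>\<^bsub>C\<^esub> P w \<in> Z" "b' \<in> B'" "\<rho> (z \<ominus>\<^bsub>C\<^esub> P w) b'"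
      using module_hom_zero[OF module_free[OF R(1)] mods(2) p'(1)] B'(1) by (auto simp: \<tau>_def)
    from ker[OF this(1,3,2)] obtain y b where y: "y \<in> Y" "b \<in> B" "z \<ominus>\<^bsub>C\<^esub> P w = y \<oplus>\<^bsub>C\<^esub> b" by auto
    from p(3)[OF y(1)] obtain u c where u: "u \<in> carrier (free_module R l)" "c \<in> B" "y = p u \<oplus>\<^bsub>C\<^esub> c" by auto
    have c: "z \<in> carrier C" "P w \<in> carrier C" "p u \<in> carrier C" "c \<in> carrier C" "b \<in> carrier C"
      using z Z(1) PZ[OF w(1)] module_homD(1)[OF p(1) u(1)] u y B(1) by auto
    have "z = (z \<ominus>\<^bsub>C\<^esub> P w) \<oplus>\<^bsub>C\<^esub> P w" using c by (simp add: a_minus_def C.a_assoc C.l_neg)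
    also have "\<dots> = (P w \<oplus>\<^bsub>C\<^esub> p u) \<oplus>\<^bsub>C\<^esub> (c \<oplus>\<^bsub>C\<^esub> b)" unfolding y(3) u(3) using c by (simp add: C.a_ac)
    finally have eq: "z = (P w \<oplus>\<^bsub>C\<^esub> p u) \<oplus>\<^bsub>C\<^esub> (c \<oplus>\<^bsub>C\<^esub> b)" .
    have "P w \<oplus>\<^bsub>C\<^esub> p u \<in> s ` carrier (free_module R (m + l))" unfolding s(2) using w u by blast
    then obtain x where "x \<in> carrier (free_module R (m + l))" "P w \<oplus>\<^bsub>C\<^esub> p u = s x" by auto
    with eq B(3)[OF u(2) y(2)] show ?thesis by auto
  qed
  ultimately show ?thesis unfolding fg_mod_def using s(1) by blast
qed

text \<open>Subquotients stay finitely generated: the identity maps Z' to Z/B, and whatever it sends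
  to zero already lies in B'.\<close>

lemma fg_mod_mono:
  assumes "cring R" "noetherian_ring R" "module R C"
    and "submodule Z R C" "submodule Z' R C" "submodule B R C" "submodule B' R C"
    and "fg_mod R C Z B" "Z' \<subseteq> Z" "B \<subseteq> B'"
  shows "fg_mod R C Z' B'"
proof -
  interpret module R C by fact
  note Z' = submoduleD[OF assms(3,5)] and B' = submoduleD[OF assms(3,7)]
  have i: "submodule (Z' \<inter> B') R C" by (rule submodule_Int[OF assms(3,5,7)])
  have "fg_mod R C (Z' \<inter> B') B'"
    unfolding fg_mod_def
  proof (intro exI[of _ 0] bexI[of _ "\<lambda>_. \<zero>\<^bsub>C\<^esub>"] conjI ballI)
    fix z assume z: "z \<in> Z' \<inter> B'"
    then have "z = \<zero>\<^bsub>C\<^esub> \<oplus>\<^bsub>C\<^esub> z" using B'(1) by auto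
    then show "\<exists>v\<in>carrier (free_module R 0). \<exists>b\<in>B'. z = \<zero>\<^bsub>C\<^esub> \<oplus>\<^bsub>C\<^esub> b"
      using z by (auto simp: free_module_def intro!: exI[of _ "\<lambda>_. \<zero>\<^bsub>R\<^esub>"])
  qed (use Z' B' in \<open>auto simp: module_hom_def\<close>)
  then show ?thesis
  proof (rule fg_mod_rel[OF assms(1,2,3,3,5,7) i assms(6) _ assms(8),
        where \<rho>="\<lambda>x y. x = y \<and> x \<in> carrier C"])
    show "linear_rel R C C (\<lambda>x y. x = y \<and> x \<in> carrier C)" by (rule linear_relI) auto
    show "\<exists>y\<in>Z' \<inter> B'. \<exists>b\<in>B'. z = y \<oplus>\<^bsub>C\<^esub> b" if "z \<in> Z'" "z = b' \<and> z \<in> carrier C" "b' \<in> B" for z b'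
      using that assms(10) B'(2) by (intro bexI[of _ z] bexI[of _ "\<zero>\<^bsub>C\<^esub>"]) auto
  qed (use Z' assms(9) in auto)
qed

text \<open>Exactness at the middle term Z/B. The relation \<open>\<rho>\<close> runs from the
  middle back to the first term, as an inverse of the incoming map, and \<open>bd\<close> says that
  this incoming map sends boundaries to boundaries. The result on kernels is applied twice: to the
  part \<open>Y\<close> of Z reached by \<open>\<rho>\<close>, and then to Z with kernel controlled
  by \<open>Y\<close>.\<close>

lemma fg_mod_exact:
  fixes R :: "('a, 'r) ring_scheme" and C1 :: "('a, 'b, 'm) module_scheme"
    and C :: "('a, 'c, 'n) module_scheme" and C2 :: "('a, 'd, 'k) module_scheme"
  assumes R: "cring R" "noetherian_ring R"
    and mods: "module R C1" "module R C" "module R C2"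
    and sub: "submodule Z R C" "submodule B R C" "submodule Z1 R C1" "submodule B1 R C1" "submodule B2 R C2"
    and fg: "fg_mod R C1 Z1 B1" "fg_mod R C2 Z2 B2"
    and rel: "linear_rel R C C1 \<rho>" "linear_rel R C C2 \<sigma>"
    and total: "\<And>z. z \<in> Z \<Longrightarrow> \<exists>z'\<in>Z2. \<sigma> z z'"
    and ker: "\<And>z b'. z \<in> Z \<Longrightarrow> \<sigma> z b' \<Longrightarrow> b' \<in> B2 \<Longrightarrow>
      \<exists>y\<in>Z. \<exists>b\<in>B. \<exists>z1\<in>Z1. z = y \<oplus>\<^bsub>C\<^esub> b \<and> \<rho> y z1"
    and bd: "\<And>y b1. y \<in> Z \<Longrightarrow> \<rho> y b1 \<Longrightarrow> b1 \<in> B1 \<Longrightarrow> y \<in> B"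
  shows "fg_mod R C Z B"
proof (cases "\<exists>y\<in>Z. \<exists>z1\<in>Z1. \<rho> y z1")
  case True
  interpret C: module R C by (rule mods(2))
  note Z = submoduleD[OF mods(2) sub(1)] and B = submoduleD[OF mods(2) sub(2)]
    and Z1 = submoduleD[OF mods(1) sub(3)]
  define Y where "Y = {y \<in> Z. \<exists>z1\<in>Z1. \<rho> y z1}"
  from True obtain y0 z0 where "\<rho> y0 z0" by auto
  from linear_rel_zero[OF mods(2,1) rel(1) this] have z: "\<rho> \<zero>\<^bsub>C\<^esub> \<zero>\<^bsub>C1\<^esub>" .
  have Y: "submodule Y R C"
  proof (rule submoduleI'[OF mods(2)])
    show "a \<oplus>\<^bsub>C\<^esub> b \<in> Y" if "a \<in> Y" "b \<in> Y" for a b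
      using that linear_relD(3)[OF rel(1)] Z(3) Z1(3) unfolding Y_def by blast
    show "a \<odot>\<^bsub>C\<^esub> b \<in> Y" if "a \<in> carrier R" "b \<in> Y" for a b
      using that linear_relD(4)[OF rel(1)] Z(4) Z1(4) unfolding Y_def by blast
  qed (use Z Z1 z in \<open>auto simp: Y_def\<close>)
  have z0: "submodule {\<zero>\<^bsub>C\<^esub>} R C" by (rule submodule_zero[OF mods(2)])
  have z1: "fg_mod R C {\<zero>\<^bsub>C\<^esub>} {\<zero>\<^bsub>C\<^esub>}" by (rule fg_mod_self[OF mods(2) z0])
  then have "fg_mod R C {\<zero>\<^bsub>C\<^esub>} B" using B(2) unfolding fg_mod_def by blast
  then have "fg_mod R C Y B"
  proof (rule fg_mod_rel[OF R mods(2,1) Y sub(2) z0 sub(4) _ fg(1)])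
    show "linear_rel R C C1 \<rho>" by (rule rel(1))
    show "\<exists>z'\<in>Z1. \<rho> z z'" if "z \<in> Y" for z using that by (auto simp: Y_def)
    show "\<exists>y\<in>{\<zero>\<^bsub>C\<^esub>}. \<exists>b\<in>B. z = y \<oplus>\<^bsub>C\<^esub> b" if "z \<in> Y" "\<rho> z b'" "b' \<in> B1" for z b'
      using bd[of z b'] that Z(1) by (intro bexI[of _ "\<zero>\<^bsub>C\<^esub>"] bexI[of _ z]) (auto simp: Y_def)
  qed (use Y submoduleD(2)[OF mods(2) Y] in auto)
  then show ?thesis
  proof (rule fg_mod_rel[OF R mods(2,3) sub(1,2) Y sub(5) _ fg(2)])
    show "\<exists>y\<in>Y. \<exists>b\<in>B. z = y \<oplus>\<^bsub>C\<^esub> b" if "z \<in> Z" "\<sigma> z b'" "b' \<in> B2" for z b'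
      using ker[OF that] by (auto simp: Y_def)
  qed (use rel(2) total in \<open>auto simp: Y_def\<close>)
next
  \<comment> \<open>Here \<open>\<rho>\<close> relates nothing in Z to Z1, yet \<open>ker\<close>
    applied to the element zero produces such a pair.\<close>
  case False
  interpret C2: module R C2 by (rule mods(3))
  note Z = submoduleD[OF mods(2) sub(1)]
  from total[OF Z(2)] obtain z' where "\<sigma> \<zero>\<^bsub>C\<^esub> z'" by auto
  from linear_rel_zero[OF mods(2,3) rel(2) this] have "\<sigma> \<zero>\<^bsub>C\<^esub> \<zero>\<^bsub>C2\<^esub>" .
  from ker[OF Z(2) this] submoduleD(2)[OF mods(3) sub(5)] False show ?thesis by blast
qed

text \<open>Links spans in a quotient with \<open>fg_mod\<close>. In one direction a free cover of
  the quotient lifts along the relation between elements and their cosets; in the other, generators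
  of R^n are pushed into the quotient.\<close>

lemma fg_mod_quotient:
  assumes "cring R" "noetherian_ring R" "module R M" "submodule H R M"
  shows "finitely_generated_module R (quotient_module R M H) \<longleftrightarrow> fg_mod R M (carrier M) H"
proof
  interpret M: module R M by fact
  interpret H: submodule H R M by fact
  have H: "subgroup H (add_monoid M)" ..
  interpret A: abelian_subgroup H M
    by (rule abelian_subgroupI3) (auto intro: additive_subgroup.intro H M.abelian_group_axioms)
  let ?Q = "quotient_module R M H"
  have Q: "module R ?Q" by (rule module_quotient[OF assms(3,4)])
  have car: "carrier ?Q = (\<lambda>x. H +>\<^bsub>M\<^esub> x) ` carrier M"
    by (auto simp: quotient_module_def A_RCOSETS_def')
  have qadd: "(H +>\<^bsub>M\<^esub> x) \<oplus>\<^bsub>?Q\<^esub> (H +>\<^bsub>M\<^esub> y) = H +>\<^bsub>M\<^esub> (x \<oplus>\<^bsub>M\<^esub> y)" if "x \<in> carrier M" "y \<in> carrier M" for x y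
    using that A.a_rcos_sum by (simp add: quotient_module_def)
  note qs = quotient_smult[OF assms(3,4)]
  {
    assume "finitely_generated_module R ?Q"
    from fg_cover[OF assms(1) this] obtain n p where p: "p \<in> module_hom R (free_module R n) ?Q"
      "p ` carrier (free_module R n) = carrier ?Q" by auto
    have "linear_rel R M ?Q (\<lambda>x y. x \<in> carrier M \<and> y = H +>\<^bsub>M\<^esub> x)"
      by (rule linear_relI) (auto simp: car qadd qs)
    moreover have "\<exists>z. z \<in> carrier M \<and> p v = H +>\<^bsub>M\<^esub> z" if "v \<in> carrier (free_module R n)" for v
      using module_homD(1)[OF p(1) that] car by auto
    ultimately obtain P where P: "P \<in> module_hom R (free_module R n) M"
      "\<And>v. v \<in> carrier (free_module R n) \<Longrightarrow> P v \<in> carrier M \<and> p v = H +>\<^bsub>M\<^esub> P v"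
      using free_lift[OF assms(3) Q _ p(1), of "\<lambda>x y. x \<in> carrier M \<and> y = H +>\<^bsub>M\<^esub> x"] by blast
    have *: "\<exists>v\<in>carrier (free_module R n). \<exists>b\<in>H. z = P v \<oplus>\<^bsub>M\<^esub> b" if z: "z \<in> carrier M" for z
    proof -
      have "H +>\<^bsub>M\<^esub> z \<in> p ` carrier (free_module R n)" unfolding p(2) car using z by (rule imageI)
      then obtain v where v: "v \<in> carrier (free_module R n)" "H +>\<^bsub>M\<^esub> z = p v" by (elim imageE)
      have "z \<in> H +>\<^bsub>M\<^esub> P v" using A.a_rcos_self[OF z] v P(2) by auto
      then obtain h where "h \<in> H" "z = h \<oplus>\<^bsub>M\<^esub> P v" by (auto simp: a_r_coset_def')
      with v P(2)[OF v(1)] A.a_subset have "z = P v \<oplus>\<^bsub>M\<^esub> h" by (auto simp: M.a_comm)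
      with v(1) \<open>h \<in> H\<close> show ?thesis by blast
    qed
    have "P ` carrier (free_module R n) \<subseteq> carrier M" using P by auto
    with P(1) * show "fg_mod R M (carrier M) H" unfolding fg_mod_def by blast
  next
    assume "fg_mod R M (carrier M) H"
    then obtain n p where p: "p \<in> module_hom R (free_module R n) M"
      "p ` carrier (free_module R n) \<subseteq> carrier M"
      "\<And>z. z \<in> carrier M \<Longrightarrow> \<exists>v\<in>carrier (free_module R n). \<exists>b\<in>H. z = p v \<oplus>\<^bsub>M\<^esub> b" by (rule fg_modE) (rule that)
    define q where "q v = H +>\<^bsub>M\<^esub> p v" for v
    have q: "q \<in> module_hom R (free_module R n) ?Q"
      using module_homD[OF p(1)] by (auto simp: module_hom_def car q_def qadd qs)
    have "H +>\<^bsub>M\<^esub> z \<in> q ` carrier (free_module R n)" if z: "z \<in> carrier M" for z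
    proof -
      from p(3)[OF z] obtain v b where v: "v \<in> carrier (free_module R n)" "b \<in> H" "z = p v \<oplus>\<^bsub>M\<^esub> b" by auto
      with module_homD(1)[OF p(1) v(1)] A.a_subset have "z = b \<oplus>\<^bsub>M\<^esub> p v" by (auto simp: M.a_comm)
      then have "z \<in> H +>\<^bsub>M\<^esub> p v" using v by (auto simp: a_r_coset_def')
      from M.a_repr_independence[OF this _ H] module_homD(1)[OF p(1) v(1)] v(1) show ?thesis by (auto simp: q_def)
    qed
    then have surj: "q ` carrier (free_module R n) = carrier ?Q"
      using module_homD(1)[OF q] car by auto
    note F = module_free[OF assms(1), of n]
    \<comment> \<open>Finitely many generators of R^n come from the result on its submodules,
      applied to all of R^n.\<close>
    from free_submodule_fg[OF assms(1,2) module.carrier_is_submodule[OF F]] obtain A where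
      A: "finite A" "A \<subseteq> carrier (free_module R n)"
        "\<And>K. submodule K R (free_module R n) \<Longrightarrow> A \<subseteq> K \<Longrightarrow> carrier (free_module R n) \<subseteq> K" by auto
    have "carrier ?Q \<subseteq> K" if K: "submodule K R ?Q" "q ` A \<subseteq> K" for K
    proof -
      have "carrier (free_module R n) \<subseteq> {x \<in> carrier (free_module R n). q x \<in> K}"
        by (rule A(3)[OF submodule_preimage[OF F Q q K(1)]]) (use A(2) K(2) in auto)
      then show ?thesis unfolding surj[symmetric] by auto
    qed
    then have "submodule_span R ?Q (q ` A) = carrier ?Q"
      using surj A(2) module.carrier_is_submodule[OF Q] module_homD(1)[OF q]
      unfolding submodule_span_def by (intro equalityI Inter_lower Inter_greatest) auto
    then show "finitely_generated_module R ?Q" unfolding finitely_generated_module_def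
      using Q A module_homD(1)[OF q] by (intro conjI exI[of _ "q ` A"]) auto
  }
qed

lemma fg_mod_module:
  assumes "cring R" "finitely_generated_module R M"
  shows "fg_mod R M (carrier M) {\<zero>\<^bsub>M\<^esub>}"
proof -
  interpret M: module R M using assms(2) by (simp add: finitely_generated_module_def)
  from fg_cover[OF assms] obtain n p where p: "p \<in> module_hom R (free_module R n) M"
    "p ` carrier (free_module R n) = carrier M" by auto
  have "\<exists>v\<in>carrier (free_module R n). \<exists>b\<in>{\<zero>\<^bsub>M\<^esub>}. z = p v \<oplus>\<^bsub>M\<^esub> b" if z: "z \<in> carrier M" for z
  proof -
    from z p obtain v where "v \<in> carrier (free_module R n)" "z = p v" by auto
    then show ?thesis using z by (intro bexI[of _ v]) auto
  qed
  then show ?thesis unfolding fg_mod_def using p by blast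
qed

lemma fg_mod_zero:
  assumes "module R C" "\<zero>\<^bsub>C\<^esub> \<in> B"
  shows "fg_mod R C {\<zero>\<^bsub>C\<^esub>} B"
  using fg_mod_self[OF assms(1) submodule_zero[OF assms(1)]] assms(2) unfolding fg_mod_def by blast

lemma fg_mod_image:
  assumes "module R C" "\<phi> \<in> module_hom R C C'" "fg_mod R C Z B" "\<phi> ` B \<subseteq> B'"
    and "Z \<subseteq> carrier C" "B \<subseteq> carrier C"
  shows "fg_mod R C' (\<phi> ` Z) B'"
proof -
  from assms(3) obtain n p where p: "p \<in> module_hom R (free_module R n) C"
    "p ` carrier (free_module R n) \<subseteq> Z"
    "\<And>z. z\<in>Z \<Longrightarrow> \<exists>v\<in>carrier (free_module R n). \<exists>b\<in>B. z = p v \<oplus>\<^bsub>C\<^esub> b"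
    by (rule fg_modE) (rule that)
  have "\<exists>v\<in>carrier (free_module R n). \<exists>b\<in>B'. \<phi> z = \<phi> (p v) \<oplus>\<^bsub>C'\<^esub> b" if z: "z \<in> Z" for z
  proof -
    from p(3)[OF z] obtain v b where v: "v \<in> carrier (free_module R n)" "b \<in> B" "z = p v \<oplus>\<^bsub>C\<^esub> b" by auto
    then have "\<phi> z = \<phi> (p v) \<oplus>\<^bsub>C'\<^esub> \<phi> b"
      using module_homD(2)[OF assms(2)] module_homD(1)[OF p(1)] assms(6) by auto
    then show ?thesis using v assms(4) by blast
  qed
  then show ?thesis unfolding fg_mod_def
    using p(2) by (intro exI[of _ n] bexI[OF _ module_hom_comp[OF p(1) assms(2)]]) auto
qed

section \<open>Modules of homomorphisms and maps out of free modules\<close>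

lemma Hom_carrier:
  "f \<in> carrier (Hom_module R M N) \<longleftrightarrow> f \<in> module_hom R M N \<and> f \<in> extensional (carrier M)"
  by (auto simp: Hom_module_def)

lemma Hom_ops:
  "f \<oplus>\<^bsub>Hom_module R M N\<^esub> g = (\<lambda>x\<in>carrier M. f x \<oplus>\<^bsub>N\<^esub> g x)"
  "r \<odot>\<^bsub>Hom_module R M N\<^esub> f = (\<lambda>x\<in>carrier M. r \<odot>\<^bsub>N\<^esub> f x)"
  "\<zero>\<^bsub>Hom_module R M N\<^esub> = (\<lambda>x\<in>carrier M. \<zero>\<^bsub>N\<^esub>)"
  by (simp_all add: Hom_module_def)

lemma Hom_apply:
  assumes "x \<in> carrier M"
  shows "(f \<oplus>\<^bsub>Hom_module R M N\<^esub> g) x = f x \<oplus>\<^bsub>N\<^esub> g x"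
    and "(r \<odot>\<^bsub>Hom_module R M N\<^esub> f) x = r \<odot>\<^bsub>N\<^esub> f x"
    and "\<zero>\<^bsub>Hom_module R M N\<^esub> x = \<zero>\<^bsub>N\<^esub>"
  using assms by (simp_all add: Hom_ops)

lemma module_hom_cong:
  assumes "module R M" "f \<in> module_hom R M N" "\<And>x. x \<in> carrier M \<Longrightarrow> g x = f x"
  shows "g \<in> module_hom R M N"
proof -
  interpret module R M by fact
  show ?thesis using assms(2,3) by (auto simp: module_hom_def)
qed

lemma Hom_restrict:
  assumes "module R M" "f \<in> module_hom R M N"
  shows "restrict f (carrier M) \<in> carrier (Hom_module R M N)"
  using module_hom_cong[OF assms, of "restrict f (carrier M)"] by (simp add: Hom_carrier)

lemma Hom_diff:
  assumes "module R M" "module R N" "f \<in> carrier (Hom_module R M N)" "g \<in> carrier (Hom_module R M N)" "x \<in> carrier M"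
  shows "(f \<ominus>\<^bsub>Hom_module R M N\<^esub> g) x = f x \<ominus>\<^bsub>N\<^esub> g x"
proof -
  \<comment> \<open>Evaluation at \<open>x\<close> is itself a homomorphism, so it respects
    differences.\<close>
  have ev: "(\<lambda>f. f x) \<in> module_hom R (Hom_module R M N) N"
    using assms(5) by (auto simp: module_hom_def Hom_carrier Hom_ops)
  show ?thesis
    using module_hom_diff[OF module_Hom[OF assms(1,2)] assms(2) ev assms(3,4)] by simp
qed

lemma Hom_postcompose:
  assumes "module R M" "module R N" "p \<in> module_hom R N P"
  shows "(\<lambda>f. \<lambda>x\<in>carrier M. p (f x)) \<in> module_hom R (Hom_module R M N) (Hom_module R M P)"
proof -
  interpret M: module R M by fact
  interpret N: module R N by fact
  have "(\<lambda>x\<in>carrier M. p (f x)) \<in> carrier (Hom_module R M P)" if "f \<in> carrier (Hom_module R M N)" for f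
    using that module_hom_comp[OF _ assms(3), of f M] Hom_restrict[OF assms(1)] by (simp add: Hom_carrier)
  then show ?thesis
    using module_homD[OF assms(3)] unfolding module_hom_def
    by (auto simp: Hom_carrier Hom_ops fun_eq_iff module_homD restrict_def)
qed

lemma free_lift_surj:
  assumes "module R N" "module R P" "p \<in> module_hom R N P" "p ` carrier N = carrier P"
    and "g \<in> module_hom R (free_module R n) P"
  shows "\<exists>h\<in>module_hom R (free_module R n) N. \<forall>x\<in>carrier (free_module R n). p (h x) = g x"
proof -
  interpret N: module R N by fact
  have lin: "linear_rel R N P (\<lambda>x y. x \<in> carrier N \<and> y = p x)"
    by (rule linear_relI) (auto simp: module_homD[OF assms(3)])
  have "\<exists>z. z \<in> carrier N \<and> g v = p z" if "v \<in> carrier (free_module R n)" for v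
    using module_homD(1)[OF assms(5) that] assms(4) by auto
  from free_lift[OF assms(1,2) lin assms(5) this] show ?thesis by fastforce
qed

text \<open>Hom(R^n, N) is N^n; the induction uses 0 -> Hom(R^n, N) -> Hom(R^(n+1), N) -> N, whose
  last map evaluates at the new basis vector.\<close>

lemma fg_mod_Hom_free:
  assumes "cring R" "noetherian_ring R" "module R N" "fg_mod R N (carrier N) {\<zero>\<^bsub>N\<^esub>}"
  defines "H \<equiv> \<lambda>n. Hom_module R (free_module R n) N"
  shows "fg_mod R (H n) (carrier (H n)) {\<zero>\<^bsub>H n\<^esub>}"
proof (induction n)
  interpret N: module R N by fact
  note mF = module_free[OF assms(1)]
  have mH: "module R (H n)" for n unfolding H_def by (rule module_Hom[OF mF assms(3)])
  case 0
  have "carrier (H 0) = {\<zero>\<^bsub>H 0\<^esub>}"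
  proof -
    have F: "carrier (free_module R 0) = {\<zero>\<^bsub>free_module R 0\<^esub>}" by (auto simp: free_module_def)
    have "f = \<zero>\<^bsub>H 0\<^esub>" if f: "f \<in> carrier (H 0)" for f
    proof (rule ext)
      fix x show "f x = \<zero>\<^bsub>H 0\<^esub> x"
        using f module_hom_zero[OF mF assms(3), of f 0] unfolding H_def
        by (cases "x \<in> carrier (free_module R 0)") (auto simp: Hom_carrier Hom_ops F extensional_def)
    qed
    then show ?thesis using submoduleD(2)[OF mH module.carrier_is_submodule[OF mH]] by blast
  qed
  then show ?case using fg_mod_self[OF mH submodule_zero[OF mH], of 0] by simp
next
  interpret N: module R N by fact
  note mF = module_free[OF assms(1)]
  have mH: "module R (H n)" for n unfolding H_def by (rule module_Hom[OF mF assms(3)])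
  case (Suc n)
  note s = free_Suc[OF assms(1), where n=n]
  \<comment> \<open>\<open>r1\<close> inverts extension by zero in the last coordinate, and
    \<open>r2\<close> is evaluation at the last basis vector.\<close>
  define r1 where "r1 f g \<longleftrightarrow> f \<in> carrier (H (Suc n)) \<and> f (unit_vec R n) = \<zero>\<^bsub>N\<^esub> \<and>
    g = restrict f (carrier (free_module R n))" for f g
  define r2 where "r2 f u \<longleftrightarrow> f \<in> carrier (H (Suc n)) \<and> u = f (unit_vec R n)" for f u
  interpret F: module R "free_module R n" by (rule mF)
  interpret F': module R "free_module R (Suc n)" by (rule mF)
  have res: "restrict f (carrier (free_module R n)) \<in> carrier (H n)" if "f \<in> carrier (H (Suc n))" for f
  proof -
    have "f \<in> module_hom R (free_module R (Suc n)) N" using that by (simp add: H_def Hom_carrier)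
    from Hom_restrict[OF mF module_hom_free_Suc(1)[OF assms(1) this]] show ?thesis by (simp add: H_def)
  qed
  have ops: "x \<in> carrier (free_module R (Suc n)) \<Longrightarrow> (f \<oplus>\<^bsub>H (Suc n)\<^esub> g) x = f x \<oplus>\<^bsub>N\<^esub> g x"
     "x \<in> carrier (free_module R (Suc n)) \<Longrightarrow> (r \<odot>\<^bsub>H (Suc n)\<^esub> f) x = r \<odot>\<^bsub>N\<^esub> f x" for f g r x
    by (simp_all add: H_def Hom_ops)
  have m: "module R (H (Suc n))" "module R (H n)" by (rule mH)+
  show ?case
  proof (rule fg_mod_exact[OF assms(1,2) m(2,1) assms(3) module.carrier_is_submodule[OF m(1)]
        submodule_zero[OF m(1)] module.carrier_is_submodule[OF m(2)] submodule_zero[OF m(2)]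
        submodule_zero[OF assms(3)] Suc.IH assms(4), of r1 r2])
    show "linear_rel R (H (Suc n)) (H n) r1"
    proof (rule linear_relI)
      show "x \<in> carrier (H (Suc n)) \<and> y \<in> carrier (H n)" if "r1 x y" for x y
        using that res by (auto simp: r1_def)
      show "r1 (x \<oplus>\<^bsub>H (Suc n)\<^esub> x') (y \<oplus>\<^bsub>H n\<^esub> y')" if "r1 x y" "r1 x' y'" for x y x' y'
        using that s(1,2) abelian_monoid.a_closed[OF abelian_group.axioms(1)[OF module.axioms(2)[OF m(1)]]]
        by (auto simp: r1_def ops subset_iff) (auto simp: H_def Hom_ops fun_eq_iff)
      show "r1 (r \<odot>\<^bsub>H (Suc n)\<^esub> x) (r \<odot>\<^bsub>H n\<^esub> y)" if "r \<in> carrier R" "r1 x y" for r x y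
        using that s(1,2) module.smult_closed[OF m(1)]
        by (auto simp: r1_def ops subset_iff) (auto simp: H_def Hom_ops fun_eq_iff)
    qed
    show "linear_rel R (H (Suc n)) N r2"
    proof (rule linear_relI)
      show "x \<in> carrier (H (Suc n)) \<and> y \<in> carrier N" if "r2 x y" for x y
        using that s(2) module_homD(1)[of x R "free_module R (Suc n)" N]
        by (auto simp: r2_def H_def Hom_carrier)
      show "r2 (x \<oplus>\<^bsub>H (Suc n)\<^esub> x') (y \<oplus>\<^bsub>N\<^esub> y')" if "r2 x y" "r2 x' y'" for x y x' y'
        using that s(2) abelian_monoid.a_closed[OF abelian_group.axioms(1)[OF module.axioms(2)[OF m(1)]]]
        by (auto simp: r2_def ops)
      show "r2 (r \<odot>\<^bsub>H (Suc n)\<^esub> x) (r \<odot>\<^bsub>N\<^esub> y)" if "r \<in> carrier R" "r2 x y" for r x y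
        using that s(2) module.smult_closed[OF m(1)] by (auto simp: r2_def ops)
    qed
    show "\<exists>z'\<in>carrier N. r2 z z'" if "z \<in> carrier (H (Suc n))" for z
      using that s(2) module_homD(1)[of z R "free_module R (Suc n)" N]
      by (auto simp: r2_def H_def Hom_carrier)
    fix z b' assume z: "z \<in> carrier (H (Suc n))"
    {
      assume "r2 z b'" "b' \<in> {\<zero>\<^bsub>N\<^esub>}"
      then have "r1 z (restrict z (carrier (free_module R n)))" by (auto simp: r1_def r2_def)
      moreover have "z = z \<oplus>\<^bsub>H (Suc n)\<^esub> \<zero>\<^bsub>H (Suc n)\<^esub>"
        using abelian_monoid.r_zero[OF abelian_group.axioms(1)[OF module.axioms(2)[OF m(1)]]] z by simp
      ultimately show "\<exists>y\<in>carrier (H (Suc n)). \<exists>b\<in>{\<zero>\<^bsub>H (Suc n)\<^esub>}. \<exists>z1\<in>carrier (H n). z = y \<oplus>\<^bsub>H (Suc n)\<^esub> b \<and> r1 y z1"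
        using z res[OF z] by blast
    }
  next
    fix y b1 assume y: "y \<in> carrier (H (Suc n))" "r1 y b1" "b1 \<in> {\<zero>\<^bsub>H n\<^esub>}"
    have y0: "y x = \<zero>\<^bsub>N\<^esub>" if "x \<in> carrier (free_module R n)" for x
      using y(2,3) that by (auto simp: r1_def H_def Hom_ops fun_eq_iff restrict_def split: if_splits)
    have yh: "y \<in> module_hom R (free_module R (Suc n)) N" "y \<in> extensional (carrier (free_module R (Suc n)))"
      using y(1) by (auto simp: H_def Hom_carrier)
    have "y x = \<zero>\<^bsub>N\<^esub>" if x: "x \<in> carrier (free_module R (Suc n))" for x
      using module_hom_free_Suc(2)[OF assms(1) yh(1) x] y0[OF s(3)[OF x]] y(2) free_carrierD[OF assms(1) x]
      by (simp add: r1_def)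
    then show "y \<in> {\<zero>\<^bsub>H (Suc n)\<^esub>}"
      using yh(2) by (auto simp: H_def Hom_ops fun_eq_iff extensional_def)
  qed
qed


section \<open>Cocycles of a resolution of $R/\mathfrak a$\<close>

text \<open>One resolution of R/a is fixed here and used for all coefficient modules; in the end it
  is instantiated with the one selected by \<open>Ext_module\<close>.\<close>

locale ext_context =
  fixes R :: "('a, 'r) ring_scheme" and \<aa> :: "'a set" and n :: "nat \<Rightarrow> nat"
    and \<delta> :: "nat \<Rightarrow> (nat \<Rightarrow> 'a) \<Rightarrow> nat \<Rightarrow> 'a" and \<epsilon> :: "(nat \<Rightarrow> 'a) \<Rightarrow> 'a set"
  assumes R: "cring R" "noetherian_ring R"
    and ideal: "ideal \<aa> R"
    and res: "finite_free_resolution R (quotient_module R (regular_module R) \<aa>) n \<delta> \<epsilon>"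
begin

abbreviation "F i \<equiv> free_module R (n i)"

lemma mF: "module R (F i)" by (rule module_free[OF R(1)])

lemma delta_hom: "\<delta> i \<in> module_hom R (F (Suc i)) (F i)"
  using res by (simp add: finite_free_resolution_def)

lemma delta_exact:
  "x \<in> carrier (F (Suc i)) \<Longrightarrow> \<delta> i x = \<zero>\<^bsub>F i\<^esub> \<longleftrightarrow> (\<exists>y\<in>carrier (F (Suc (Suc i))). x = \<delta> (Suc i) y)"
proof -
  assume x: "x \<in> carrier (F (Suc i))"
  have "a_kernel (F (Suc i)) (F i) (\<delta> i) = \<delta> (Suc i) ` carrier (F (Suc (Suc i)))"
    using res by (simp add: finite_free_resolution_def)
  moreover have "\<delta> i x = \<zero>\<^bsub>F i\<^esub> \<longleftrightarrow> x \<in> a_kernel (F (Suc i)) (F i) (\<delta> i)"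
    using x by (auto simp: a_kernel_def kernel_def)
  ultimately show ?thesis by auto
qed

lemma delta_delta: "y \<in> carrier (F (Suc (Suc i))) \<Longrightarrow> \<delta> i (\<delta> (Suc i) y) = \<zero>\<^bsub>F i\<^esub>"
  using delta_exact[of "\<delta> (Suc i) y" i] module_homD(1)[OF delta_hom] by auto

definition ext_Z :: "nat \<Rightarrow> ('a, 'c, 'n) module_scheme \<Rightarrow> ((nat \<Rightarrow> 'a) \<Rightarrow> 'c) set"
  where "ext_Z j N = {f \<in> carrier (Hom_module R (F j) N). \<forall>x\<in>carrier (F (Suc j)). f (\<delta> j x) = \<zero>\<^bsub>N\<^esub>}"

text \<open>The bounding map \<open>g\<close> ranges over all of \<open>module_hom\<close>,
  extensional or not, since only its values on the image of \<open>\<delta> k\<close> matter.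
  Witnesses can thus be given as plain compositions.\<close>

definition ext_B :: "nat \<Rightarrow> ('a, 'c, 'n) module_scheme \<Rightarrow> ((nat \<Rightarrow> 'a) \<Rightarrow> 'c) set"
  where "ext_B j N = {f \<in> carrier (Hom_module R (F j) N).
    case j of 0 \<Rightarrow> \<forall>x\<in>carrier (F 0). f x = \<zero>\<^bsub>N\<^esub>
    | Suc k \<Rightarrow> \<exists>g\<in>module_hom R (F k) N. \<forall>x\<in>carrier (F (Suc k)). f x = g (\<delta> k x)}"

definition ext_fg :: "nat \<Rightarrow> ('a, 'c, 'n) module_scheme \<Rightarrow> bool"
  where "ext_fg j N \<longleftrightarrow> fg_mod R (Hom_module R (F j) N) (ext_Z j N) (ext_B j N)"

lemma ext_B_0: "f \<in> ext_B 0 N \<longleftrightarrow> f \<in> carrier (Hom_module R (F 0) N) \<and> (\<forall>x\<in>carrier (F 0). f x = \<zero>\<^bsub>N\<^esub>)"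
  by (simp add: ext_B_def)

lemma ext_B_Suc: "f \<in> ext_B (Suc k) N \<longleftrightarrow> f \<in> carrier (Hom_module R (F (Suc k)) N) \<and>
    (\<exists>g\<in>module_hom R (F k) N. \<forall>x\<in>carrier (F (Suc k)). f x = g (\<delta> k x))"
  by (simp add: ext_B_def)

lemma mH: "module R N \<Longrightarrow> module R (Hom_module R (F j) N)"
  by (rule module_Hom[OF mF])

lemma ext_Z_submodule: assumes N: "module R N" shows "submodule (ext_Z j N) R (Hom_module R (F j) N)"
proof -
  interpret N: module R N by fact
  interpret H: module R "Hom_module R (F j) N" by (rule mH[OF N])
  show ?thesis
    by (rule submoduleI'[OF mH[OF N]])
      (auto simp: ext_Z_def Hom_apply module_homD(1)[OF delta_hom])
qed

lemma ext_B_submodule: assumes N: "module R N" shows "submodule (ext_B j N) R (Hom_module R (F j) N)"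
proof -
  interpret N: module R N by fact
  interpret H: module R "Hom_module R (F j) N" by (rule mH[OF N])
  have Hc: "\<And>f g. f \<in> carrier (Hom_module R (F j) N) \<Longrightarrow> g \<in> carrier (Hom_module R (F j) N)
      \<Longrightarrow> f \<oplus>\<^bsub>Hom_module R (F j) N\<^esub> g \<in> carrier (Hom_module R (F j) N)" by simp
  show ?thesis
  proof (cases j)
    case 0
    interpret H0: module R "Hom_module R (F 0) N" by (rule mH[OF N])
    show ?thesis unfolding 0
      by (intro submoduleI'[OF mH[OF N]]) (auto simp: ext_B_0 Hom_apply)
  next
    case (Suc k)
    have "\<zero>\<^bsub>Hom_module R (F j) N\<^esub> \<in> ext_B j N"
      unfolding Suc ext_B_Suc using H.zero_closed Suc
      by (auto simp: Hom_ops module_hom_def intro!: bexI[of _ "\<lambda>_. \<zero>\<^bsub>N\<^esub>"])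
    moreover have "a \<oplus>\<^bsub>Hom_module R (F j) N\<^esub> b \<in> ext_B j N" if "a \<in> ext_B j N" "b \<in> ext_B j N" for a b
    proof -
      from that Suc obtain g h where "g\<in>module_hom R (F k) N" "\<forall>x\<in>carrier (F (Suc k)). a x = g (\<delta> k x)"
         "h\<in>module_hom R (F k) N" "\<forall>x\<in>carrier (F (Suc k)). b x = h (\<delta> k x)" by (auto simp: ext_B_Suc)
      then have "\<exists>u\<in>module_hom R (F k) N. \<forall>x\<in>carrier (F (Suc k)). (a \<oplus>\<^bsub>Hom_module R (F j) N\<^esub> b) x = u (\<delta> k x)"
        using Suc by (intro bexI[OF _ module_hom_add[OF mF N, of g k h]]) (auto simp: Hom_ops)
      then show ?thesis using that Hc[of a b] unfolding Suc ext_B_Suc by blast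
    qed
    moreover have "r \<odot>\<^bsub>Hom_module R (F j) N\<^esub> a \<in> ext_B j N" if "r \<in> carrier R" "a \<in> ext_B j N" for r a
    proof -
      from that Suc obtain g where "g\<in>module_hom R (F k) N" "\<forall>x\<in>carrier (F (Suc k)). a x = g (\<delta> k x)"
        by (auto simp: ext_B_Suc)
      then have "\<exists>u\<in>module_hom R (F k) N. \<forall>x\<in>carrier (F (Suc k)). (r \<odot>\<^bsub>Hom_module R (F j) N\<^esub> a) x = u (\<delta> k x)"
        using Suc by (intro bexI[OF _ module_hom_comp[OF _ module_hom_smult[OF N that(1)], of g]]) (auto simp: Hom_ops)
      then show ?thesis using that H.smult_closed[of r a] unfolding Suc ext_B_Suc by blast
    qed
    ultimately show ?thesis using Suc
      by (intro submoduleI'[OF mH[OF N]]) (auto simp: ext_B_Suc)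
  qed
qed

lemma ext_B_subset_Z: assumes N: "module R N" shows "ext_B j N \<subseteq> ext_Z j N"
proof
  interpret N: module R N by fact
  fix f assume f: "f \<in> ext_B j N"
  show "f \<in> ext_Z j N"
  proof (cases j)
    case 0 then show ?thesis using f module_homD(1)[OF delta_hom] by (auto simp: ext_B_0 ext_Z_def)
  next
    case (Suc k)
    with f obtain g where "f \<in> carrier (Hom_module R (F (Suc k)) N)" "g\<in>module_hom R (F k) N"
      "\<forall>x\<in>carrier (F (Suc k)). f x = g (\<delta> k x)" by (auto simp: ext_B_Suc)
    then show ?thesis using Suc module_homD(1)[OF delta_hom] module_hom_zero[OF mF N, of g]
      by (auto simp: ext_Z_def delta_delta)
  qed
qed

text \<open>Restricting a bounding map to the carrier makes it extensional without changing its
  coboundary, so \<open>ext_Z\<close> and \<open>ext_B\<close> are the cocycles and coboundaries of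
  the Hom complex.\<close>

lemma ext_fg_iff:
  assumes N: "module R N"
  shows "finitely_generated_module R (Ext_of_resolution R n \<delta> N j) \<longleftrightarrow> ext_fg j N"
proof -
  interpret N: module R N by fact
  let ?H = "\<lambda>j. Hom_module R (F j) N"
  have Z: "cocycles ?H (\<lambda>i f. \<lambda>x\<in>carrier (F (Suc i)). f (\<delta> i x)) j = ext_Z j N"
    by (auto simp: cocycles_def ext_Z_def Hom_ops fun_eq_iff restrict_def)
  have B: "coboundaries ?H (\<lambda>i f. \<lambda>x\<in>carrier (F (Suc i)). f (\<delta> i x)) j = ext_B j N"
  proof (cases j)
    case 0
    have "\<zero>\<^bsub>?H 0\<^esub> \<in> carrier (?H 0)" by (rule submoduleD(2)[OF mH[OF N] module.carrier_is_submodule[OF mH[OF N]]])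
    moreover have "f = \<zero>\<^bsub>?H 0\<^esub>" if "f \<in> ext_B 0 N" for f
      using that by (auto simp: ext_B_0 Hom_carrier Hom_ops fun_eq_iff extensional_def)
    ultimately show ?thesis using 0 by (auto simp: coboundaries_def ext_B_0 Hom_ops)
  next
    case (Suc k)
    show ?thesis
    proof (intro equalityI subsetI)
      fix f assume "f \<in> coboundaries ?H (\<lambda>i f. \<lambda>x\<in>carrier (F (Suc i)). f (\<delta> i x)) j"
      then obtain g where g: "g \<in> carrier (?H k)" "f = (\<lambda>x\<in>carrier (F (Suc k)). g (\<delta> k x))"
        using Suc by (auto simp: coboundaries_def)
      then show "f \<in> ext_B j N"
        using Hom_restrict[OF mF module_hom_comp[OF delta_hom, of g]] Suc by (auto simp: ext_B_Suc Hom_carrier)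
    next
      fix f assume f: "f \<in> ext_B j N"
      then obtain g where g: "f \<in> carrier (?H (Suc k))" "g\<in>module_hom R (F k) N"
        "\<forall>x\<in>carrier (F (Suc k)). f x = g (\<delta> k x)" using Suc by (auto simp: ext_B_Suc)
      have "f = (\<lambda>x\<in>carrier (F (Suc k)). restrict g (carrier (F k)) (\<delta> k x))"
        using g module_homD(1)[OF delta_hom] by (auto simp: fun_eq_iff Hom_carrier extensional_def)
      then show "f \<in> coboundaries ?H (\<lambda>i f. \<lambda>x\<in>carrier (F (Suc i)). f (\<delta> i x)) j"
        using Hom_restrict[OF mF g(2)] Suc
        by (auto simp: coboundaries_def simp del: restrict_apply intro!: image_eqI[of _ _ "restrict g (carrier (F k))"])
    qed
  qed
  note sZ = ext_Z_submodule[OF N, of j] and sB = ext_B_submodule[OF N, of j] and BZ = ext_B_subset_Z[OF N, of j]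
  have "submodule (ext_B j N) R ((?H j)\<lparr>carrier := ext_Z j N\<rparr>)"
    using submodule_carrier_update[OF mH[OF N] sZ BZ] sB by simp
  from fg_mod_quotient[OF R submodule_module[OF mH[OF N] sZ] this]
    fg_mod_carrier_update[of "ext_Z j N" "ext_Z j N" "?H j" R "ext_B j N"] submoduleD(1)[OF mH[OF N] sZ]
  show ?thesis by (simp add: Ext_of_resolution_def cohomology_def Z B ext_fg_def)
qed

text \<open>Ext is a subquotient of Hom(R^n, N), which is finitely generated along with N.\<close>

lemma ext_fg_fg_module:
  assumes "module R N" "fg_mod R N (carrier N) {\<zero>\<^bsub>N\<^esub>}"
  shows "ext_fg j N"
proof -
  note m = mH[OF assms(1), of j]
  show ?thesis unfolding ext_fg_def
    by (rule fg_mod_mono[OF R m module.carrier_is_submodule[OF m] ext_Z_submodule[OF assms(1)]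
          submodule_zero[OF m] ext_B_submodule[OF assms(1)] fg_mod_Hom_free[OF R assms]])
      (use submoduleD[OF m ext_Z_submodule[OF assms(1)]] submoduleD[OF m ext_B_submodule[OF assms(1)]] in auto)
qed

end

lemma linear_rel_graph:
  assumes "module R M" "f \<in> module_hom R M N"
  shows "linear_rel R M N (\<lambda>x y. x \<in> carrier M \<and> y = f x)"
proof -
  interpret module R M by fact
  show ?thesis by (rule linear_relI) (auto simp: module_homD[OF assms(2)])
qed

lemma module_hom_supermodule:
  assumes "f \<in> module_hom R M (N\<lparr>carrier := K\<rparr>)" "K \<subseteq> carrier N"
  shows "f \<in> module_hom R M N"
  using assms by (auto simp: module_hom_def)

lemma module_hom_subset:
  assumes "f \<in> module_hom R M N" "H \<subseteq> carrier M"
  shows "f \<in> module_hom R (M\<lparr>carrier := H\<rparr>) N"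
  using module_homD[OF assms(1)] assms(2) by (auto simp: module_hom_def subset_iff)

lemma submodule_image_submodule:
  assumes "module R M" "module R N" "f \<in> module_hom R M N" "submodule H R M"
  shows "submodule (f ` H) R N"
  using submodule_image[OF submodule_module[OF assms(1,4)] assms(2)
      module_hom_subset[OF assms(3) submoduleD(1)[OF assms(1,4)]]] by simp

lemma regular_module_simps:
  "carrier (regular_module R) = carrier R" "add (regular_module R) = add R"
  "smult (regular_module R) = (\<otimes>\<^bsub>R\<^esub>)" "\<zero>\<^bsub>regular_module R\<^esub> = \<zero>\<^bsub>R\<^esub>"
  by (simp_all add: regular_module_def)

lemma ideal_submodule_regular:
  assumes "cring R" "ideal \<aa> R"
  shows "submodule \<aa> R (regular_module R)"
proof -
  interpret cring R by fact
  interpret ideal \<aa> R by fact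
  show ?thesis
    by (rule submoduleI'[OF module_regular[OF assms(1)]])
      (auto simp: regular_module_def I_l_closed)
qed

lemma coset_eq_iff:
  assumes "module R M" "submodule H R M" "x \<in> carrier M" "y \<in> carrier M"
  shows "H +>\<^bsub>M\<^esub> x = H +>\<^bsub>M\<^esub> y \<longleftrightarrow> x \<ominus>\<^bsub>M\<^esub> y \<in> H"
proof -
  interpret M: module R M by fact
  interpret H: submodule H R M by fact
  have H: "subgroup H (add_monoid M)" ..
  interpret A: abelian_subgroup H M
    by (rule abelian_subgroupI3) (auto intro: additive_subgroup.intro H M.abelian_group_axioms)
  show ?thesis
  proof
    assume "H +>\<^bsub>M\<^esub> x = H +>\<^bsub>M\<^esub> y"
    then have "x \<in> H +>\<^bsub>M\<^esub> y" using A.a_rcos_self[OF assms(3)] by simp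
    then show "x \<ominus>\<^bsub>M\<^esub> y \<in> H" using A.a_rcos_module_minus assms(3,4) A.a_rcos_module by (simp add: a_minus_def)
  next
    assume "x \<ominus>\<^bsub>M\<^esub> y \<in> H"
    then have "x \<in> H +>\<^bsub>M\<^esub> y" using assms(3,4) A.a_rcos_module by (simp add: a_minus_def)
    from M.a_repr_independence[OF this assms(4) H] show "H +>\<^bsub>M\<^esub> x = H +>\<^bsub>M\<^esub> y" by simp
  qed
qed

lemma coset_hom:
  assumes "module R M" "submodule H R M"
  shows "(\<lambda>x. H +>\<^bsub>M\<^esub> x) \<in> module_hom R M (quotient_module R M H)"
    and "(\<lambda>x. H +>\<^bsub>M\<^esub> x) ` carrier M = carrier (quotient_module R M H)"
    and "x \<in> carrier M \<Longrightarrow> H +>\<^bsub>M\<^esub> x = \<zero>\<^bsub>quotient_module R M H\<^esub> \<longleftrightarrow> x \<in> H"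
proof -
  interpret M: module R M by fact
  interpret H: submodule H R M by fact
  have H: "subgroup H (add_monoid M)" ..
  interpret A: abelian_subgroup H M
    by (rule abelian_subgroupI3) (auto intro: additive_subgroup.intro H M.abelian_group_axioms)
  show car: "(\<lambda>x. H +>\<^bsub>M\<^esub> x) ` carrier M = carrier (quotient_module R M H)"
    by (auto simp: quotient_module_def A_RCOSETS_def')
  have "(H +>\<^bsub>M\<^esub> x) \<oplus>\<^bsub>quotient_module R M H\<^esub> (H +>\<^bsub>M\<^esub> y) = H +>\<^bsub>M\<^esub> (x \<oplus>\<^bsub>M\<^esub> y)"
    if "x \<in> carrier M" "y \<in> carrier M" for x y
    using that A.a_rcos_sum by (simp add: quotient_module_def)
  then show "(\<lambda>x. H +>\<^bsub>M\<^esub> x) \<in> module_hom R M (quotient_module R M H)"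
    using quotient_smult[OF assms] car by (auto simp: module_hom_def)
  show "H +>\<^bsub>M\<^esub> x = \<zero>\<^bsub>quotient_module R M H\<^esub> \<longleftrightarrow> x \<in> H" if "x \<in> carrier M"
  proof -
    have "\<zero>\<^bsub>quotient_module R M H\<^esub> = H +>\<^bsub>M\<^esub> \<zero>\<^bsub>M\<^esub>"
      using A.a_rcos_const[OF A.zero_closed] by (simp add: quotient_module_def)
    then show ?thesis using coset_eq_iff[OF assms that, of "\<zero>\<^bsub>M\<^esub>"] that
      M.r_zero[of x] M.add.inv_one by (simp add: a_minus_def a_inv_def)
  qed
qed

text \<open>This is (0 :_N a), a copy of Hom(R/a, N) when the set is the ideal; it is also formed
  for sets of generators.\<close>

definition ann_part ::
    "'a set \<Rightarrow> ('a, 'b, 'm) module_scheme \<Rightarrow> 'b set"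
  where "ann_part \<aa> N = {x \<in> carrier N. \<forall>r\<in>\<aa>. r \<odot>\<^bsub>N\<^esub> x = \<zero>\<^bsub>N\<^esub>}"

section \<open>Ext along short exact sequences of coefficient modules\<close>

context ext_context
begin

text \<open>The cochain that bounds in P lifts through \<open>p\<close> because its source is free;
  the coboundary of the lift is the required \<open>b\<close>.\<close>

lemma ext_B_lift:
  assumes N: "module R N" and P: "module R P" and p: "p \<in> module_hom R N P" "p ` carrier N = carrier P"
    and f: "f \<in> carrier (Hom_module R (F j) N)" "(\<lambda>x\<in>carrier (F j). p (f x)) \<in> ext_B j P"
  shows "\<exists>b\<in>ext_B j N. \<forall>x\<in>carrier (F j). p (f x) = p (b x)"
proof (cases j)
  case 0
  interpret N: module R N by fact
  have "\<zero>\<^bsub>Hom_module R (F j) N\<^esub> \<in> ext_B j N"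
    by (rule submoduleD(2)[OF mH[OF N] ext_B_submodule[OF N]])
  moreover have "p (f x) = p (\<zero>\<^bsub>Hom_module R (F j) N\<^esub> x)" if "x \<in> carrier (F j)" for x
    using f(2) that 0 module_hom_zero[OF N P p(1)] by (simp add: ext_B_0 Hom_apply)
  ultimately show ?thesis by blast
next
  case (Suc k)
  with f(2) obtain g where g: "g \<in> module_hom R (F k) P" "\<forall>x\<in>carrier (F (Suc k)). p (f x) = g (\<delta> k x)"
    by (auto simp: ext_B_Suc)
  from free_lift_surj[OF N P p g(1)] obtain h where h: "h \<in> module_hom R (F k) N" "\<forall>x\<in>carrier (F k). p (h x) = g x"
    by auto
  have "(\<lambda>x\<in>carrier (F j). h (\<delta> k x)) \<in> ext_B j N"
    using Hom_restrict[OF mF module_hom_comp[OF delta_hom h(1)]] h(1) by (auto simp: Suc ext_B_Suc)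
  moreover have "p (f x) = p ((\<lambda>x\<in>carrier (F j). h (\<delta> k x)) x)" if "x \<in> carrier (F j)" for x
    using that g(2) h(2) module_homD(1)[OF delta_hom] by (simp add: Suc)
  ultimately show ?thesis by blast
qed

lemma postcompose_Z:
  assumes N: "module R N" and P: "module R P" and p: "p \<in> module_hom R N P" and f: "f \<in> ext_Z j N"
  shows "(\<lambda>x\<in>carrier (F j). p (f x)) \<in> ext_Z j P"
  using f module_homD(1)[OF Hom_postcompose[OF mF N p], of f j] module_hom_zero[OF N P p] module_homD(1)[OF delta_hom]
  by (auto simp: ext_Z_def)

lemma postcompose_B:
  assumes N: "module R N" and P: "module R P" and p: "p \<in> module_hom R N P" and f: "f \<in> ext_B j N"
  shows "(\<lambda>x\<in>carrier (F j). p (f x)) \<in> ext_B j P"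
proof (cases j)
  case 0
  then show ?thesis
    using f module_homD(1)[OF Hom_postcompose[OF mF N p], of f j] module_hom_zero[OF N P p]
    by (auto simp: ext_B_0)
next
  case (Suc k)
  with f obtain g where "g \<in> module_hom R (F k) N" "\<forall>x\<in>carrier (F (Suc k)). f x = g (\<delta> k x)"
    "f \<in> carrier (Hom_module R (F j) N)" by (auto simp: ext_B_Suc)
  then show ?thesis
    using module_homD(1)[OF Hom_postcompose[OF mF N p], of f j] module_hom_comp[of g R "F k" N p P] p
    unfolding Suc ext_B_Suc by (auto intro!: bexI[of _ "\<lambda>x. p (g x)"])
qed

lemma Hom_submodule_iff:
  assumes "K \<subseteq> carrier N"
  shows "f \<in> carrier (Hom_module R (F j) (N\<lparr>carrier := K\<rparr>)) \<longleftrightarrow>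
    f \<in> carrier (Hom_module R (F j) N) \<and> (\<forall>x\<in>carrier (F j). f x \<in> K)"
  using assms by (auto simp: Hom_carrier module_hom_def)

text \<open>Exactness of Ext^j(K) -> Ext^j(N) -> Ext^j(P), where \<open>T\<close> only has to
  contain the image of the cocycles of N. Thus Ext^j(P) itself may be unknown, as when N = P and
  \<open>p\<close> is multiplication by an element of the ideal.\<close>

lemma ext_fg_extension:
  assumes N: "module R N" and P: "module R P" and p: "p \<in> module_hom R N P" "p ` carrier N = carrier P"
    and K: "ext_fg j (N\<lparr>carrier := {x \<in> carrier N. p x = \<zero>\<^bsub>P\<^esub>}\<rparr>)"
    and T: "fg_mod R (Hom_module R (F j) P) T (ext_B j P)"
      "\<And>f. f \<in> ext_Z j N \<Longrightarrow> (\<lambda>x\<in>carrier (F j). p (f x)) \<in> T"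
  shows "ext_fg j N"
proof -
  interpret N: module R N by fact
  interpret P: module R P by fact
  interpret HN: module R "Hom_module R (F j) N" by (rule mH[OF N])
  define K where "K = {x \<in> carrier N. p x = \<zero>\<^bsub>P\<^esub>}"
  have sK: "submodule K R N" unfolding K_def by (rule submodule_kernel[OF N P p(1)])
  have Kc: "K \<subseteq> carrier N" by (auto simp: K_def)
  let ?K = "N\<lparr>carrier := K\<rparr>"
  have mK: "module R ?K" by (rule submodule_module[OF N sK])
  interpret HK: module R "Hom_module R (F j) ?K" by (rule mH[OF mK])
  note HKc = Hom_submodule_iff[OF Kc]
  define r1 where "r1 f g \<longleftrightarrow> g = f \<and> f \<in> carrier (Hom_module R (F j) ?K)" for f g
  define r2 where "r2 f g \<longleftrightarrow> f \<in> carrier (Hom_module R (F j) N) \<and> g = (\<lambda>x\<in>carrier (F j). p (f x))" for f g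
  show ?thesis unfolding ext_fg_def
  proof (rule fg_mod_exact[OF R mH[OF mK] mH[OF N] mH[OF P] ext_Z_submodule[OF N] ext_B_submodule[OF N]
      ext_Z_submodule[OF mK] ext_B_submodule[OF mK] ext_B_submodule[OF P] _ T(1), where \<rho>=r1 and \<sigma>=r2])
    show "fg_mod R (Hom_module R (F j) ?K) (ext_Z j ?K) (ext_B j ?K)"
      using K by (simp add: ext_fg_def K_def)
    show "linear_rel R (Hom_module R (F j) N) (Hom_module R (F j) ?K) r1"
      using HK.a_closed HK.smult_closed
      by (intro linear_relI) (auto simp: r1_def HKc Hom_ops)
    show "linear_rel R (Hom_module R (F j) N) (Hom_module R (F j) P) r2"
      unfolding r2_def by (rule linear_rel_graph[OF mH[OF N] Hom_postcompose[OF mF N p(1)]])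
    show "\<exists>z'\<in>T. r2 z z'" if "z \<in> ext_Z j N" for z
      using T(2)[OF that] that by (auto simp: r2_def ext_Z_def)
    show "\<exists>y\<in>ext_Z j N. \<exists>b\<in>ext_B j N. \<exists>z1\<in>ext_Z j ?K. z = y \<oplus>\<^bsub>Hom_module R (F j) N\<^esub> b \<and> r1 y z1"
      if z: "z \<in> ext_Z j N" "r2 z b'" "b' \<in> ext_B j P" for z b'
    proof -
      from ext_B_lift[OF N P p, of z j] z obtain b where b: "b \<in> ext_B j N" "\<forall>x\<in>carrier (F j). p (z x) = p (b x)"
        by (auto simp: r2_def)
      have zc: "z \<in> carrier (Hom_module R (F j) N)" using z by (simp add: r2_def)
      have bc: "b \<in> carrier (Hom_module R (F j) N)" using b by (simp add: ext_B_def)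
      \<comment> \<open>\<open>z\<close> and the coboundary \<open>b\<close> agree after
        \<open>p\<close>, so the difference is a cocycle with values in the kernel.\<close>
      define y where "y = z \<ominus>\<^bsub>Hom_module R (F j) N\<^esub> b"
      have y: "y \<in> ext_Z j N" unfolding y_def
        using submodule_diff[OF mH[OF N] ext_Z_submodule[OF N] z(1)] ext_B_subset_Z[OF N] b(1) by blast
      have "z = y \<oplus>\<^bsub>Hom_module R (F j) N\<^esub> b"
        using zc bc by (simp add: y_def a_minus_def HN.a_assoc HN.l_neg)
      moreover have "y x \<in> K" if x: "x \<in> carrier (F j)" for x
      proof -
        have c: "z x \<in> carrier N" "b x \<in> carrier N"
          using zc bc x module_homD(1)[of _ R "F j" N] by (auto simp: Hom_carrier)
        have "p (y x) = p (z x) \<ominus>\<^bsub>P\<^esub> p (b x)"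
          unfolding y_def Hom_diff[OF mF N zc bc x] by (rule module_hom_diff[OF N P p(1) c])
        also have "\<dots> = \<zero>\<^bsub>P\<^esub>" using b(2) x module_homD(1)[OF p(1) c(2)] by (simp add: a_minus_def P.r_neg)
        finally show ?thesis
          using c by (simp add: K_def y_def Hom_diff[OF mF N zc bc x])
      qed
      then have "y \<in> ext_Z j ?K" using y by (simp add: ext_Z_def HKc)
      ultimately show ?thesis using y b by (auto simp: r1_def ext_Z_def)
    qed
    show "y \<in> ext_B j N" if "y \<in> ext_Z j N" "r1 y b1" "b1 \<in> ext_B j ?K" for y b1
      using that module_hom_supermodule[OF _ Kc]
      by (cases j) (auto simp: r1_def ext_B_0 ext_B_Suc ext_Z_def)
  qed
qed

text \<open>Exactness of Ext^j(N) -> Ext^j(P) -> Ext^(j+1)(K), with \<open>T\<close> bounding the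
  image of the first map. Hence Ext^j(N) may be infinite as long as its image is not.\<close>

lemma ext_fg_quotient:
  assumes N: "module R N" and P: "module R P" and p: "p \<in> module_hom R N P" "p ` carrier N = carrier P"
    and K: "ext_fg (Suc j) (N\<lparr>carrier := {x \<in> carrier N. p x = \<zero>\<^bsub>P\<^esub>}\<rparr>)"
    and T: "submodule T R (Hom_module R (F j) P)" "fg_mod R (Hom_module R (F j) P) T (ext_B j P)"
      "\<And>f. f \<in> ext_Z j N \<Longrightarrow> (\<lambda>x\<in>carrier (F j). p (f x)) \<in> T"
  shows "ext_fg j P"
proof -
  interpret N: module R N by fact
  interpret P: module R P by fact
  interpret HP: module R "Hom_module R (F j) P" by (rule mH[OF P])
  define K where "K = {x \<in> carrier N. p x = \<zero>\<^bsub>P\<^esub>}"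
  have sK: "submodule K R N" unfolding K_def by (rule submodule_kernel[OF N P p(1)])
  have Kc: "K \<subseteq> carrier N" by (auto simp: K_def)
  let ?K = "N\<lparr>carrier := K\<rparr>"
  have mK: "module R ?K" by (rule submodule_module[OF N sK])
  interpret HK: module R "Hom_module R (F (Suc j)) ?K" by (rule mH[OF mK])
  note HKc = Hom_submodule_iff[OF Kc]
  note dc = module_homD(1)[OF delta_hom]
  define r1 where "r1 f g \<longleftrightarrow> g = f \<and> f \<in> carrier (Hom_module R (F j) P)" for f g
  \<comment> \<open>The connecting homomorphism as a relation: \<open>h\<close> lifts the cochain
    \<open>f\<close> to N, and \<open>g\<close> is the coboundary of \<open>h\<close>, which takes
    values in K.\<close>
  define r2 where "r2 f g \<longleftrightarrow> f \<in> carrier (Hom_module R (F j) P) \<and> g \<in> carrier (Hom_module R (F (Suc j)) ?K) \<and>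
     (\<exists>h\<in>module_hom R (F j) N. (\<forall>x\<in>carrier (F j). p (h x) = f x) \<and> (\<forall>x\<in>carrier (F (Suc j)). h (\<delta> j x) = g x))" for f g
  show ?thesis unfolding ext_fg_def
  proof (rule fg_mod_exact[OF R mH[OF P] mH[OF P] mH[OF mK] ext_Z_submodule[OF P] ext_B_submodule[OF P]
      T(1) ext_B_submodule[OF P] ext_B_submodule[OF mK] T(2), where \<rho>=r1 and \<sigma>=r2])
    show "fg_mod R (Hom_module R (F (Suc j)) ?K) (ext_Z (Suc j) ?K) (ext_B (Suc j) ?K)"
      using K by (simp add: ext_fg_def K_def)
    show "linear_rel R (Hom_module R (F j) P) (Hom_module R (F j) P) r1"
      by (intro linear_relI) (auto simp: r1_def)
    show "linear_rel R (Hom_module R (F j) P) (Hom_module R (F (Suc j)) ?K) r2"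
    proof (rule linear_relI)
      fix f g f' g' assume 1: "r2 f g" "r2 f' g'"
      then obtain h h' where h: "h\<in>module_hom R (F j) N" "(\<forall>x\<in>carrier (F j). p (h x) = f x)" "(\<forall>x\<in>carrier (F (Suc j)). h (\<delta> j x) = g x)"
        "h'\<in>module_hom R (F j) N" "(\<forall>x\<in>carrier (F j). p (h' x) = f' x)" "(\<forall>x\<in>carrier (F (Suc j)). h' (\<delta> j x) = g' x)"
        by (auto simp: r2_def)
      show "r2 (f \<oplus>\<^bsub>Hom_module R (F j) P\<^esub> f') (g \<oplus>\<^bsub>Hom_module R (F (Suc j)) ?K\<^esub> g')"
        unfolding r2_def
        using 1 h module_homD(1)[OF h(1)] module_homD(1)[OF h(4)] module_homD(2)[OF p(1)] dc
        by (intro conjI bexI[OF _ module_hom_add[OF mF N h(1,4)]]) (auto simp: r2_def Hom_apply)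
    next
      fix r f g assume r: "r \<in> carrier R" and 1: "r2 f g"
      then obtain h where h: "h\<in>module_hom R (F j) N" "(\<forall>x\<in>carrier (F j). p (h x) = f x)" "(\<forall>x\<in>carrier (F (Suc j)). h (\<delta> j x) = g x)"
        by (auto simp: r2_def)
      show "r2 (r \<odot>\<^bsub>Hom_module R (F j) P\<^esub> f) (r \<odot>\<^bsub>Hom_module R (F (Suc j)) ?K\<^esub> g)"
        unfolding r2_def
        using r 1 h module_homD(1)[OF h(1)] module_homD(3)[OF p(1)] dc
        by (intro conjI bexI[OF _ module_hom_comp[OF h(1) module_hom_smult[OF N r]]]) (auto simp: r2_def Hom_apply)
    qed (simp add: r2_def)
    show "\<exists>z'\<in>ext_Z (Suc j) ?K. r2 z z'" if z: "z \<in> ext_Z j P" for z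
    proof -
      have zh: "z \<in> module_hom R (F j) P" using z by (simp add: ext_Z_def Hom_carrier)
      from free_lift_surj[OF N P p zh] obtain h where h: "h\<in>module_hom R (F j) N" "\<forall>x\<in>carrier (F j). p (h x) = z x"
        by auto
      have hd: "h (\<delta> j x) \<in> K" if "x \<in> carrier (F (Suc j))" for x
        using that z h(2) dc[OF that] module_homD(1)[OF h(1)] by (auto simp: K_def ext_Z_def)
      define z' where "z' = (\<lambda>x\<in>carrier (F (Suc j)). h (\<delta> j x))"
      have "z' \<in> carrier (Hom_module R (F (Suc j)) N)" unfolding z'_def
        by (rule Hom_restrict[OF mF module_hom_comp[OF delta_hom h(1)]])
      then have "z' \<in> carrier (Hom_module R (F (Suc j)) ?K)" using hd by (auto simp: HKc z'_def)
      moreover from this have "z' \<in> ext_Z (Suc j) ?K"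
        using dc module_hom_zero[OF mF N h(1)] by (auto simp: ext_Z_def z'_def delta_delta)
      moreover have "r2 z z'"
        using z h calculation(1) by (auto simp: r2_def ext_Z_def z'_def)
      ultimately show ?thesis by blast
    qed
    show "\<exists>y\<in>ext_Z j P. \<exists>b\<in>ext_B j P. \<exists>z1\<in>T. z = y \<oplus>\<^bsub>Hom_module R (F j) P\<^esub> b \<and> r1 y z1"
      if z: "z \<in> ext_Z j P" "r2 z b'" "b' \<in> ext_B (Suc j) ?K" for z b'
    proof -
      from z(2) obtain h where h: "h\<in>module_hom R (F j) N" "(\<forall>x\<in>carrier (F j). p (h x) = z x)" "(\<forall>x\<in>carrier (F (Suc j)). h (\<delta> j x) = b' x)"
        by (auto simp: r2_def)
      from z(3) obtain g where g: "g \<in> module_hom R (F j) ?K" "\<forall>x\<in>carrier (F (Suc j)). b' x = g (\<delta> j x)"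
        by (auto simp: ext_B_Suc)
      have gh: "g \<in> module_hom R (F j) N" and gK: "\<And>x. x \<in> carrier (F j) \<Longrightarrow> g x \<in> K"
        using module_hom_supermodule[OF g(1) Kc] g(1) by (auto simp: module_hom_carrier_update)
      \<comment> \<open>Since the connecting class is bounded by \<open>g\<close> in K, subtracting
        \<open>g\<close> turns the lift into a cocycle of N that still maps to \<open>z\<close>;
        therefore \<open>z\<close> lies in \<open>T\<close>.\<close>
      define u where "u = (\<lambda>x\<in>carrier (F j). h x \<ominus>\<^bsub>N\<^esub> g x)"
      have uc: "u \<in> carrier (Hom_module R (F j) N)" unfolding u_def
        by (rule Hom_restrict[OF mF module_hom_minus[OF mF N h(1) gh]])
      have "u \<in> ext_Z j N" unfolding ext_Z_def
        using uc h(3) g(2) dc module_homD(1)[OF gh] by (auto simp: u_def a_minus_def N.r_neg)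
      from T(3)[OF this] have T': "(\<lambda>x\<in>carrier (F j). p (u x)) \<in> T" .
      have "p (u x) = z x" if x: "x \<in> carrier (F j)" for x
      proof -
        have "p (u x) = p (h x) \<ominus>\<^bsub>P\<^esub> p (g x)" using x module_homD(1)[OF h(1) x] module_homD(1)[OF gh x]
          by (simp add: u_def module_hom_diff[OF N P p(1)])
        also have "\<dots> = z x" using h(2) gK[OF x] x z(2) module_homD(1)[of z R "F j" P x]
          by (simp add: K_def a_minus_def r2_def Hom_carrier)
        finally show ?thesis .
      qed
      then have "(\<lambda>x\<in>carrier (F j). p (u x)) = z" using z(2)
        by (auto simp: r2_def Hom_carrier extensional_def fun_eq_iff)
      with T' have "z \<in> T" by simp
      moreover have zc: "z \<in> carrier (Hom_module R (F j) P)" using z(2) by (simp add: r2_def)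
      ultimately show ?thesis using z(1) submoduleD(2)[OF mH[OF P] ext_B_submodule[OF P, of j]]
        by (intro bexI[of _ z] bexI[of _ "\<zero>\<^bsub>Hom_module R (F j) P\<^esub>"]) (auto simp: r1_def)
    qed
    show "y \<in> ext_B j P" if "y \<in> ext_Z j P" "r1 y b1" "b1 \<in> ext_B j P" for y b1
      using that by (simp add: r1_def)
  qed
qed

lemma ext_fg_middle:
  assumes "module R N" "module R P" "p \<in> module_hom R N P" "p ` carrier N = carrier P"
    and "ext_fg j (N\<lparr>carrier := {x \<in> carrier N. p x = \<zero>\<^bsub>P\<^esub>}\<rparr>)" "ext_fg j P"
  shows "ext_fg j N"
  by (rule ext_fg_extension[OF assms(1-5) assms(6)[unfolded ext_fg_def]])
    (rule postcompose_Z[OF assms(1-3)])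

text \<open>\<open>T\<close> is taken to be the image of all cocycles of N, finite modulo
  coboundaries because Ext^j(N) is.\<close>

lemma ext_fg_right:
  assumes "module R N" "module R P" "p \<in> module_hom R N P" "p ` carrier N = carrier P"
    and "ext_fg (Suc j) (N\<lparr>carrier := {x \<in> carrier N. p x = \<zero>\<^bsub>P\<^esub>}\<rparr>)" "ext_fg j N"
  shows "ext_fg j P"
proof (rule ext_fg_quotient[OF assms(1-5)])
  let ?\<phi> = "\<lambda>f. \<lambda>x\<in>carrier (F j). p (f x)"
  note \<phi> = Hom_postcompose[OF mF assms(1,3), of j]
  show "submodule (?\<phi> ` ext_Z j N) R (Hom_module R (F j) P)"
    by (rule submodule_image_submodule[OF mH[OF assms(1)] mH[OF assms(2)] \<phi> ext_Z_submodule[OF assms(1)]])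
  show "fg_mod R (Hom_module R (F j) P) (?\<phi> ` ext_Z j N) (ext_B j P)"
    by (rule fg_mod_image[OF mH[OF assms(1)] \<phi> assms(6)[unfolded ext_fg_def]])
      (use postcompose_B[OF assms(1-3)] in \<open>auto simp: ext_Z_def ext_B_def\<close>)
qed auto

section \<open>The ideal annihilates Ext; Ext in degree zero\<close>

abbreviation "Q \<equiv> quotient_module R (regular_module R) \<aa>"

lemma \<aa>_submodule: "submodule \<aa> R (regular_module R)"
  by (rule ideal_submodule_regular[OF R(1) ideal])

lemma eps_hom: "\<epsilon> \<in> module_hom R (F 0) Q"
  and eps_surj: "\<epsilon> ` carrier (F 0) = carrier Q"
  using res by (simp_all add: finite_free_resolution_def)

lemma eps_exact: "x \<in> carrier (F 0) \<Longrightarrow> \<epsilon> x = \<zero>\<^bsub>Q\<^esub> \<longleftrightarrow> (\<exists>y\<in>carrier (F 1). x = \<delta> 0 y)"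
proof -
  assume x: "x \<in> carrier (F 0)"
  have "a_kernel (F 0) Q \<epsilon> = \<delta> 0 ` carrier (F 1)" using res by (simp add: finite_free_resolution_def)
  moreover have "\<epsilon> x = \<zero>\<^bsub>Q\<^esub> \<longleftrightarrow> x \<in> a_kernel (F 0) Q \<epsilon>"
    using x by (auto simp: a_kernel_def kernel_def)
  ultimately show ?thesis by auto
qed

lemma Q_annihilated: assumes "y \<in> \<aa>" "q \<in> carrier Q" shows "y \<odot>\<^bsub>Q\<^esub> q = \<zero>\<^bsub>Q\<^esub>"
proof -
  interpret cring R by (rule R(1))
  interpret ideal \<aa> R by (rule ideal)
  note c = coset_hom[OF module_regular[OF R(1)] \<aa>_submodule]
  from assms(2) c(2) obtain r where r: "r \<in> carrier R" "q = \<aa> +>\<^bsub>regular_module R\<^esub> r" by (auto simp: regular_module_simps)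
  have "y \<odot>\<^bsub>Q\<^esub> q = \<aa> +>\<^bsub>regular_module R\<^esub> (y \<otimes>\<^bsub>R\<^esub> r)"
    using quotient_smult[OF module_regular[OF R(1)] \<aa>_submodule, of y r] r assms(1) by (simp add: regular_module_simps)
  also have "\<dots> = \<zero>\<^bsub>Q\<^esub>"
    using c(3)[of "y \<otimes>\<^bsub>R\<^esub> r"] r assms(1) by (simp add: regular_module_simps I_r_closed)
  finally show ?thesis .
qed

lemma smult_in_image_delta:
  assumes "y \<in> \<aa>" "x \<in> carrier (F 0)"
  shows "\<exists>z\<in>carrier (F 1). y \<odot>\<^bsub>F 0\<^esub> x = \<delta> 0 z"
proof -
  interpret ideal \<aa> R by (rule ideal)
  interpret F: module R "F 0" by (rule mF)
  show ?thesis
    using eps_exact[of "y \<odot>\<^bsub>F 0\<^esub> x"] assms module_homD[OF eps_hom] Q_annihilated[of y "\<epsilon> x"] by simp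
qed

text \<open>Multiplication by \<open>y\<close> on the resolution covers the zero map of R/a, so it
  is null-homotopic. The identity is stated in positive degrees; degree zero is
  \<open>smult_in_image_delta\<close>.\<close>

lemma smult_null_homotopic:
  assumes "y \<in> \<aa>"
  shows "\<exists>s\<in>module_hom R (F j) (F (Suc j)). \<exists>s'\<in>module_hom R (F (Suc j)) (F (Suc (Suc j))).
      \<forall>x\<in>carrier (F (Suc j)). y \<odot>\<^bsub>F (Suc j)\<^esub> x = s (\<delta> j x) \<oplus>\<^bsub>F (Suc j)\<^esub> \<delta> (Suc j) (s' x)"
proof -
  interpret ideal \<aa> R by (rule ideal)
  have y: "y \<in> carrier R" using assms by simp
  note dc = module_homD(1)[OF delta_hom]
  have lift: "\<exists>s\<in>module_hom R (F i) (F (Suc k)). \<forall>x\<in>carrier (F i). \<delta> k (s x) = q x"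
    if q: "q \<in> module_hom R (F i) (F k)" "\<And>x. x \<in> carrier (F i) \<Longrightarrow> \<exists>z\<in>carrier (F (Suc k)). q x = \<delta> k z" for i k q
  proof -
    have ex: "\<exists>z. z \<in> carrier (F (Suc k)) \<and> q v = \<delta> k z" if "v \<in> carrier (F i)" for v
      using q(2)[OF that] by blast
    from free_lift[OF mF mF linear_rel_graph[OF mF delta_hom[of k]] q(1), OF ex]
    obtain s where s: "s \<in> module_hom R (F i) (F (Suc k))"
      "\<And>v. v \<in> carrier (F i) \<Longrightarrow> s v \<in> carrier (F (Suc k)) \<and> q v = \<delta> k (s v)" by blast
    show ?thesis by (rule bexI[OF _ s(1)]) (simp add: s(2))
  qed
  have zero: "\<exists>s\<in>module_hom R (F 0) (F 1). \<forall>x\<in>carrier (F 0). y \<odot>\<^bsub>F 0\<^esub> x = \<delta> 0 (s x)"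
    using lift[of "\<lambda>x. y \<odot>\<^bsub>F 0\<^esub> x" 0 0, OF module_hom_smult[OF mF y]] smult_in_image_delta[OF assms]
    by (simp add: eq_commute)
  have step: "\<exists>s'\<in>module_hom R (F (Suc j)) (F (Suc (Suc j))).
      \<forall>x\<in>carrier (F (Suc j)). y \<odot>\<^bsub>F (Suc j)\<^esub> x = s (\<delta> j x) \<oplus>\<^bsub>F (Suc j)\<^esub> \<delta> (Suc j) (s' x)"
    if s: "s\<in>module_hom R (F j) (F (Suc j))" "\<forall>x\<in>carrier (F (Suc j)). \<delta> j (s (\<delta> j x)) = y \<odot>\<^bsub>F j\<^esub> \<delta> j x" for s j
  proof -
    interpret F: module R "F (Suc j)" by (rule mF)
    interpret F': module R "F j" by (rule mF)
    let ?q = "\<lambda>x. y \<odot>\<^bsub>F (Suc j)\<^esub> x \<ominus>\<^bsub>F (Suc j)\<^esub> s (\<delta> j x)"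
    have c: "s (\<delta> j x) \<in> carrier (F (Suc j))" if "x \<in> carrier (F (Suc j))" for x
      using module_homD(1)[OF s(1) dc[OF that]] .
    have q: "?q \<in> module_hom R (F (Suc j)) (F (Suc j))"
      by (rule module_hom_minus[OF mF mF module_hom_smult[OF mF y] module_hom_comp[OF delta_hom s(1)]])
    have "\<exists>z\<in>carrier (F (Suc (Suc j))). ?q x = \<delta> (Suc j) z" if x: "x \<in> carrier (F (Suc j))" for x
    proof -
      have "\<delta> j (?q x) = \<delta> j (y \<odot>\<^bsub>F (Suc j)\<^esub> x) \<ominus>\<^bsub>F j\<^esub> \<delta> j (s (\<delta> j x))"
        using module_hom_diff[OF mF mF delta_hom F.smult_closed[OF y x] c[OF x]] .
      also have "\<dots> = \<zero>\<^bsub>F j\<^esub>"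
        using s(2) x y dc[OF x] module_homD(3)[OF delta_hom y x] by (simp add: a_minus_def F'.r_neg)
      finally show ?thesis using delta_exact[of "?q x" j] module_homD(1)[OF q x] by blast
    qed
    from lift[OF q this] obtain s' where s': "s'\<in>module_hom R (F (Suc j)) (F (Suc (Suc j)))"
      "\<forall>x\<in>carrier (F (Suc j)). \<delta> (Suc j) (s' x) = ?q x" by auto
    have "y \<odot>\<^bsub>F (Suc j)\<^esub> x = s (\<delta> j x) \<oplus>\<^bsub>F (Suc j)\<^esub> \<delta> (Suc j) (s' x)" if x: "x \<in> carrier (F (Suc j))" for x
    proof -
      have "s (\<delta> j x) \<oplus>\<^bsub>F (Suc j)\<^esub> ?q x = (y \<odot>\<^bsub>F (Suc j)\<^esub> x) \<oplus>\<^bsub>F (Suc j)\<^esub> (s (\<delta> j x) \<oplus>\<^bsub>F (Suc j)\<^esub> \<ominus>\<^bsub>F (Suc j)\<^esub> s (\<delta> j x))"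
        using c[OF x] y x by (simp only: a_minus_def F.a_ac F.smult_closed F.a_inv_closed F.a_closed)
      then show ?thesis using s'(2) x c[OF x] y by (simp add: F.r_neg)
    qed
    with s' show ?thesis by blast
  qed
  \<comment> \<open>The invariant asks for the homotopy identity on boundaries only. That makes y x
    - s (\<delta> j x) a cycle, which is what the construction of the next homotopy
    requires.\<close>
  have *: "\<exists>s\<in>module_hom R (F j) (F (Suc j)). \<forall>x\<in>carrier (F (Suc j)). \<delta> j (s (\<delta> j x)) = y \<odot>\<^bsub>F j\<^esub> \<delta> j x" for j
  proof (induction j)
    case 0
    from zero obtain s where "s\<in>module_hom R (F 0) (F 1)" "\<forall>x\<in>carrier (F 0). y \<odot>\<^bsub>F 0\<^esub> x = \<delta> 0 (s x)" by auto
    then show ?case using dc[of _ 0] by (intro bexI[of _ s]) auto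
  next
    case (Suc j)
    then obtain s where s: "s\<in>module_hom R (F j) (F (Suc j))"
      "\<forall>x\<in>carrier (F (Suc j)). \<delta> j (s (\<delta> j x)) = y \<odot>\<^bsub>F j\<^esub> \<delta> j x" by auto
    from step[OF this] obtain s' where s': "s'\<in>module_hom R (F (Suc j)) (F (Suc (Suc j)))"
      "\<forall>x\<in>carrier (F (Suc j)). y \<odot>\<^bsub>F (Suc j)\<^esub> x = s (\<delta> j x) \<oplus>\<^bsub>F (Suc j)\<^esub> \<delta> (Suc j) (s' x)" by auto
    interpret F: module R "F (Suc j)" by (rule mF)
    have "\<delta> (Suc j) (s' (\<delta> (Suc j) x)) = y \<odot>\<^bsub>F (Suc j)\<^esub> \<delta> (Suc j) x" if x: "x \<in> carrier (F (Suc (Suc j)))" for x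
      using s'(2)[rule_format, OF dc[OF x]] delta_delta[OF x] module_hom_zero[OF mF mF s(1)]
        dc[OF module_homD(1)[OF s'(1) dc[OF x]]] by simp
    then show ?case using s'(1) by blast
  qed
  show "\<exists>s\<in>module_hom R (F j) (F (Suc j)). \<exists>s'\<in>module_hom R (F (Suc j)) (F (Suc (Suc j))).
      \<forall>x\<in>carrier (F (Suc j)). y \<odot>\<^bsub>F (Suc j)\<^esub> x = s (\<delta> j x) \<oplus>\<^bsub>F (Suc j)\<^esub> \<delta> (Suc j) (s' x)"
    using *[of j] step by blast
qed

text \<open>Composing the null-homotopy with a cocycle \<open>f\<close> kills the summand that ends
  in a boundary, so y f is the coboundary of f after \<open>s\<close>.\<close>

lemma smult_ext_Z:
  assumes N: "module R N" and y: "y \<in> \<aa>" and f: "f \<in> ext_Z j N"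
  shows "(\<lambda>x\<in>carrier (F j). y \<odot>\<^bsub>N\<^esub> f x) \<in> ext_B j N"
proof -
  interpret N: module R N by fact
  interpret ideal \<aa> R by (rule ideal)
  have yR: "y \<in> carrier R" using y by simp
  have fh: "f \<in> module_hom R (F j) N" and f0: "\<And>x. x \<in> carrier (F (Suc j)) \<Longrightarrow> f (\<delta> j x) = \<zero>\<^bsub>N\<^esub>"
    using f by (auto simp: ext_Z_def Hom_carrier)
  have c: "(\<lambda>x\<in>carrier (F j). y \<odot>\<^bsub>N\<^esub> f x) \<in> carrier (Hom_module R (F j) N)"
    by (rule Hom_restrict[OF mF module_hom_comp[OF fh module_hom_smult[OF N yR]]])
  show ?thesis
  proof (cases j)
    case 0
    have "y \<odot>\<^bsub>N\<^esub> f x = \<zero>\<^bsub>N\<^esub>" if x: "x \<in> carrier (F 0)" for x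
      using smult_in_image_delta[OF y x] module_homD(3)[OF fh yR] x f0 0 by fastforce
    then show ?thesis using c by (auto simp: 0 ext_B_0)
  next
    case (Suc k)
    from smult_null_homotopic[OF y, of k] obtain s s' where s: "s\<in>module_hom R (F k) (F (Suc k))"
      "s'\<in>module_hom R (F (Suc k)) (F (Suc (Suc k)))"
      "\<forall>x\<in>carrier (F (Suc k)). y \<odot>\<^bsub>F (Suc k)\<^esub> x = s (\<delta> k x) \<oplus>\<^bsub>F (Suc k)\<^esub> \<delta> (Suc k) (s' x)" by auto
    note dc = module_homD(1)[OF delta_hom]
    have "y \<odot>\<^bsub>N\<^esub> f x = f (s (\<delta> k x))" if x: "x \<in> carrier (F (Suc k))" for x
    proof -
      have c: "s (\<delta> k x) \<in> carrier (F (Suc k))" "s' x \<in> carrier (F (Suc (Suc k)))"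
         "\<delta> (Suc k) (s' x) \<in> carrier (F (Suc k))"
        using module_homD(1)[OF s(1) dc[OF x]] module_homD(1)[OF s(2) x] dc by auto
      have "y \<odot>\<^bsub>N\<^esub> f x = f (y \<odot>\<^bsub>F (Suc k)\<^esub> x)" using module_homD(3)[OF fh yR] x Suc by simp
      also have "\<dots> = f (s (\<delta> k x)) \<oplus>\<^bsub>N\<^esub> f (\<delta> (Suc k) (s' x))"
        using s(3) x c module_homD(2)[OF fh] Suc by simp
      also have "\<dots> = f (s (\<delta> k x))" using f0 Suc c module_homD(1)[OF fh] by simp
      finally show ?thesis .
    qed
    moreover have "(\<lambda>x. f (s x)) \<in> module_hom R (F k) N"
      using module_hom_comp[OF s(1), of f N] fh Suc by simp
    ultimately show ?thesis using c unfolding Suc ext_B_Suc by (auto intro!: bexI[of _ "\<lambda>x. f (s x)"])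
  qed
qed

text \<open>Coboundaries in degree zero vanish, so the fact that y f is a coboundary says that
  \<open>y\<close> kills the values of \<open>f\<close>.\<close>

lemma ext_Z_0_annihilated:
  assumes N: "module R N" and f: "f \<in> ext_Z 0 N" and x: "x \<in> carrier (F 0)"
  shows "f x \<in> ann_part \<aa> N"
  using smult_ext_Z[OF N _ f] x f module_homD(1)[of f R "F 0" N]
  by (auto simp: ext_B_0 ann_part_def ext_Z_def Hom_carrier)

text \<open>Under Hom(R/a, N) = (0 :_N a), a map corresponds to its value at 1. On cochains this is
  evaluation at a vector \<open>e\<close> of F 0 lying over the class of 1.\<close>

lemma ext_fg_0:
  assumes N: "module R N" and fg: "ext_fg 0 N"
  shows "fg_mod R N (ann_part \<aa> N) {\<zero>\<^bsub>N\<^esub>}"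
proof -
  interpret N: module R N by fact
  interpret ideal \<aa> R by (rule ideal)
  note reg = module_regular[OF R(1)]
  let ?c = "\<lambda>x. \<aa> +>\<^bsub>regular_module R\<^esub> x"
  note c = coset_hom[OF reg \<aa>_submodule, unfolded regular_module_simps]
  note cD = module_homD[OF c(1), unfolded regular_module_simps]
  have "?c \<one>\<^bsub>R\<^esub> \<in> carrier Q" using c(2) by auto
  then obtain e where e: "e \<in> carrier (F 0)" "\<epsilon> e = ?c \<one>\<^bsub>R\<^esub>" using eps_surj by (metis imageE)
  have ev: "(\<lambda>f. f e) \<in> module_hom R (Hom_module R (F 0) N) N"
    using e by (auto simp: module_hom_def Hom_carrier Hom_ops)
  have "(\<lambda>f. f e) ` ext_Z 0 N = ann_part \<aa> N"
  proof (intro equalityI subsetI)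
    fix u assume u: "u \<in> ann_part \<aa> N"
    then have uc: "u \<in> carrier N" and u0: "\<And>r. r \<in> \<aa> \<Longrightarrow> r \<odot>\<^bsub>N\<^esub> u = \<zero>\<^bsub>N\<^esub>" by (auto simp: ann_part_def)
    \<comment> \<open>For surjectivity, \<open>u\<close> should come from the map r + a -> r u,
      pulled back along \<open>\<epsilon>\<close>. The relation avoids choosing representatives
      \<open>r\<close>.\<close>
    define \<rho> where "\<rho> z v \<longleftrightarrow> v \<in> carrier (F 0) \<and> (\<exists>r\<in>carrier R. \<epsilon> v = ?c r \<and> z = r \<odot>\<^bsub>N\<^esub> u)" for z v
    interpret F: module R "F 0" by (rule mF)
    have lin: "linear_rel R N (F 0) \<rho>"
    proof (rule linear_relI)
      show "x \<in> carrier N \<and> y \<in> carrier (F 0)" if "\<rho> x y" for x y using that uc by (auto simp: \<rho>_def)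
      show "\<rho> (x \<oplus>\<^bsub>N\<^esub> x') (y \<oplus>\<^bsub>F 0\<^esub> y')" if xy: "\<rho> x y" "\<rho> x' y'" for x y x' y'
      proof -
        from xy obtain r r' where "r \<in> carrier R" "\<epsilon> y = ?c r" "x = r \<odot>\<^bsub>N\<^esub> u" "r' \<in> carrier R" "\<epsilon> y' = ?c r'" "x' = r' \<odot>\<^bsub>N\<^esub> u"
          by (auto simp: \<rho>_def)
        then show ?thesis using xy cD(2)[of r r'] uc module_homD(2)[OF eps_hom, of y y']
          by (auto simp: \<rho>_def N.smult_l_distr intro!: bexI[of _ "r \<oplus>\<^bsub>R\<^esub> r'"])
      qed
      show "\<rho> (s \<odot>\<^bsub>N\<^esub> x) (s \<odot>\<^bsub>F 0\<^esub> y)" if s: "s \<in> carrier R" and xy: "\<rho> x y" for s x y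
      proof -
        from xy obtain r where "r \<in> carrier R" "\<epsilon> y = ?c r" "x = r \<odot>\<^bsub>N\<^esub> u"
          by (auto simp: \<rho>_def)
        then show ?thesis using s xy cD(3)[of s r] uc module_homD(3)[OF eps_hom, of s y]
          by (auto simp: \<rho>_def N.smult_assoc1 intro!: bexI[of _ "s \<otimes>\<^bsub>R\<^esub> r"])
      qed
    qed
    have "\<exists>z. \<rho> z v" if "v \<in> carrier (F 0)" for v
    proof -
      have "\<epsilon> v \<in> ?c ` carrier R" unfolding c(2) by (rule module_homD(1)[OF eps_hom that])
      then show ?thesis using that by (auto simp: \<rho>_def)
    qed
    from free_lift[OF N mF lin module_hom_id this] obtain f where f: "f \<in> module_hom R (F 0) N"
      "\<And>v. v \<in> carrier (F 0) \<Longrightarrow> \<rho> (f v) v" by auto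
    \<comment> \<open>Two representatives of one class differ by an element of the ideal, which
      kills \<open>u\<close>; so the lifted map has the expected values.\<close>
    have fe: "f v = s \<odot>\<^bsub>N\<^esub> u" if v: "v \<in> carrier (F 0)" "\<epsilon> v = ?c s" "s \<in> carrier R" for v s
    proof -
      from f(2)[OF v(1)] obtain r where r: "r \<in> carrier R" "?c s = ?c r" "f v = r \<odot>\<^bsub>N\<^esub> u"
        using v(2) by (auto simp: \<rho>_def)
      let ?m = "r \<oplus>\<^bsub>R\<^esub> (\<ominus>\<^bsub>R\<^esub> \<one>\<^bsub>R\<^esub>) \<otimes>\<^bsub>R\<^esub> s"
      have "r \<ominus>\<^bsub>regular_module R\<^esub> s \<in> \<aa>"
        using coset_eq_iff[OF reg \<aa>_submodule, of r s] r v(3) by (simp add: regular_module_simps)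
      then have m: "?m \<in> \<aa>" using v(3)
        by (simp only: a_minus_def module_neg_eq_smult[OF reg] regular_module_simps)
      have "?m \<odot>\<^bsub>N\<^esub> u = r \<odot>\<^bsub>N\<^esub> u \<ominus>\<^bsub>N\<^esub> s \<odot>\<^bsub>N\<^esub> u"
        using r v(3) uc by (simp add: N.smult_l_distr N.smult_assoc1 a_minus_def N.smult_l_minus)
      with u0[OF m] r v(3) uc show ?thesis
        by (metis N.smult_closed N.minus_equality N.minus_minus N.a_inv_closed a_minus_def)
    qed
    have fc: "restrict f (carrier (F 0)) \<in> carrier (Hom_module R (F 0) N)" by (rule Hom_restrict[OF mF f(1)])
    have "f (\<delta> 0 x) = \<zero>\<^bsub>N\<^esub>" if x: "x \<in> carrier (F 1)" for x
    proof -
      have d: "\<delta> 0 x \<in> carrier (F 0)" using module_homD(1)[OF delta_hom, of x 0] x by simp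
      have "\<epsilon> (\<delta> 0 x) = \<zero>\<^bsub>Q\<^esub>" using eps_exact[OF d] x by blast
      also have "\<dots> = ?c \<zero>\<^bsub>R\<^esub>" using c(3)[of "\<zero>\<^bsub>R\<^esub>"] by simp
      finally show ?thesis using fe[OF d, of "\<zero>\<^bsub>R\<^esub>"] uc by simp
    qed
    then have "restrict f (carrier (F 0)) \<in> ext_Z 0 N"
      using fc module_homD(1)[OF delta_hom, of _ 0] by (auto simp: ext_Z_def)
    moreover have "u = restrict f (carrier (F 0)) e" using fe[OF e] e(1) uc by simp
    ultimately show "u \<in> (\<lambda>f. f e) ` ext_Z 0 N" by blast
  qed (use ext_Z_0_annihilated[OF N _ e(1)] in auto)
  moreover have "fg_mod R N ((\<lambda>f. f e) ` ext_Z 0 N) {\<zero>\<^bsub>N\<^esub>}"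
    by (rule fg_mod_image[OF mH[OF N] ev fg[unfolded ext_fg_def]]) (use e in \<open>auto simp: ext_B_0 ext_Z_def\<close>)
  ultimately show ?thesis by simp
qed

end

declare regular_module_simps [simp]

section \<open>Baer's criterion and torsion submodules of injective modules\<close>

lemma submodule_regular_ideal:
  assumes "cring R" "submodule D R (regular_module R)"
  shows "ideal D R"
proof -
  interpret cring R by fact
  note D = submoduleD[OF module_regular[OF assms(1)] assms(2)]
  have c: "D \<subseteq> carrier R" "\<zero>\<^bsub>R\<^esub> \<in> D"
    "\<And>a b. a \<in> D \<Longrightarrow> b \<in> D \<Longrightarrow> a \<oplus>\<^bsub>R\<^esub> b \<in> D" "\<And>r a. r \<in> carrier R \<Longrightarrow> a \<in> D \<Longrightarrow> r \<otimes>\<^bsub>R\<^esub> a \<in> D"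
    using D by (auto simp: regular_module_def)
  show ?thesis
  proof (rule idealI)
    show "subgroup D (add_monoid R)"
    proof (rule add.subgroupI)
      show "\<ominus>\<^bsub>R\<^esub> a \<in> D" if "a \<in> D" for a
        using c(4)[of "\<ominus>\<^bsub>R\<^esub> \<one>\<^bsub>R\<^esub>" a] that c(1) by (auto simp: l_minus)
    qed (use c in auto)
    show "a \<otimes>\<^bsub>R\<^esub> x \<in> D" if "a \<in> D" "x \<in> carrier R" for a x
      using c(4)[OF that(2,1)] that c(1) m_comm by (auto simp: subset_iff)
  qed (use c ring_axioms in auto)
qed

lemma ideal_sequence_stable:
  assumes "noetherian_ring R" "\<And>k::nat. ideal (H k) R" "\<And>k. H k \<subseteq> H (Suc k)"
  shows "\<exists>N. \<forall>k. H k \<subseteq> H N"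
proof -
  have "H i \<subseteq> H j" if "i \<le> j" for i j using lift_Suc_mono_le[of H, OF assms(3) that] .
  then have "H i \<subseteq> H j \<or> H j \<subseteq> H i" for i j using linear[of i j] by blast
  then have "subset.chain {I. ideal I R} (range H)"
    using assms(2) unfolding subset.chain_def by blast
  from noetherian_ring.ideal_chain_is_trivial[OF assms(1) _ this] have "\<Union>(range H) \<in> range H" by auto
  then obtain N where "\<Union>(range H) = H N" by auto
  then show ?thesis by blast
qed

text \<open>A single-valued linear relation from \<open>R\<close> to \<open>E\<close> is a homomorphism from an ideal to \<open>E\<close>.\<close>

definition baer_module :: "('a, 'r) ring_scheme \<Rightarrow> ('a, 'b, 'm) module_scheme \<Rightarrow> bool"
  where "baer_module R E \<longleftrightarrow>
    (\<forall>\<sigma>. linear_rel R (regular_module R) E \<sigma> \<longrightarrow> (\<forall>e. \<sigma> \<zero>\<^bsub>R\<^esub> e \<longrightarrow> e = \<zero>\<^bsub>E\<^esub>) \<longrightarrow>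
      (\<exists>u\<in>carrier E. \<forall>r e. \<sigma> r e \<longrightarrow> e = r \<odot>\<^bsub>E\<^esub> u))"

text \<open>The difference of two values at \<open>x\<close> is a value at zero.\<close>

lemma linear_rel_unique:
  assumes "module R M" "module R N" "linear_rel R M N \<sigma>" "\<And>e. \<sigma> \<zero>\<^bsub>M\<^esub> e \<Longrightarrow> e = \<zero>\<^bsub>N\<^esub>"
    and "\<sigma> x e" "\<sigma> x e'"
  shows "e = e'"
proof -
  interpret M: module R M by fact
  interpret N: module R N by fact
  have c: "x \<in> carrier M" "e \<in> carrier N" "e' \<in> carrier N"
    using linear_relD(1,2)[OF assms(3)] assms(5,6) by auto
  have "\<sigma> (x \<ominus>\<^bsub>M\<^esub> x) (e \<ominus>\<^bsub>N\<^esub> e')" by (rule linear_rel_diff[OF assms(1-3), OF assms(5,6)])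
  then have "e \<ominus>\<^bsub>N\<^esub> e' = \<zero>\<^bsub>N\<^esub>" using assms(4) c(1) by (simp add: a_minus_def M.r_neg)
  then have "e = \<ominus>\<^bsub>N\<^esub> (\<ominus>\<^bsub>N\<^esub> e')" using c(2,3) by (metis N.minus_equality N.a_inv_closed a_minus_def)
  then show ?thesis using c by simp
qed

lemma linear_rel_Domain:
  assumes "module R M" "module R N" "linear_rel R M N \<sigma>" "\<sigma> x0 e0"
    and "submodule K R N"
  shows "submodule {x. \<exists>e\<in>K. \<sigma> x e} R M"
proof (rule submoduleI'[OF assms(1)])
  note K = submoduleD[OF assms(2,5)]
  show "\<zero>\<^bsub>M\<^esub> \<in> {x. \<exists>e\<in>K. \<sigma> x e}" using linear_rel_zero[OF assms(1-4)] K(2) by auto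
  show "{x. \<exists>e\<in>K. \<sigma> x e} \<subseteq> carrier M" using linear_relD(1)[OF assms(3)] by auto
  show "a \<oplus>\<^bsub>M\<^esub> b \<in> {x. \<exists>e\<in>K. \<sigma> x e}" if "a \<in> {x. \<exists>e\<in>K. \<sigma> x e}" "b \<in> {x. \<exists>e\<in>K. \<sigma> x e}" for a b
    using that linear_relD(3)[OF assms(3)] K(3) by blast
  show "a \<odot>\<^bsub>M\<^esub> b \<in> {x. \<exists>e\<in>K. \<sigma> x e}" if "a \<in> carrier R" "b \<in> {x. \<exists>e\<in>K. \<sigma> x e}" for a b
    using that linear_relD(4)[OF assms(3)] K(4) by blast
qed

text \<open>The domain of the relation is an ideal, so it lives on the element type of the ring and
  is an admissible test module inside R. The element \<open>u\<close> is the value at 1 of the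
  extended map.\<close>

lemma injective_imp_baer:
  fixes E :: "('a, 'c, 'm) module_scheme"
  assumes inj: "injective_module R E"
  shows "baer_module R E"
  unfolding baer_module_def
proof (intro allI impI)
  have E: "module R E" using inj by (simp add: injective_module_def)
  interpret E: module R E by fact
  have R: "cring R" ..
  fix \<sigma> assume lin: "linear_rel R (regular_module R) E \<sigma>" and "\<forall>e. \<sigma> \<zero>\<^bsub>R\<^esub> e \<longrightarrow> e = \<zero>\<^bsub>E\<^esub>"
  then have sv: "\<And>e. \<sigma> \<zero>\<^bsub>R\<^esub> e \<Longrightarrow> e = \<zero>\<^bsub>E\<^esub>" by auto
  note reg = module_regular[OF R]
  show "\<exists>u\<in>carrier E. \<forall>r e. \<sigma> r e \<longrightarrow> e = r \<odot>\<^bsub>E\<^esub> u"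
  proof (cases "\<exists>r e. \<sigma> r e")
    case True
    then obtain r0 e0 where 0: "\<sigma> r0 e0" by auto
    define D where "D = {x. \<exists>e\<in>carrier E. \<sigma> x e}"
    have D: "submodule D R (regular_module R)" unfolding D_def
      by (rule linear_rel_Domain[OF reg E lin 0 E.carrier_is_submodule])
    define g where "g r = (THE e. \<sigma> r e)" for r
    have uniq: "e = e'" if "\<sigma> r e" "\<sigma> r e'" for r e e'
      by (rule linear_rel_unique[OF reg E lin _ that]) (simp add: sv)
    have g: "g r = e" if "\<sigma> r e" for r e unfolding g_def using that uniq by blast
    have gD: "\<sigma> r (g r)" if "r \<in> D" for r using that g by (auto simp: D_def)
    let ?A = "(regular_module R)\<lparr>carrier := D\<rparr>"
    have "g r \<in> carrier E" if "r \<in> D" for r using linear_relD(2)[OF lin, OF gD[OF that]] .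
    moreover have "g (r \<oplus>\<^bsub>R\<^esub> s) = g r \<oplus>\<^bsub>E\<^esub> g s" if "r \<in> D" "s \<in> D" for r s
      using linear_relD(3)[OF lin, OF gD[OF that(1)] gD[OF that(2)]] by (intro g) simp
    moreover have "g (r \<otimes>\<^bsub>R\<^esub> s) = r \<odot>\<^bsub>E\<^esub> g s" if "r \<in> carrier R" "s \<in> D" for r s
      using linear_relD(4)[OF lin, OF gD[OF that(2)] that(1)] by (intro g) simp
    ultimately have gh: "g \<in> module_hom R ?A E" by (auto simp: module_hom_def)
    have "(\<lambda>x. x) \<in> module_hom R ?A (regular_module R)"
      using submoduleD(1)[OF reg D] by (auto simp: module_hom_def)
    with inj submodule_module[OF reg D] reg gh obtain h where
      h: "h \<in> module_hom R (regular_module R) E" "\<forall>x\<in>D. h x = g x"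
      unfolding injective_module_def by fastforce
    have "e = r \<odot>\<^bsub>E\<^esub> h \<one>\<^bsub>R\<^esub>" if r: "\<sigma> r e" for r e
    proof -
      have rD: "r \<in> D" "r \<in> carrier R" using r linear_relD(1,2)[OF lin r] by (auto simp: D_def)
      then have "e = h r" using h(2) g[OF r] by simp
      also have "\<dots> = h (r \<odot>\<^bsub>regular_module R\<^esub> \<one>\<^bsub>R\<^esub>)" using rD by simp
      also have "\<dots> = r \<odot>\<^bsub>E\<^esub> h \<one>\<^bsub>R\<^esub>" by (rule module_homD(3)[OF h(1)]) (use rD in auto)
      finally show ?thesis .
    qed
    then show ?thesis using module_homD(1)[OF h(1), of "\<one>\<^bsub>R\<^esub>"] by auto
  next
    case False then show ?thesis by (intro bexI[of _ "\<zero>\<^bsub>E\<^esub>"]) auto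
  qed
qed

text \<open>The torsion submodule described through generators: each generator has its own exponent,
  so generators can be added one at a time. \<open>torsion_part_eq\<close> identifies it with the
  torsion part of the ideal generated by a finite set.\<close>

definition power_torsion ::
    "('a, 'r) ring_scheme \<Rightarrow> 'a set \<Rightarrow> ('a, 'b, 'm) module_scheme \<Rightarrow> 'b set"
  where "power_torsion R S N = {u \<in> carrier N. \<forall>s\<in>S. \<exists>k::nat. (s [^]\<^bsub>R\<^esub> k) \<odot>\<^bsub>N\<^esub> u = \<zero>\<^bsub>N\<^esub>}"

lemma power_kill_mono:
  assumes "module R N" "x \<in> carrier R" "u \<in> carrier N" "(x [^]\<^bsub>R\<^esub> k) \<odot>\<^bsub>N\<^esub> u = \<zero>\<^bsub>N\<^esub>" "k \<le> (l::nat)"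
  shows "(x [^]\<^bsub>R\<^esub> l) \<odot>\<^bsub>N\<^esub> u = \<zero>\<^bsub>N\<^esub>"
proof -
  interpret N: module R N by fact
  from assms(5) obtain d where l: "l = d + k" by (metis le_add_diff_inverse2)
  have "(x [^]\<^bsub>R\<^esub> l) \<odot>\<^bsub>N\<^esub> u = (x [^]\<^bsub>R\<^esub> d) \<odot>\<^bsub>N\<^esub> ((x [^]\<^bsub>R\<^esub> k) \<odot>\<^bsub>N\<^esub> u)"
    using assms(2,3) unfolding l by (simp add: N.nat_pow_mult[symmetric] N.smult_assoc1)
  then show ?thesis using assms(2,4) by simp
qed

lemma power_torsion_submodule:
  assumes "module R N" "S \<subseteq> carrier R"
  shows "submodule (power_torsion R S N) R N"
proof (rule submoduleI'[OF assms(1)])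
  interpret N: module R N by fact
  show "a \<oplus>\<^bsub>N\<^esub> b \<in> power_torsion R S N" if ab: "a \<in> power_torsion R S N" "b \<in> power_torsion R S N" for a b
  proof -
    have "\<exists>k::nat. (s [^]\<^bsub>R\<^esub> k) \<odot>\<^bsub>N\<^esub> (a \<oplus>\<^bsub>N\<^esub> b) = \<zero>\<^bsub>N\<^esub>" if s: "s \<in> S" for s
    proof -
      from ab(1) s obtain k :: nat where k: "(s [^]\<^bsub>R\<^esub> k) \<odot>\<^bsub>N\<^esub> a = \<zero>\<^bsub>N\<^esub>" by (auto simp: power_torsion_def)
      from ab(2) s obtain l :: nat where l: "(s [^]\<^bsub>R\<^esub> l) \<odot>\<^bsub>N\<^esub> b = \<zero>\<^bsub>N\<^esub>" by (auto simp: power_torsion_def)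
      have "a \<in> carrier N" "b \<in> carrier N" using ab by (auto simp: power_torsion_def)
      note kl = k l this
      have "s \<in> carrier R" using s assms(2) by auto
      with power_kill_mono[OF assms(1) _ kl(3,1), of "max k l"] power_kill_mono[OF assms(1) _ kl(4,2), of "max k l"] kl
      show ?thesis by (intro exI[of _ "max k l"]) (simp add: N.smult_r_distr)
    qed
    then show ?thesis using ab by (auto simp: power_torsion_def)
  qed
  show "r \<odot>\<^bsub>N\<^esub> a \<in> power_torsion R S N" if r: "r \<in> carrier R" "a \<in> power_torsion R S N" for r a
  proof -
    have "(s [^]\<^bsub>R\<^esub> k) \<odot>\<^bsub>N\<^esub> (r \<odot>\<^bsub>N\<^esub> a) = r \<odot>\<^bsub>N\<^esub> ((s [^]\<^bsub>R\<^esub> k) \<odot>\<^bsub>N\<^esub> a)" if "s \<in> S" for s and k :: nat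
      using that r assms(2) by (auto simp: power_torsion_def N.smult_assoc1[symmetric] N.m_comm subset_iff)
    moreover have "\<exists>k::nat. (s [^]\<^bsub>R\<^esub> k) \<odot>\<^bsub>N\<^esub> a = \<zero>\<^bsub>N\<^esub>" if "s \<in> S" for s
      using r that by (auto simp: power_torsion_def)
    ultimately show ?thesis using r unfolding power_torsion_def by (auto; metis N.smult_r_null)
  qed
  show "\<zero>\<^bsub>N\<^esub> \<in> power_torsion R S N" using assms(2) by (auto simp: power_torsion_def subset_iff)
qed (auto simp: power_torsion_def)

text \<open>
  For a principal ideal the Artin--Rees argument is elementary: if \<open>D\<close> is the domain of a partial
  map killed by \<open>x ^ N\<close> and the ideals \<open>(D : x ^ k)\<close> are stationary from \<open>J\<close> on, then the map
  vanishes on \<open>D \<inter> x ^ (N + J) R\<close>, so it extends by zero to \<open>x ^ (N + J) R\<close>.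
\<close>

lemma baer_principal_torsion:
  assumes R: "cring R" "noetherian_ring R" and E: "module R E" "baer_module R E" and x: "x \<in> carrier R"
  shows "baer_module R (E\<lparr>carrier := power_torsion R {x} E\<rparr>)"
  unfolding baer_module_def
proof (intro allI impI)
  interpret E: module R E by (rule E(1))
  let ?G = "E\<lparr>carrier := power_torsion R {x} E\<rparr>"
  have sG: "submodule (power_torsion R {x} E) R E" using power_torsion_submodule[OF E(1)] x by auto
  note reg = module_regular[OF R(1)]
  fix \<sigma> assume lin: "linear_rel R (regular_module R) ?G \<sigma>" and "\<forall>e. \<sigma> \<zero>\<^bsub>R\<^esub> e \<longrightarrow> e = \<zero>\<^bsub>?G\<^esub>"
  then have sv: "\<And>e. \<sigma> \<zero>\<^bsub>R\<^esub> e \<Longrightarrow> e = \<zero>\<^bsub>E\<^esub>" by auto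
  have linE: "linear_rel R (regular_module R) E \<sigma>"
    using lin submoduleD(1)[OF E(1) sG] by (auto simp: linear_rel_def)
  have uniq: "e = e'" if "\<sigma> r e" "\<sigma> r e'" for r e e'
    by (rule linear_rel_unique[OF reg E(1) linE _ that]) (simp add: sv)
  show "\<exists>u\<in>carrier ?G. \<forall>r e. \<sigma> r e \<longrightarrow> e = r \<odot>\<^bsub>?G\<^esub> u"
  proof (cases "\<exists>r e. \<sigma> r e")
    case False then show ?thesis using submoduleD(2)[OF E(1) sG] by auto
  next
    case True
    then obtain r0 e0 where 0: "\<sigma> r0 e0" by auto
    have xk[simp]: "x [^]\<^bsub>R\<^esub> (k::nat) \<in> carrier R" for k using x by simp
    define K where "K k = {e \<in> carrier E. (x [^]\<^bsub>R\<^esub> (k::nat)) \<odot>\<^bsub>E\<^esub> e = \<zero>\<^bsub>E\<^esub>}" for k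
    have sK: "submodule (K k) R E" for k
      unfolding K_def by (rule submodule_kernel[OF E(1) E(1) module_hom_smult[OF E(1)]]) simp
    define D where "D = {r. \<exists>e\<in>carrier E. \<sigma> r e}"
    have sD: "submodule D R (regular_module R)" unfolding D_def
      by (rule linear_rel_Domain[OF reg E(1) linE 0 E.carrier_is_submodule])
    \<comment> \<open>The domain is the union of the ideals on which the values are killed by x^k.
      The ascending chain condition yields one exponent for all values.\<close>
    have "\<exists>N. \<forall>k. {r. \<exists>e\<in>K k. \<sigma> r e} \<subseteq> {r. \<exists>e\<in>K N. \<sigma> r e}"
    proof (rule ideal_sequence_stable[OF R(2)])
      show "ideal {r. \<exists>e\<in>K k. \<sigma> r e} R" for k
        by (rule submodule_regular_ideal[OF R(1) linear_rel_Domain[OF reg E(1) linE 0 sK]])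
      show "{r. \<exists>e\<in>K k. \<sigma> r e} \<subseteq> {r. \<exists>e\<in>K (Suc k). \<sigma> r e}" for k
        using power_kill_mono[OF E(1) x, of _ k "Suc k"] unfolding K_def by force
    qed
    then obtain N where N: "\<And>k. {r. \<exists>e\<in>K k. \<sigma> r e} \<subseteq> {r. \<exists>e\<in>K N. \<sigma> r e}" by auto
    have kill: "(x [^]\<^bsub>R\<^esub> N) \<odot>\<^bsub>E\<^esub> e = \<zero>\<^bsub>E\<^esub>" if re: "\<sigma> r e" for r e
    proof -
      have "e \<in> power_torsion R {x} E" using linear_relD(2)[OF lin, OF re] by simp
      then obtain k where "e \<in> K k" by (auto simp: power_torsion_def K_def)
      with re N[of k] obtain e' where "e' \<in> K N" "\<sigma> r e'" by blast
      with uniq[OF re] show ?thesis by (auto simp: K_def)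
    qed
    have "\<exists>J::nat. \<forall>k::nat. {s \<in> carrier R. (x [^]\<^bsub>R\<^esub> k) \<otimes>\<^bsub>R\<^esub> s \<in> D} \<subseteq> {s \<in> carrier R. (x [^]\<^bsub>R\<^esub> J) \<otimes>\<^bsub>R\<^esub> s \<in> D}"
    proof (rule ideal_sequence_stable[OF R(2)])
      fix k :: nat
      show "ideal {s \<in> carrier R. (x [^]\<^bsub>R\<^esub> k) \<otimes>\<^bsub>R\<^esub> s \<in> D} R"
        using submodule_regular_ideal[OF R(1) submodule_preimage[OF reg reg module_hom_smult[OF reg xk] sD], of k]
        by simp
      have "(x [^]\<^bsub>R\<^esub> Suc k) \<otimes>\<^bsub>R\<^esub> s = x \<otimes>\<^bsub>R\<^esub> ((x [^]\<^bsub>R\<^esub> k) \<otimes>\<^bsub>R\<^esub> s)" if "s \<in> carrier R" for s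
        using that x by (simp add: E.m_ac)
      then show "{s \<in> carrier R. (x [^]\<^bsub>R\<^esub> k) \<otimes>\<^bsub>R\<^esub> s \<in> D} \<subseteq> {s \<in> carrier R. (x [^]\<^bsub>R\<^esub> Suc k) \<otimes>\<^bsub>R\<^esub> s \<in> D}"
        using submoduleD(4)[OF reg sD x] by auto
    qed
    then obtain J :: nat where J0: "\<And>k::nat. {s \<in> carrier R. (x [^]\<^bsub>R\<^esub> k) \<otimes>\<^bsub>R\<^esub> s \<in> D} \<subseteq> {s \<in> carrier R. (x [^]\<^bsub>R\<^esub> J) \<otimes>\<^bsub>R\<^esub> s \<in> D}"
      by (elim exE) (rule that, erule spec)
    have J: "(x [^]\<^bsub>R\<^esub> J) \<otimes>\<^bsub>R\<^esub> s \<in> D" if "s \<in> carrier R" "(x [^]\<^bsub>R\<^esub> k) \<otimes>\<^bsub>R\<^esub> s \<in> D" for k :: nat and s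
      using J0[of k] that by auto
    define m where "m = N + J"
    define \<tau> where "\<tau> r e \<longleftrightarrow> (\<exists>r1 s. \<sigma> r1 e \<and> s \<in> carrier R \<and> r = r1 \<oplus>\<^bsub>R\<^esub> (x [^]\<^bsub>R\<^esub> m) \<otimes>\<^bsub>R\<^esub> s)" for r e
    have c: "r \<in> carrier R" "e \<in> carrier E" if "\<sigma> r e" for r e using linear_relD(1,2)[OF linE that] by auto
    have "linear_rel R (regular_module R) E \<tau>"
    proof (rule linear_relI)
      show "r \<in> carrier (regular_module R) \<and> e \<in> carrier E" if "\<tau> r e" for r e using that c by (auto simp: \<tau>_def)
    next
      fix r e r' e' assume "\<tau> r e" "\<tau> r' e'"
      then obtain r1 s r1' s' where 1: "\<sigma> r1 e" "s \<in> carrier R" "r = r1 \<oplus>\<^bsub>R\<^esub> (x [^]\<^bsub>R\<^esub> m) \<otimes>\<^bsub>R\<^esub> s"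
        "\<sigma> r1' e'" "s' \<in> carrier R" "r' = r1' \<oplus>\<^bsub>R\<^esub> (x [^]\<^bsub>R\<^esub> m) \<otimes>\<^bsub>R\<^esub> s'" by (auto simp: \<tau>_def)
      have "r \<oplus>\<^bsub>R\<^esub> r' = (r1 \<oplus>\<^bsub>R\<^esub> r1') \<oplus>\<^bsub>R\<^esub> (x [^]\<^bsub>R\<^esub> m) \<otimes>\<^bsub>R\<^esub> (s \<oplus>\<^bsub>R\<^esub> s')"
        using 1 c(1)[OF 1(1)] c(1)[OF 1(4)] by (simp add: E.r_distr E.R.add.m_ac)
      with 1 linear_relD(3)[OF linE, OF 1(1,4)] show "\<tau> (r \<oplus>\<^bsub>regular_module R\<^esub> r') (e \<oplus>\<^bsub>E\<^esub> e')"
        unfolding \<tau>_def by (intro exI[of _ "r1 \<oplus>\<^bsub>R\<^esub> r1'"] exI[of _ "s \<oplus>\<^bsub>R\<^esub> s'"]) simp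
    next
      fix a r e assume a: "a \<in> carrier R" and "\<tau> r e"
      then obtain r1 s where 1: "\<sigma> r1 e" "s \<in> carrier R" "r = r1 \<oplus>\<^bsub>R\<^esub> (x [^]\<^bsub>R\<^esub> m) \<otimes>\<^bsub>R\<^esub> s" by (auto simp: \<tau>_def)
      have "a \<otimes>\<^bsub>R\<^esub> r = (a \<otimes>\<^bsub>R\<^esub> r1) \<oplus>\<^bsub>R\<^esub> (x [^]\<^bsub>R\<^esub> m) \<otimes>\<^bsub>R\<^esub> (a \<otimes>\<^bsub>R\<^esub> s)"
        using 1 a c(1)[OF 1(1)] by (simp add: E.r_distr E.m_lcomm)
      with 1 a linear_relD(4)[OF linE, OF 1(1) a] show "\<tau> (a \<odot>\<^bsub>regular_module R\<^esub> r) (a \<odot>\<^bsub>E\<^esub> e)"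
        unfolding \<tau>_def by (intro exI[of _ "a \<otimes>\<^bsub>R\<^esub> r1"] exI[of _ "a \<otimes>\<^bsub>R\<^esub> s"]) simp
    qed
    moreover have "e = \<zero>\<^bsub>E\<^esub>" if "\<tau> \<zero>\<^bsub>R\<^esub> e" for e
    proof -
      from that obtain r1 s where 1: "\<sigma> r1 e" "s \<in> carrier R" "\<zero>\<^bsub>R\<^esub> = r1 \<oplus>\<^bsub>R\<^esub> (x [^]\<^bsub>R\<^esub> m) \<otimes>\<^bsub>R\<^esub> s" by (auto simp: \<tau>_def)
      have r1: "r1 \<in> D" "r1 \<in> carrier R" using 1(1) c by (auto simp: D_def)
      have "(x [^]\<^bsub>R\<^esub> m) \<otimes>\<^bsub>R\<^esub> s = \<ominus>\<^bsub>R\<^esub> r1"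
        using 1 r1 by (metis E.R.minus_equality E.R.minus_minus E.R.add.m_comm E.m_closed xk)
      moreover have "\<ominus>\<^bsub>R\<^esub> r1 \<in> D"
        using submoduleD(4)[OF reg sD, of "\<ominus>\<^bsub>R\<^esub> \<one>\<^bsub>R\<^esub>" r1] r1 by (simp add: E.l_minus)
      ultimately have "(x [^]\<^bsub>R\<^esub> m) \<otimes>\<^bsub>R\<^esub> s \<in> D" by simp
      \<comment> \<open>x^J s lies in the domain, and x^N kills its value, so x^m s has the value
        zero. This is the source of m = N + J.\<close>
      from J[OF 1(2) this] obtain e1 where e1: "\<sigma> ((x [^]\<^bsub>R\<^esub> J) \<otimes>\<^bsub>R\<^esub> s) e1" by (auto simp: D_def)
      have "\<sigma> ((x [^]\<^bsub>R\<^esub> N) \<odot>\<^bsub>regular_module R\<^esub> ((x [^]\<^bsub>R\<^esub> J) \<otimes>\<^bsub>R\<^esub> s)) ((x [^]\<^bsub>R\<^esub> N) \<odot>\<^bsub>E\<^esub> e1)"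
        by (rule linear_relD(4)[OF linE, OF e1 xk])
      moreover have "(x [^]\<^bsub>R\<^esub> N) \<otimes>\<^bsub>R\<^esub> ((x [^]\<^bsub>R\<^esub> J) \<otimes>\<^bsub>R\<^esub> s) = (x [^]\<^bsub>R\<^esub> m) \<otimes>\<^bsub>R\<^esub> s"
        using x 1(2) by (simp add: m_def E.nat_pow_mult[symmetric] E.m_assoc)
      ultimately have "\<sigma> ((x [^]\<^bsub>R\<^esub> m) \<otimes>\<^bsub>R\<^esub> s) \<zero>\<^bsub>E\<^esub>" using kill[OF e1] by simp
      from linear_relD(3)[OF linE, OF 1(1) this] have "\<sigma> \<zero>\<^bsub>R\<^esub> e" using 1(3) c(2)[OF 1(1)] by simp
      then show ?thesis by (rule sv)
    qed
    ultimately obtain u where u: "u \<in> carrier E" "\<And>r e. \<tau> r e \<Longrightarrow> e = r \<odot>\<^bsub>E\<^esub> u"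
      using E(2) unfolding baer_module_def by blast
    \<comment> \<open>The enlarged map is zero at x^m, so x^m kills the representing element
      \<open>u\<close>, which is therefore torsion.\<close>
    have "\<tau> (x [^]\<^bsub>R\<^esub> m) \<zero>\<^bsub>E\<^esub>"
      using linear_rel_zero[OF reg E(1) linE 0] unfolding \<tau>_def
      by (intro exI[of _ "\<zero>\<^bsub>R\<^esub>"] exI[of _ "\<one>\<^bsub>R\<^esub>"]) simp
    from u(2)[OF this] have "u \<in> carrier ?G" using u(1) by (auto simp: power_torsion_def intro!: exI[of _ m])
    moreover have "\<tau> r e" if "\<sigma> r e" for r e
      using that c[OF that] unfolding \<tau>_def by (intro exI[of _ r] exI[of _ "\<zero>\<^bsub>R\<^esub>"]) simp
    ultimately show ?thesis by (intro bexI[of _ u]) (auto intro: u(2))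
  qed
qed

text \<open>Torsion for one more generator, taken inside the torsion already cut out, is torsion for
  the enlarged set; so the principal case can be iterated.\<close>

lemma baer_power_torsion:
  assumes R: "cring R" "noetherian_ring R" and E: "module R E" "baer_module R E"
    and S: "finite S" "S \<subseteq> carrier R"
  shows "baer_module R (E\<lparr>carrier := power_torsion R S E\<rparr>)"
  using S
proof (induction S)
  case empty
  have "power_torsion R {} E = carrier E" by (simp add: power_torsion_def)
  then show ?case using E(2) by (simp add: baer_module_def linear_rel_def)
next
  case (insert s S)
  have m: "module R (E\<lparr>carrier := power_torsion R S E\<rparr>)"
    using submodule_module[OF E(1) power_torsion_submodule[OF E(1)]] insert.prems by auto
  have "power_torsion R {s} (E\<lparr>carrier := power_torsion R S E\<rparr>) = power_torsion R (insert s S) E"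
    by (auto simp: power_torsion_def)
  then show ?case
    using baer_principal_torsion[OF R m insert.IH, of s] insert.prems by simp
qed

text \<open>Baer's criterion for partial maps out of R^m, one coordinate at a time: extend the part
  defined on R^m, then correct the last coordinate by a multiple of a single element.\<close>

lemma baer_extend_free:
  assumes E: "module R E" "baer_module R E"
    and "linear_rel R (free_module R m) E \<rho>" "\<And>e. \<rho> \<zero>\<^bsub>free_module R m\<^esub> e \<Longrightarrow> e = \<zero>\<^bsub>E\<^esub>"
  shows "\<exists>g\<in>module_hom R (free_module R m) E. \<forall>v e. \<rho> v e \<longrightarrow> g v = e"
  using assms(3,4)
proof (induction m arbitrary: \<rho>)
  interpret E: module R E by (rule E(1))
  case 0
  have F: "carrier (free_module R 0) = {\<zero>\<^bsub>free_module R 0\<^esub>}" by (auto simp: free_module_def)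
  show ?case
    by (intro bexI[of _ "\<lambda>_. \<zero>\<^bsub>E\<^esub>"]) (use 0 linear_relD(1)[OF 0(1)] in \<open>auto simp: F module_hom_def\<close>)
next
  interpret E: module R E by (rule E(1))
  have R: "cring R" ..
  case (Suc m)
  interpret F: module R "free_module R m" by (rule module_free[OF R])
  note s = free_Suc[OF R, where n=m]
  note c = linear_relD(1,2)[OF Suc.prems(1)]
  have lin: "linear_rel R (free_module R m) E (\<lambda>v e. \<rho> v e \<and> v \<in> carrier (free_module R m))"
    using Suc.prems(1) F.a_closed F.smult_closed by (auto simp: linear_rel_def free_ops)
  have "\<exists>g\<in>module_hom R (free_module R m) E. \<forall>v e. \<rho> v e \<and> v \<in> carrier (free_module R m) \<longrightarrow> g v = e"
    by (rule Suc.IH[OF lin]) (use Suc.prems(2) in \<open>auto simp: free_ops\<close>)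
  then obtain g where g: "g \<in> module_hom R (free_module R m) E"
     "\<And>v e. \<rho> v e \<Longrightarrow> v \<in> carrier (free_module R m) \<Longrightarrow> g v = e" by auto
  let ?t = "\<lambda>v. v(m := \<zero>\<^bsub>R\<^esub>)"
  have gc: "g (?t v) \<in> carrier E" if "v \<in> carrier (free_module R (Suc m))" for v
    using module_homD(1)[OF g(1) s(3)[OF that]] .
  \<comment> \<open>After subtracting the extension \<open>g\<close> of the earlier coordinates, the
    remaining value depends only on the last coordinate, which gives a partial map from R.\<close>
  define \<sigma> where "\<sigma> r e \<longleftrightarrow> (\<exists>v e0. \<rho> v e0 \<and> r = v m \<and> e = e0 \<ominus>\<^bsub>E\<^esub> g (?t v))" for r e
  have "linear_rel R (regular_module R) E \<sigma>"
  proof (rule linear_relI)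
    show "r \<in> carrier (regular_module R) \<and> e \<in> carrier E" if re: "\<sigma> r e" for r e
    proof -
      from re obtain v e0 where v: "\<rho> v e0" "r = v m" "e = e0 \<ominus>\<^bsub>E\<^esub> g (?t v)" by (auto simp: \<sigma>_def)
      then show ?thesis using c[OF v(1)] gc free_carrierD[OF R] by auto
    qed
  next
    fix r e r' e' assume "\<sigma> r e" "\<sigma> r' e'"
    then obtain v e0 v' e0' where v: "\<rho> v e0" "r = v m" "e = e0 \<ominus>\<^bsub>E\<^esub> g (?t v)"
       "\<rho> v' e0'" "r' = v' m" "e' = e0' \<ominus>\<^bsub>E\<^esub> g (?t v')" by (auto simp: \<sigma>_def)
    let ?v = "v \<oplus>\<^bsub>free_module R (Suc m)\<^esub> v'"
    have "?t ?v = ?t v \<oplus>\<^bsub>free_module R m\<^esub> ?t v'" by (auto simp: free_ops)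
    then have "g (?t ?v) = g (?t v) \<oplus>\<^bsub>E\<^esub> g (?t v')"
      using module_homD(2)[OF g(1) s(3)[OF c(1)[OF v(1)]] s(3)[OF c(1)[OF v(4)]]] by simp
    then have "e \<oplus>\<^bsub>E\<^esub> e' = (e0 \<oplus>\<^bsub>E\<^esub> e0') \<ominus>\<^bsub>E\<^esub> g (?t ?v)"
      using v c[OF v(1)] c[OF v(4)] gc by (simp add: a_minus_def E.minus_add E.a_ac)
    moreover have "?v m = r \<oplus>\<^bsub>R\<^esub> r'" using v by (simp add: free_ops)
    ultimately show "\<sigma> (r \<oplus>\<^bsub>regular_module R\<^esub> r') (e \<oplus>\<^bsub>E\<^esub> e')"
      using linear_relD(3)[OF Suc.prems(1), OF v(1,4)] unfolding \<sigma>_def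
      by (intro exI[of _ ?v] exI[of _ "e0 \<oplus>\<^bsub>E\<^esub> e0'"]) simp
  next
    fix a r e assume a: "a \<in> carrier R" and "\<sigma> r e"
    then obtain v e0 where v: "\<rho> v e0" "r = v m" "e = e0 \<ominus>\<^bsub>E\<^esub> g (?t v)" by (auto simp: \<sigma>_def)
    let ?v = "a \<odot>\<^bsub>free_module R (Suc m)\<^esub> v"
    have "?t ?v = a \<odot>\<^bsub>free_module R m\<^esub> ?t v" using a by (auto simp: free_ops)
    then have "g (?t ?v) = a \<odot>\<^bsub>E\<^esub> g (?t v)"
      using module_homD(3)[OF g(1) a s(3)[OF c(1)[OF v(1)]]] by simp
    then have "a \<odot>\<^bsub>E\<^esub> e = (a \<odot>\<^bsub>E\<^esub> e0) \<ominus>\<^bsub>E\<^esub> g (?t ?v)"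
      using v c[OF v(1)] gc a by (simp add: a_minus_def E.smult_r_distr E.smult_r_minus)
    moreover have "?v m = a \<otimes>\<^bsub>R\<^esub> r" using v by (simp add: free_ops)
    ultimately show "\<sigma> (a \<odot>\<^bsub>regular_module R\<^esub> r) (a \<odot>\<^bsub>E\<^esub> e)"
      using linear_relD(4)[OF Suc.prems(1), OF v(1) a] unfolding \<sigma>_def
      by (intro exI[of _ ?v] exI[of _ "a \<odot>\<^bsub>E\<^esub> e0"]) simp
  qed
  moreover have "e = \<zero>\<^bsub>E\<^esub>" if "\<sigma> \<zero>\<^bsub>R\<^esub> e" for e
  proof -
    from that obtain v e0 where v: "\<rho> v e0" "\<zero>\<^bsub>R\<^esub> = v m" "e = e0 \<ominus>\<^bsub>E\<^esub> g (?t v)" by (auto simp: \<sigma>_def)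
    have t: "?t v = v" using v(2) by auto
    with s(3)[OF c(1)[OF v(1)]] g(2)[OF v(1)] v(3) c(2)[OF v(1)] show ?thesis
      by (simp add: a_minus_def E.r_neg)
  qed
  ultimately obtain u where u: "u \<in> carrier E" "\<And>r e. \<sigma> r e \<Longrightarrow> e = r \<odot>\<^bsub>E\<^esub> u"
    using E(2) unfolding baer_module_def by blast
  show ?case
  proof (intro bexI[OF _ free_hom_extend(1)[OF E(1) g(1) u(1)]] allI impI)
    fix v e assume v: "\<rho> v e"
    then have "e \<ominus>\<^bsub>E\<^esub> g (?t v) = v m \<odot>\<^bsub>E\<^esub> u" by (intro u(2)) (auto simp: \<sigma>_def)
    then have "g (?t v) \<oplus>\<^bsub>E\<^esub> v m \<odot>\<^bsub>E\<^esub> u = g (?t v) \<oplus>\<^bsub>E\<^esub> (e \<ominus>\<^bsub>E\<^esub> g (?t v))" by simp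
    also have "\<dots> = e" using c[OF v] gc[OF c(1)[OF v]]
      by (metis E.a_closed E.a_inv_closed E.add.m_lcomm E.r_neg E.r_zero a_minus_def)
    finally show "g (?t v) \<oplus>\<^bsub>E\<^esub> v m \<odot>\<^bsub>E\<^esub> u = e" .
  qed
qed

context ext_context
begin

text \<open>Ext vanishes in positive degrees: by exactness a cocycle is constant on the fibres of
  \<open>\<delta> k\<close>, so it defines a map on the image of \<open>\<delta> k\<close>, and this
  extends to all of F k.\<close>

lemma ext_fg_baer:
  assumes E: "module R E" "baer_module R E"
  shows "ext_fg (Suc k) E"
proof -
  interpret E: module R E by (rule E(1))
  have "ext_Z (Suc k) E \<subseteq> ext_B (Suc k) E"
  proof
    fix f assume f: "f \<in> ext_Z (Suc k) E"
    then have fh: "f \<in> module_hom R (F (Suc k)) E" and fc: "f \<in> carrier (Hom_module R (F (Suc k)) E)"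
      by (auto simp: ext_Z_def Hom_carrier)
    define \<rho> where "\<rho> v e \<longleftrightarrow> (\<exists>x\<in>carrier (F (Suc k)). v = \<delta> k x \<and> e = f x)" for v e
    interpret F: module R "F (Suc k)" by (rule mF)
    have "linear_rel R (F k) E \<rho>"
    proof (rule linear_relI)
      show "x \<in> carrier (F k) \<and> y \<in> carrier E" if "\<rho> x y" for x y
        using that module_homD(1)[OF delta_hom] module_homD(1)[OF fh] by (auto simp: \<rho>_def)
      show "\<rho> (x \<oplus>\<^bsub>F k\<^esub> x') (y \<oplus>\<^bsub>E\<^esub> y')" if xy: "\<rho> x y" "\<rho> x' y'" for x y x' y'
      proof -
        from xy obtain u u' where "u \<in> carrier (F (Suc k))" "x = \<delta> k u" "y = f u"
          "u' \<in> carrier (F (Suc k))" "x' = \<delta> k u'" "y' = f u'" by (auto simp: \<rho>_def)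
        then show ?thesis using module_homD(2)[OF delta_hom, of u k u'] module_homD(2)[OF fh, of u u']
          by (auto simp: \<rho>_def intro!: bexI[of _ "u \<oplus>\<^bsub>F (Suc k)\<^esub> u'"])
      qed
      show "\<rho> (r \<odot>\<^bsub>F k\<^esub> x) (r \<odot>\<^bsub>E\<^esub> y)" if r: "r \<in> carrier R" and xy: "\<rho> x y" for r x y
      proof -
        from xy obtain u where "u \<in> carrier (F (Suc k))" "x = \<delta> k u" "y = f u" by (auto simp: \<rho>_def)
        then show ?thesis using r module_homD(3)[OF delta_hom r, of u k] module_homD(3)[OF fh r, of u]
          by (auto simp: \<rho>_def intro!: bexI[of _ "r \<odot>\<^bsub>F (Suc k)\<^esub> u"])
      qed
    qed
    moreover have "e = \<zero>\<^bsub>E\<^esub>" if "\<rho> \<zero>\<^bsub>F k\<^esub> e" for e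
    proof -
      from that obtain x where x: "x \<in> carrier (F (Suc k))" "\<delta> k x = \<zero>\<^bsub>F k\<^esub>" "e = f x" by (auto simp: \<rho>_def)
      with delta_exact[OF x(1)] f show ?thesis by (auto simp: ext_Z_def)
    qed
    ultimately obtain g where g: "g \<in> module_hom R (F k) E" "\<forall>v e. \<rho> v e \<longrightarrow> g v = e"
      using baer_extend_free[OF E] by blast
    have "f x = g (\<delta> k x)" if "x \<in> carrier (F (Suc k))" for x
      by (rule g(2)[rule_format, symmetric]) (use that in \<open>auto simp: \<rho>_def\<close>)
    then show "f \<in> ext_B (Suc k) E" using fc g(1) by (auto simp: ext_B_Suc)
  qed
  with ext_B_subset_Z[OF E(1)] have "ext_Z (Suc k) E = ext_B (Suc k) E" by blast
  then show ?thesis unfolding ext_fg_def using fg_mod_self[OF mH[OF E(1)] ext_B_submodule[OF E(1)]] by simp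
qed

end

section \<open>The torsion functor\<close>

lemma ideal_pow:
  assumes "cring R" "ideal \<aa> R"
  shows "\<aa> [^]\<^bsub>ideals_set R\<^esub> (0::nat) = carrier R"
    and "\<aa> [^]\<^bsub>ideals_set R\<^esub> (Suc n) = ideal_prod R (\<aa> [^]\<^bsub>ideals_set R\<^esub> n) \<aa>"
    and "ideal (\<aa> [^]\<^bsub>ideals_set R\<^esub> n) R"
proof -
  interpret cring R by fact
  show 1: "\<aa> [^]\<^bsub>ideals_set R\<^esub> (0::nat) = carrier R"
    by (simp add: nat_pow_def ideals_set_def)
  show 2: "\<aa> [^]\<^bsub>ideals_set R\<^esub> (Suc n) = ideal_prod R (\<aa> [^]\<^bsub>ideals_set R\<^esub> n) \<aa>" for n
    by (simp add: nat_pow_def ideals_set_def)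
  show "ideal (\<aa> [^]\<^bsub>ideals_set R\<^esub> n) R"
    by (induction n) (auto simp only: 1 2 oneideal intro!: ideal_prod_is_ideal assms(2))
qed

lemma element_pow_in_ideal_pow:
  assumes "cring R" "ideal \<aa> R" "x \<in> \<aa>"
  shows "x [^]\<^bsub>R\<^esub> (n::nat) \<in> \<aa> [^]\<^bsub>ideals_set R\<^esub> n"
proof (induction n)
  interpret cring R by fact
  case 0 then show ?case unfolding ideal_pow(1)[OF assms(1,2)] by simp
next
  interpret cring R by fact
  case (Suc n)
  then show ?case unfolding ideal_pow(2)[OF assms(1,2)] nat_pow_Suc using assms(3) by (intro ideal_prod.prod)
qed

text \<open>
  If a power \<open>s ^ k s\<close> of every generator kills \<open>u\<close>, then a product of more than \<open>\<Sum>s. k s\<close>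
  elements of the ideal does: the induction on this sum passes from \<open>u\<close> to \<open>s u\<close>.
\<close>

lemma ideal_pow_kills:
  assumes "cring R" "module R N" "finite S" "S \<subseteq> carrier R"
  defines "\<aa> \<equiv> Idl\<^bsub>R\<^esub> S"
  assumes "u \<in> carrier N" "\<And>s. s \<in> S \<Longrightarrow> (s [^]\<^bsub>R\<^esub> (k s :: nat)) \<odot>\<^bsub>N\<^esub> u = \<zero>\<^bsub>N\<^esub>"
    and "r \<in> \<aa> [^]\<^bsub>ideals_set R\<^esub> Suc (sum k S)"
  shows "r \<odot>\<^bsub>N\<^esub> u = \<zero>\<^bsub>N\<^esub>"
  using assms(6-8)
proof (induction "sum k S" arbitrary: u k r)
  interpret N: module R N by fact
  have a: "ideal \<aa> R" unfolding \<aa>_def by (rule N.genideal_ideal[OF assms(4)])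
  note pw = ideal_pow[OF assms(1) a]
  case (0 k u r)
  show ?case
  \<comment> \<open>The exponent is at least one, so for empty \<open>S\<close> the element
    \<open>r\<close> lies in the zero ideal. Otherwise some generator has exponent zero and
    \<open>u\<close> itself vanishes.\<close>
  proof (cases "S = {}")
    case True
    have "{\<zero>\<^bsub>R\<^esub>} = Idl\<^bsub>R\<^esub> {}"
      by (rule antisym) (use N.zeroideal N.genideal_minimal[OF N.zeroideal] N.genideal_ideal[of "{}"]
          additive_subgroup.zero_closed[OF ideal.axioms(1)] in auto)
    then have a0: "\<aa> = {\<zero>\<^bsub>R\<^esub>}" using True by (simp add: \<aa>_def)
    have "r \<in> \<aa>" using 0(4) N.ideal_prod_inter[OF pw(3) a, of "sum k S"] unfolding pw(2) by auto
    then show ?thesis using a0 0(2) by simp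
  next
    case False
    then obtain s where s: "s \<in> S" by auto
    then have "k s = 0" using 0(1) assms(3) by simp
    with 0(3)[OF s] 0(2) have "u = \<zero>\<^bsub>N\<^esub>" by simp
    then show ?thesis using ideal.Icarr[OF pw(3) 0(4)] by simp
  qed
next
  interpret N: module R N by fact
  have a: "ideal \<aa> R" unfolding \<aa>_def by (rule N.genideal_ideal[OF assms(4)])
  note pw = ideal_pow[OF assms(1) a]
  case (Suc m k u r)
  let ?P = "\<aa> [^]\<^bsub>ideals_set R\<^esub> Suc m"
  have Pc: "w \<in> carrier R" if "w \<in> ?P" for w using ideal.Icarr[OF pw(3) that] .
  \<comment> \<open>The \<open>t\<close> for which the power with exponent \<open>Suc m\<close>
    kills t u form an ideal. It suffices that the generators belong to it, and that is the induction
    hypothesis for s u.\<close>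
  define T where "T = {t \<in> carrier R. \<forall>w\<in>?P. w \<odot>\<^bsub>N\<^esub> (t \<odot>\<^bsub>N\<^esub> u) = \<zero>\<^bsub>N\<^esub>}"
  have "submodule T R (regular_module R)"
  proof (rule submoduleI'[OF module_regular[OF assms(1)]])
    show "b \<odot>\<^bsub>regular_module R\<^esub> t \<in> T" if bt: "b \<in> carrier R" "t \<in> T" for b t
    proof -
      have "w \<odot>\<^bsub>N\<^esub> ((b \<otimes>\<^bsub>R\<^esub> t) \<odot>\<^bsub>N\<^esub> u) = b \<odot>\<^bsub>N\<^esub> (w \<odot>\<^bsub>N\<^esub> (t \<odot>\<^bsub>N\<^esub> u))" if w: "w \<in> ?P" for w
      proof -
        have "w \<otimes>\<^bsub>R\<^esub> (b \<otimes>\<^bsub>R\<^esub> t) = b \<otimes>\<^bsub>R\<^esub> (w \<otimes>\<^bsub>R\<^esub> t)" using bt Pc[OF w] by (simp add: T_def N.m_lcomm)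
        then show ?thesis using bt Pc[OF w] Suc(3) by (simp add: T_def N.smult_assoc1[symmetric])
      qed
      then show ?thesis using bt by (auto simp: T_def)
    qed
  qed (use Suc(3) Pc in \<open>auto simp: T_def N.smult_l_distr N.smult_r_distr\<close>)
  then have T: "ideal T R" by (rule submodule_regular_ideal[OF assms(1)])
  have "s \<in> T" if s: "s \<in> S" for s
  proof -
    have sc: "s \<in> carrier R" using s assms(4) by auto
    have "w \<odot>\<^bsub>N\<^esub> (s \<odot>\<^bsub>N\<^esub> u) = \<zero>\<^bsub>N\<^esub>" if w: "w \<in> ?P" for w
    proof (cases "k s")
      case 0
      with Suc(4)[OF s] Suc(3) have "u = \<zero>\<^bsub>N\<^esub>" by simp
      then show ?thesis using sc Pc[OF w] by simp
    next
      case (Suc l)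
      \<comment> \<open>Passing from \<open>u\<close> to s u lowers the exponent of \<open>s\<close>
        by one and leaves the others valid.\<close>
      let ?k = "k(s := l)"
      have "sum k S = k s + sum k (S - {s})" "sum ?k S = ?k s + sum ?k (S - {s})"
        using s assms(3) by (simp_all only: sum.remove)
      moreover have "sum ?k (S - {s}) = sum k (S - {s})" by (rule sum.cong) auto
      ultimately have m: "m = sum ?k S" using \<open>Suc m = sum k S\<close> Suc by simp
      show ?thesis
      proof (rule Suc.hyps(1)[OF m])
        show "s \<odot>\<^bsub>N\<^esub> u \<in> carrier N" using sc Suc.prems(1) by simp
        show "(s' [^]\<^bsub>R\<^esub> ?k s') \<odot>\<^bsub>N\<^esub> (s \<odot>\<^bsub>N\<^esub> u) = \<zero>\<^bsub>N\<^esub>" if s': "s' \<in> S" for s'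
        proof (cases "s' = s")
          case True
          have "(s [^]\<^bsub>R\<^esub> l) \<odot>\<^bsub>N\<^esub> (s \<odot>\<^bsub>N\<^esub> u) = (s [^]\<^bsub>R\<^esub> k s) \<odot>\<^bsub>N\<^esub> u"
            using sc Suc.prems(1) by (simp add: Suc N.smult_assoc1)
          then show ?thesis using Suc.prems(2)[OF s] True by simp
        next
          case False
          have c': "s' \<in> carrier R" using s' assms(4) by auto
          have "(s' [^]\<^bsub>R\<^esub> k s') \<odot>\<^bsub>N\<^esub> (s \<odot>\<^bsub>N\<^esub> u) = s \<odot>\<^bsub>N\<^esub> ((s' [^]\<^bsub>R\<^esub> k s') \<odot>\<^bsub>N\<^esub> u)"
            using sc c' Suc.prems(1) by (simp add: N.smult_assoc1[symmetric] N.m_comm)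
          then show ?thesis using Suc.prems(2)[OF s'] False sc by simp
        qed
        show "w \<in> \<aa> [^]\<^bsub>ideals_set R\<^esub> Suc (sum ?k S)" using w m by simp
      qed
    qed
    then show ?thesis using sc by (simp add: T_def)
  qed
  then have aT: "\<aa> \<subseteq> T" unfolding \<aa>_def by (intro N.genideal_minimal[OF T]) auto
  have "r \<in> ideal_prod R ?P \<aa>" using Suc(5) unfolding pw(2)[of "sum k S"] Suc(2) .
  then have "r \<in> carrier R \<and> r \<odot>\<^bsub>N\<^esub> u = \<zero>\<^bsub>N\<^esub>"
  proof (induction r rule: ideal_prod.induct)
    case (prod i j)
    then have "j \<in> T" "i \<in> carrier R" using aT Pc by auto
    then show ?case using prod Suc.prems(1) by (auto simp: T_def N.smult_assoc1)
  next
    case (sum s1 s2)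
    then show ?case using Suc.prems(1) by (simp add: N.smult_l_distr)
  qed
  then show ?case ..
qed

text \<open>Powers of generators lie in powers of the ideal, which gives one inclusion. Conversely,
  finitely many exponents, one for each generator, combine by
  \<open>ideal_pow_kills\<close>.\<close>

lemma torsion_part_eq:
  assumes "cring R" "module R N" "finite S" "S \<subseteq> carrier R"
  shows "torsion_part R (Idl\<^bsub>R\<^esub> S) N = N\<lparr>carrier := power_torsion R S N\<rparr>"
proof -
  interpret N: module R N by fact
  have a: "ideal (Idl\<^bsub>R\<^esub> S) R" by (rule N.genideal_ideal[OF assms(4)])
  have "{x \<in> carrier N. \<exists>n::nat. \<forall>r \<in> (Idl\<^bsub>R\<^esub> S) [^]\<^bsub>ideals_set R\<^esub> n. r \<odot>\<^bsub>N\<^esub> x = \<zero>\<^bsub>N\<^esub>} = power_torsion R S N"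
  proof (intro equalityI subsetI)
    fix u assume "u \<in> {x \<in> carrier N. \<exists>n::nat. \<forall>r \<in> (Idl\<^bsub>R\<^esub> S) [^]\<^bsub>ideals_set R\<^esub> n. r \<odot>\<^bsub>N\<^esub> x = \<zero>\<^bsub>N\<^esub>}"
    then show "u \<in> power_torsion R S N"
      using element_pow_in_ideal_pow[OF assms(1) a] N.genideal_self[OF assms(4)]
      unfolding power_torsion_def by blast
  next
    fix u assume u: "u \<in> power_torsion R S N"
    then have "\<exists>k. \<forall>s\<in>S. (s [^]\<^bsub>R\<^esub> (k s :: nat)) \<odot>\<^bsub>N\<^esub> u = \<zero>\<^bsub>N\<^esub>"
      unfolding power_torsion_def by (intro bchoice) auto
    then obtain k where k: "\<And>s. s \<in> S \<Longrightarrow> (s [^]\<^bsub>R\<^esub> (k s :: nat)) \<odot>\<^bsub>N\<^esub> u = \<zero>\<^bsub>N\<^esub>" by auto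
    have uc: "u \<in> carrier N" using u by (simp add: power_torsion_def)
    from ideal_pow_kills[OF assms uc k] uc
    show "u \<in> {x \<in> carrier N. \<exists>n::nat. \<forall>r \<in> (Idl\<^bsub>R\<^esub> S) [^]\<^bsub>ideals_set R\<^esub> n. r \<odot>\<^bsub>N\<^esub> x = \<zero>\<^bsub>N\<^esub>}" by blast
  qed
  then show ?thesis by (simp add: torsion_part_def)
qed

section \<open>Artinian modules\<close>

lemma fg_mod_submodule:
  assumes "cring R" "noetherian_ring R" "module R N" "submodule K R N" "submodule W R N"
    and "fg_mod R N W {\<zero>\<^bsub>N\<^esub>}" "V \<subseteq> W" "V \<subseteq> K" "submodule V R N"
  shows "fg_mod R (N\<lparr>carrier := K\<rparr>) V {\<zero>\<^bsub>N\<^esub>}"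
proof -
  have "fg_mod R N V {\<zero>\<^bsub>N\<^esub>}"
    by (rule fg_mod_mono[OF assms(1-3) assms(5,9) submodule_zero[OF assms(3)] submodule_zero[OF assms(3)] assms(6,7)]) simp
  then show ?thesis using fg_mod_carrier_update[OF assms(8) submoduleD(1)[OF assms(3,4)]] by blast
qed

lemma ann_part_submodule:
  assumes "module R N" "S \<subseteq> carrier R"
  shows "submodule (ann_part S N) R N"
proof -
  interpret N: module R N by fact
  have "a \<odot>\<^bsub>N\<^esub> x \<in> ann_part S N" if a: "a \<in> carrier R" "x \<in> ann_part S N" for a x
  proof -
    have "r \<odot>\<^bsub>N\<^esub> (a \<odot>\<^bsub>N\<^esub> x) = a \<odot>\<^bsub>N\<^esub> (r \<odot>\<^bsub>N\<^esub> x)" if "r \<in> S" for r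
    proof -
      have "r \<in> carrier R" "x \<in> carrier N" using that a assms(2) by (auto simp: ann_part_def)
      then show ?thesis using a(1) by (simp add: N.smult_assoc1[symmetric] N.m_comm)
    qed
    then show ?thesis using a by (auto simp: ann_part_def)
  qed
  moreover have "a \<oplus>\<^bsub>N\<^esub> b \<in> ann_part S N" if "a \<in> ann_part S N" "b \<in> ann_part S N" for a b
    using that assms(2) by (auto simp: ann_part_def N.smult_r_distr subset_iff)
  moreover have "\<zero>\<^bsub>N\<^esub> \<in> ann_part S N" using assms(2) by (auto simp: ann_part_def)
  ultimately show ?thesis by (intro submoduleI'[OF assms(1)]) (auto simp: ann_part_def)
qed

lemma ann_part_genideal:
  assumes "module R N" "S \<subseteq> carrier R"
  shows "ann_part (Idl\<^bsub>R\<^esub> S) N = ann_part S N"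
proof (intro equalityI subsetI)
  interpret N: module R N by fact
  fix u assume u: "u \<in> ann_part S N"
  then have uc: "u \<in> carrier N" by (simp add: ann_part_def)
  have "(\<lambda>r. r \<odot>\<^bsub>N\<^esub> u) \<in> module_hom R (regular_module R) N"
    using uc by (auto simp: module_hom_def N.smult_l_distr N.smult_assoc1)
  from submodule_kernel[OF module_regular assms(1) this]
  have "ideal {r \<in> carrier R. r \<odot>\<^bsub>N\<^esub> u = \<zero>\<^bsub>N\<^esub>} R"
    using submodule_regular_ideal N.R.is_cring by simp
  from N.genideal_minimal[OF this, of S] show "u \<in> ann_part (Idl\<^bsub>R\<^esub> S) N"
    using u assms(2) by (auto simp: ann_part_def)
next
  interpret N: module R N by fact
  fix u assume "u \<in> ann_part (Idl\<^bsub>R\<^esub> S) N"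
  then show "u \<in> ann_part S N" using N.genideal_self[OF assms(2)] by (auto simp: ann_part_def)
qed

text \<open>For a new generator \<open>s\<close>, the induction hypothesis handles the kernel of
  \<open>s\<close>. Multiplication by \<open>s\<close> maps the kernel of s^(k+1) to that of s^k
  with kernel (0 :_N s), so all these kernels are finitely generated, and one of them is N.\<close>

lemma fg_mod_of_nilpotent:
  assumes R: "cring R" "noetherian_ring R"
    and "finite S" "S \<subseteq> carrier R" "module R N"
    and "\<And>s. s \<in> S \<Longrightarrow> \<exists>k::nat. \<forall>u\<in>carrier N. (s [^]\<^bsub>R\<^esub> k) \<odot>\<^bsub>N\<^esub> u = \<zero>\<^bsub>N\<^esub>"
    and "fg_mod R N (ann_part S N) {\<zero>\<^bsub>N\<^esub>}"
  shows "fg_mod R N (carrier N) {\<zero>\<^bsub>N\<^esub>}"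
  using assms(3-7)
proof (induction S arbitrary: N)
  case empty
  then show ?case by (simp add: ann_part_def)
next
  case (insert s S)
  interpret N: module R N by fact
  note N = insert.prems(2)
  have s: "s \<in> carrier R" "S \<subseteq> carrier R" using insert.prems by auto
  define K where "K k = {u \<in> carrier N. (s [^]\<^bsub>R\<^esub> (k::nat)) \<odot>\<^bsub>N\<^esub> u = \<zero>\<^bsub>N\<^esub>}" for k
  have sK: "submodule (K k) R N" for k
    unfolding K_def by (rule submodule_kernel[OF N N module_hom_smult[OF N]]) (use s in simp)
  let ?N = "N\<lparr>carrier := K (Suc 0)\<rparr>"
  have K1: "K (Suc 0) = {u \<in> carrier N. s \<odot>\<^bsub>N\<^esub> u = \<zero>\<^bsub>N\<^esub>}" using s by (simp add: K_def)
  have eq: "ann_part S ?N = ann_part (insert s S) N" by (auto simp: ann_part_def K1)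
  have "fg_mod R ?N (carrier ?N) {\<zero>\<^bsub>?N\<^esub>}"
  proof (rule insert.IH[OF s(2) submodule_module[OF N sK]])
    show "\<exists>k::nat. \<forall>u\<in>carrier ?N. (s' [^]\<^bsub>R\<^esub> k) \<odot>\<^bsub>?N\<^esub> u = \<zero>\<^bsub>?N\<^esub>" if s': "s' \<in> S" for s'
    proof -
      from insert.prems(3)[of s'] s' obtain k :: nat where
        "\<forall>u\<in>carrier N. (s' [^]\<^bsub>R\<^esub> k) \<odot>\<^bsub>N\<^esub> u = \<zero>\<^bsub>N\<^esub>" by auto
      then show ?thesis by (auto simp: K_def)
    qed
    have "fg_mod R ?N (ann_part S ?N) {\<zero>\<^bsub>N\<^esub>}" unfolding eq
      by (rule fg_mod_submodule[OF R N sK ann_part_submodule[OF N insert.prems(1)] insert.prems(4) subset_refl _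
            ann_part_submodule[OF N insert.prems(1)]]) (auto simp: ann_part_def K1)
    then show "fg_mod R ?N (ann_part S ?N) {\<zero>\<^bsub>?N\<^esub>}" by simp
  qed
  then have fg1: "fg_mod R N (K (Suc 0)) {\<zero>\<^bsub>N\<^esub>}"
    using fg_mod_carrier_update[OF subset_refl submoduleD(1)[OF N sK], where R=R] by simp
  have z: "submodule {\<zero>\<^bsub>N\<^esub>} R N" by (rule submodule_zero[OF N])
  have fgk: "fg_mod R N (K k) {\<zero>\<^bsub>N\<^esub>}" for k
  proof (induction k)
    case 0
    have "K 0 = {\<zero>\<^bsub>N\<^esub>}" by (auto simp: K_def)
    then show ?case using fg_mod_zero[OF N] by simp
  next
    case (Suc k)
    show ?case
    proof (rule fg_mod_rel[OF R N N sK z sK z fg1 Suc.IH _ linear_rel_graph[OF N module_hom_smult[OF N s(1)]]])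
      show "K (Suc 0) \<subseteq> K (Suc k)" using power_kill_mono[OF N s(1), of _ "Suc 0" "Suc k"] by (auto simp: K_def)
      show "\<exists>z'\<in>K k. z \<in> carrier N \<and> z' = s \<odot>\<^bsub>N\<^esub> z" if "z \<in> K (Suc k)" for z
        using that s(1) by (auto simp: K_def N.smult_assoc1)
      show "\<exists>y\<in>K (Suc 0). \<exists>b\<in>{\<zero>\<^bsub>N\<^esub>}. z = y \<oplus>\<^bsub>N\<^esub> b"
        if "z \<in> K (Suc k)" "z \<in> carrier N \<and> b' = s \<odot>\<^bsub>N\<^esub> z" "b' \<in> {\<zero>\<^bsub>N\<^esub>}" for z b'
        using that by (auto simp: K1 intro!: bexI[of _ z])
    qed
  qed
  from insert.prems(3)[of s] obtain k :: nat where "\<forall>u\<in>carrier N. (s [^]\<^bsub>R\<^esub> k) \<odot>\<^bsub>N\<^esub> u = \<zero>\<^bsub>N\<^esub>" by auto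
  then have "K k = carrier N" by (auto simp: K_def)
  with fgk[of k] show ?case by simp
qed

lemma artinian_submodule:
  assumes "artinian_module R N" "submodule K R N"
  shows "artinian_module R (N\<lparr>carrier := K\<rparr>)"
  unfolding artinian_module_def
proof (intro conjI allI impI)
  have N: "module R N" using assms(1) by (simp add: artinian_module_def)
  show m: "module R (N\<lparr>carrier := K\<rparr>)" by (rule submodule_module[OF N assms(2)])
  fix H :: "nat \<Rightarrow> _" assume H: "\<forall>n. submodule (H n) R (N\<lparr>carrier := K\<rparr>) \<and> H (Suc n) \<subseteq> H n"
  then have "submodule (H n) R N" for n
  proof -
    have s: "submodule (H n) R (N\<lparr>carrier := K\<rparr>)" using H by blast
    show ?thesis using submodule_carrier_update[OF N assms(2)] submoduleD(1)[OF m s] s by simp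
  qed
  with H assms(1) show "\<exists>n. \<forall>m\<ge>n. H m = H n" unfolding artinian_module_def by blast
qed

context ext_context
begin

text \<open>
  Induction on the set \<open>T\<close> of generators not yet known to act nilpotently. For \<open>x\<close> in \<open>T\<close> choose
  \<open>k > 0\<close> with $x^k N = x^{2k} N =: B$, put $y = x^k$ and let \<open>K\<close> be the kernel of \<open>y\<close>. On \<open>K\<close>
  and \<open>K \<inter> B\<close> the element \<open>x\<close> is nilpotent; $N = K + B$ gives $N / B = K / (K \cap B)$; and \<open>B\<close> is
  handled by $0 \to K \cap B \to B \to B \to 0$, because \<open>y\<close> annihilates $\mathrm{Ext}(R/\mathfrak a, B)$.
\<close>

lemma ext_fg_artinian:
  assumes S: "finite S" "S \<subseteq> carrier R" "\<aa> = Idl\<^bsub>R\<^esub> S"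
    and "finite T" "T \<subseteq> S" "artinian_module R N"
    and "\<And>s. s \<in> S - T \<Longrightarrow> \<exists>k::nat. \<forall>u\<in>carrier N. (s [^]\<^bsub>R\<^esub> k) \<odot>\<^bsub>N\<^esub> u = \<zero>\<^bsub>N\<^esub>"
    and "fg_mod R N (ann_part \<aa> N) {\<zero>\<^bsub>N\<^esub>}"
  shows "ext_fg j N"
  using assms(4-8)
proof (induction T arbitrary: N j)
  case empty
  have N: "module R N" using empty.prems(2) by (simp add: artinian_module_def)
  have "fg_mod R N (carrier N) {\<zero>\<^bsub>N\<^esub>}"
    by (rule fg_mod_of_nilpotent[OF R S(1,2) N])
      (use empty.prems ann_part_genideal[OF N S(2)] S(3) in auto)
  then show ?case by (rule ext_fg_fg_module[OF N])
next
  case (insert x T)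
  have N: "module R N" using insert.prems(2) by (simp add: artinian_module_def)
  interpret N: module R N by (rule N)
  interpret a: ideal \<aa> R by (rule ideal)
  have aR: "\<aa> \<subseteq> carrier R" by (rule a.a_subset)
  have x: "x \<in> carrier R" "x \<in> \<aa>" using insert.prems(1) S N.genideal_self[OF S(2)] by auto
  have xk: "x [^]\<^bsub>R\<^esub> (k::nat) \<in> carrier R" for k using x by simp
  have xx: "(x [^]\<^bsub>R\<^esub> (k + l :: nat)) \<odot>\<^bsub>N\<^esub> u = (x [^]\<^bsub>R\<^esub> k) \<odot>\<^bsub>N\<^esub> ((x [^]\<^bsub>R\<^esub> l) \<odot>\<^bsub>N\<^esub> u)"
    if "u \<in> carrier N" for k l u
    using that x by (simp add: N.nat_pow_mult[symmetric] N.smult_assoc1)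
  define H where "H k = (\<lambda>u. (x [^]\<^bsub>R\<^esub> (k::nat)) \<odot>\<^bsub>N\<^esub> u) ` carrier N" for k
  have sH: "submodule (H k) R N" for k unfolding H_def
    by (rule submodule_image[OF N N module_hom_smult[OF N xk]])
  have dec: "H (Suc k) \<subseteq> H k" for k unfolding H_def using xx[of _ k 1] x by auto
  from sH dec insert.prems(2) obtain k0 where k0: "\<And>m. m \<ge> k0 \<Longrightarrow> H m = H k0"
    unfolding artinian_module_def by meson
  \<comment> \<open>The successor makes the exponent positive, so that x^k belongs to the
    ideal.\<close>
  define k where "k = Suc k0"
  define y where "y = x [^]\<^bsub>R\<^esub> k"
  have y: "y \<in> carrier R" "y \<in> \<aa>" using x a.I_l_closed[OF x(2) xk[of k0]] by (simp_all add: y_def k_def)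
  have Hk: "H (k + k) = H k" using k0[of k] k0[of "k + k"] by (simp add: k_def)
  \<comment> \<open>This is N = K + B in usable form: u - y w is killed by \<open>y\<close>, and y w
    lies in B.\<close>
  have yy: "\<exists>w\<in>carrier N. y \<odot>\<^bsub>N\<^esub> u = y \<odot>\<^bsub>N\<^esub> (y \<odot>\<^bsub>N\<^esub> w)" if u: "u \<in> carrier N" for u
  proof -
    have "y \<odot>\<^bsub>N\<^esub> u \<in> H (k + k)" unfolding Hk using u by (auto simp: H_def y_def)
    then obtain w where w: "w \<in> carrier N" "y \<odot>\<^bsub>N\<^esub> u = (x [^]\<^bsub>R\<^esub> (k + k)) \<odot>\<^bsub>N\<^esub> w" unfolding H_def by blast
    then show ?thesis using xx[OF w(1), of k k] by (auto simp: y_def)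
  qed
  let ?B = "H k"
  define K where "K = {u \<in> carrier N. y \<odot>\<^bsub>N\<^esub> u = \<zero>\<^bsub>N\<^esub>}"
  have sK: "submodule K R N" unfolding K_def by (rule submodule_kernel[OF N N module_hom_smult[OF N y(1)]])
  have sKB: "submodule (K \<inter> ?B) R N" by (rule submodule_Int[OF N sK sH])
  let ?NB = "N\<lparr>carrier := ?B\<rparr>" and ?NK = "N\<lparr>carrier := K\<rparr>" and ?NKB = "N\<lparr>carrier := K \<inter> ?B\<rparr>"
  have mB: "module R ?NB" and mK: "module R ?NK" by (rule submodule_module[OF N] sH sK)+
  \<comment> \<open>Inside K the element \<open>x\<close> is nilpotent as well, so the induction
    hypothesis with one generator fewer covers every submodule of K.\<close>
  have sub: "ext_fg i (N\<lparr>carrier := W\<rparr>)" if W: "submodule W R N" "W \<subseteq> K" for W i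
  proof (rule insert.IH)
    show "T \<subseteq> S" using insert.prems(1) by auto
    show "artinian_module R (N\<lparr>carrier := W\<rparr>)" by (rule artinian_submodule[OF insert.prems(2) W(1)])
    show "\<exists>l::nat. \<forall>u\<in>carrier (N\<lparr>carrier := W\<rparr>). (s [^]\<^bsub>R\<^esub> l) \<odot>\<^bsub>N\<lparr>carrier := W\<rparr>\<^esub> u = \<zero>\<^bsub>N\<lparr>carrier := W\<rparr>\<^esub>"
      if s: "s \<in> S - T" for s
    proof (cases "s = x")
      case True
      then show ?thesis using W(2) by (intro exI[of _ k]) (auto simp: K_def y_def)
    next
      case False
      then obtain l :: nat where "\<forall>u\<in>carrier N. (s [^]\<^bsub>R\<^esub> l) \<odot>\<^bsub>N\<^esub> u = \<zero>\<^bsub>N\<^esub>" using insert.prems(3)[of s] s by auto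
      then show ?thesis using submoduleD(1)[OF N W(1)] by (intro exI[of _ l]) auto
    qed
    have eq: "ann_part \<aa> (N\<lparr>carrier := W\<rparr>) = W \<inter> ann_part \<aa> N"
      using submoduleD(1)[OF N W(1)] by (auto simp: ann_part_def)
    have "fg_mod R (N\<lparr>carrier := W\<rparr>) (W \<inter> ann_part \<aa> N) {\<zero>\<^bsub>N\<^esub>}"
      by (rule fg_mod_submodule[OF R N W(1) ann_part_submodule[OF N aR] insert.prems(4) _ _
            submodule_Int[OF N W(1) ann_part_submodule[OF N aR]]]) auto
    then show "fg_mod R (N\<lparr>carrier := W\<rparr>) (ann_part \<aa> (N\<lparr>carrier := W\<rparr>)) {\<zero>\<^bsub>N\<lparr>carrier := W\<rparr>\<^esub>}"
      unfolding eq by simp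
  qed
  have fB: "ext_fg i ?NB" for i
  proof (rule ext_fg_extension[OF mB mB, where p="\<lambda>u. y \<odot>\<^bsub>N\<^esub> u"])
    show "(\<lambda>u. y \<odot>\<^bsub>N\<^esub> u) \<in> module_hom R ?NB ?NB" using module_hom_smult[OF mB y(1)] by simp
    show "(\<lambda>u. y \<odot>\<^bsub>N\<^esub> u) ` carrier ?NB = carrier ?NB"
    proof -
      have "b \<in> (\<lambda>u. y \<odot>\<^bsub>N\<^esub> u) ` ?B" if "b \<in> ?B" for b
      proof -
        from that obtain u where u: "u \<in> carrier N" "b = y \<odot>\<^bsub>N\<^esub> u" by (auto simp: H_def y_def)
        with yy[OF u(1)] obtain w where "w \<in> carrier N" "b = y \<odot>\<^bsub>N\<^esub> (y \<odot>\<^bsub>N\<^esub> w)" by auto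
        then show ?thesis by (auto simp: H_def y_def)
      qed
      then show ?thesis using submoduleD(4)[OF N sH y(1)] by auto
    qed
    have "{u \<in> carrier ?NB. y \<odot>\<^bsub>N\<^esub> u = \<zero>\<^bsub>?NB\<^esub>} = K \<inter> ?B"
      using submoduleD(1)[OF N sH] by (auto simp: K_def)
    then show "ext_fg i (?NB\<lparr>carrier := {u \<in> carrier ?NB. y \<odot>\<^bsub>N\<^esub> u = \<zero>\<^bsub>?NB\<^esub>}\<rparr>)"
      using sub[OF sKB] by simp
    \<comment> \<open>\<open>T\<close> is the set of coboundaries: multiplication by
      \<open>y\<close> induces zero on Ext of B, so the kernel term alone bounds Ext of B.\<close>
    show "fg_mod R (Hom_module R (F i) ?NB) (ext_B i ?NB) (ext_B i ?NB)"
      by (rule fg_mod_self[OF mH[OF mB] ext_B_submodule[OF mB]])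
    show "(\<lambda>u\<in>carrier (F i). y \<odot>\<^bsub>N\<^esub> f u) \<in> ext_B i ?NB" if "f \<in> ext_Z i ?NB" for f
      using smult_ext_Z[OF mB y(2) that] by simp
  qed
  let ?P = "quotient_module R N ?B" and ?p = "\<lambda>u. ?B +>\<^bsub>N\<^esub> u"
  have mP: "module R ?P" by (rule module_quotient[OF N sH])
  note p = coset_hom[OF N sH[of k]]
  have fP: "ext_fg i ?P" for i
  proof (rule ext_fg_right[OF mK mP, where p="?p"])
    show pK: "?p \<in> module_hom R ?NK ?P"
      by (rule module_hom_subset[OF p(1) submoduleD(1)[OF N sK]])
    show "?p ` carrier ?NK = carrier ?P"
    proof (intro equalityI subsetI)
      fix q assume "q \<in> carrier ?P"
      then obtain u where u: "u \<in> carrier N" "q = ?p u" using p(2) by auto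
      from yy[OF u(1)] obtain w where w: "w \<in> carrier N" "y \<odot>\<^bsub>N\<^esub> u = y \<odot>\<^bsub>N\<^esub> (y \<odot>\<^bsub>N\<^esub> w)" by auto
      have wB: "y \<odot>\<^bsub>N\<^esub> w \<in> ?B" using w by (auto simp: H_def y_def)
      let ?v = "u \<ominus>\<^bsub>N\<^esub> y \<odot>\<^bsub>N\<^esub> w"
      have vc: "?v \<in> carrier N" using u w y by simp
      have "y \<odot>\<^bsub>N\<^esub> ?v = y \<odot>\<^bsub>N\<^esub> u \<ominus>\<^bsub>N\<^esub> y \<odot>\<^bsub>N\<^esub> (y \<odot>\<^bsub>N\<^esub> w)"
        by (rule module_hom_diff[OF N N module_hom_smult[OF N y(1)]]) (use u w y in auto)
      then have "?v \<in> K" using w y vc by (simp add: K_def a_minus_def N.r_neg)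
      moreover have "?v \<ominus>\<^bsub>N\<^esub> u = \<ominus>\<^bsub>N\<^esub> (y \<odot>\<^bsub>N\<^esub> w)" using u w y by (simp add: a_minus_def N.a_ac N.r_neg1 N.r_neg2 N.l_neg N.r_neg)
      then have "?p ?v = q"
        using coset_eq_iff[OF N sH vc u(1)] submoduleD(5)[OF N sH wB] u(2) by simp
      ultimately show "q \<in> ?p ` carrier ?NK" by auto
    qed (use module_homD(1)[OF pK] in auto)
    have "{u \<in> carrier ?NK. ?p u = \<zero>\<^bsub>?P\<^esub>} = K \<inter> ?B"
      using p(3) submoduleD(1)[OF N sK] by auto
    then show "ext_fg (Suc i) (?NK\<lparr>carrier := {u \<in> carrier ?NK. ?p u = \<zero>\<^bsub>?P\<^esub>}\<rparr>)"
      using sub[OF sKB] by simp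
    show "ext_fg i ?NK" by (rule sub[OF sK subset_refl])
  qed
  show ?case
  proof (rule ext_fg_middle[OF N mP p(1,2)])
    have "{u \<in> carrier N. ?p u = \<zero>\<^bsub>?P\<^esub>} = ?B" using p(3) submoduleD(1)[OF N sH] by auto
    then show "ext_fg j (N\<lparr>carrier := {u \<in> carrier N. ?p u = \<zero>\<^bsub>?P\<^esub>}\<rparr>)" using fB by simp
  qed (rule fP)
qed

end

text \<open>If some \<open>r\<close> in the ideal lies outside the prime, its powers are admissible
  denominators and kill every element, so the localization is zero.\<close>

lemma Supp_torsion:
  assumes "module R N" "\<And>r u. r \<in> \<aa> \<Longrightarrow> u \<in> carrier N \<Longrightarrow> \<exists>k::nat. (r [^]\<^bsub>R\<^esub> k) \<odot>\<^bsub>N\<^esub> u = \<zero>\<^bsub>N\<^esub>"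
    and "\<aa> \<subseteq> carrier R"
  shows "Supp R N \<subseteq> zero_locus R \<aa>"
proof
  interpret N: module R N by fact
  fix \<pp> assume p: "\<pp> \<in> Supp R N"
  then have P: "primeideal \<pp> R" by (simp add: Supp_def Spec_def)
  interpret p: primeideal \<pp> R by (rule P)
  let ?S = "carrier R - \<pp>"
  have "\<aa> \<subseteq> \<pp>"
  proof
    fix r assume r: "r \<in> \<aa>"
    show "r \<in> \<pp>"
    proof (rule ccontr)
      assume rp: "r \<notin> \<pp>"
      have rc: "r \<in> carrier R" using r assms(3) by auto
      have one: "\<one>\<^bsub>R\<^esub> \<in> ?S" using p.I_notcarr p.one_imp_carrier by auto
      have pow: "r [^]\<^bsub>R\<^esub> (k::nat) \<in> ?S" for k
      proof (induction k)
        case (Suc k) then show ?case using rc rp p.I_prime[of "r [^]\<^bsub>R\<^esub> k" r] by auto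
      qed (use one in simp)
      have mult: "a \<otimes>\<^bsub>R\<^esub> b \<in> ?S" if "a \<in> ?S" "b \<in> ?S" for a b using that p.I_prime by auto
      \<comment> \<open>Every fraction is the same class, namely all pairs: a common power of
        \<open>r\<close> annihilates both numerators.\<close>
      have frac: "module_frac R ?S N x s = carrier N \<times> ?S" if x: "x \<in> carrier N" and s: "s \<in> ?S" for x s
      proof (intro equalityI subsetI)
        fix q assume "q \<in> carrier N \<times> ?S"
        then obtain y t where q: "q = (y, t)" "y \<in> carrier N" "t \<in> ?S" by auto
        from assms(2)[OF r x] assms(2)[OF r q(2)] obtain k l :: nat where
          "(r [^]\<^bsub>R\<^esub> k) \<odot>\<^bsub>N\<^esub> x = \<zero>\<^bsub>N\<^esub>" "(r [^]\<^bsub>R\<^esub> l) \<odot>\<^bsub>N\<^esub> y = \<zero>\<^bsub>N\<^esub>" by auto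
        then have k: "(r [^]\<^bsub>R\<^esub> max k l) \<odot>\<^bsub>N\<^esub> x = \<zero>\<^bsub>N\<^esub>" "(r [^]\<^bsub>R\<^esub> max k l) \<odot>\<^bsub>N\<^esub> y = \<zero>\<^bsub>N\<^esub>"
          using power_kill_mono[OF assms(1) rc] x q(2) by auto
        let ?u = "r [^]\<^bsub>R\<^esub> max k l"
        have uc: "?u \<in> carrier R" using rc by simp
        have comm: "?u \<odot>\<^bsub>N\<^esub> (b \<odot>\<^bsub>N\<^esub> z) = b \<odot>\<^bsub>N\<^esub> (?u \<odot>\<^bsub>N\<^esub> z)" if "b \<in> carrier R" "z \<in> carrier N" for b z
          using that uc N.m_comm by (simp add: N.smult_assoc1[symmetric])
        have "?u \<odot>\<^bsub>N\<^esub> (t \<odot>\<^bsub>N\<^esub> x) = ?u \<odot>\<^bsub>N\<^esub> (s \<odot>\<^bsub>N\<^esub> y)"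
          using comm[of t x] comm[of s y] k x q s by simp
        then show "q \<in> module_frac R ?S N x s" unfolding module_frac_def using q pow[of "max k l"] by blast
      qed (auto simp: module_frac_def)
      have "carrier (localized_module R ?S N) = {\<zero>\<^bsub>localized_module R ?S N\<^esub>}"
      proof -
        have 1: "\<zero>\<^bsub>localized_module R ?S N\<^esub> = carrier N \<times> ?S"
          using frac[OF N.zero_closed one] by (simp add: localized_module_def)
        have "carrier (localized_module R ?S N) = {module_frac R ?S N x s | x s. x \<in> carrier N \<and> s \<in> ?S}"
          by (simp add: localized_module_def)
        also have "\<dots> = {carrier N \<times> ?S}" using frac N.zero_closed one by blast
        finally show ?thesis using 1 by simp
      qed
      then show False using p by (simp add: Supp_def Let_def)
    qed
  qed
  then show "\<pp> \<in> zero_locus R \<aa>" using P by (simp add: zero_locus_def Spec_def)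
qed

section \<open>Local cohomology\<close>

text \<open>A finite generating set \<open>S\<close> of the ideal is fixed along with the
  resolution, so that torsion can be handled generator by generator.\<close>

locale local_cohomology_context = ext_context R \<aa> n \<delta> \<epsilon>
  for R :: "('a, 'r) ring_scheme" and \<aa> :: "'a set" and n :: "nat \<Rightarrow> nat"
    and \<delta> :: "nat \<Rightarrow> (nat \<Rightarrow> 'a) \<Rightarrow> nat \<Rightarrow> 'a" and \<epsilon> :: "(nat \<Rightarrow> 'a) \<Rightarrow> 'a set" +
  fixes S :: "'a set" and M :: "('a, 'b, 'm) module_scheme"
    and I :: "nat \<Rightarrow> ('a, 'c) module" and d :: "nat \<Rightarrow> 'c \<Rightarrow> 'c" and \<eta> :: "'b \<Rightarrow> 'c"
  assumes S: "finite S" "S \<subseteq> carrier R" "\<aa> = Idl\<^bsub>R\<^esub> S"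
    and M: "finitely_generated_module R M"
    and inj: "injective_resolution R M I d \<eta>"
begin

definition "\<Gamma> i = power_torsion R S (I i)"
text \<open>The cosyzygies of \<open>M\<close>: by exactness a copy of \<open>M\<close> in degree
  zero, and the image of the preceding differential in higher degrees.\<close>

definition "\<Omega> i = {x \<in> carrier (I i). d i x = \<zero>\<^bsub>I (Suc i)\<^esub>}"
definition "\<Gamma>Z i = {x \<in> \<Gamma> i. d i x = \<zero>\<^bsub>I (Suc i)\<^esub>}"
definition "\<Gamma>B i = (case i of 0 \<Rightarrow> {\<zero>\<^bsub>I 0\<^esub>} | Suc k \<Rightarrow> d k ` \<Gamma> k)"

abbreviation "sub i K \<equiv> (I i)\<lparr>carrier := K\<rparr>"
abbreviation "H i \<equiv> local_cohomology R \<aa> I d i"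

lemma mI: "module R (I i)"
  using inj by (simp add: injective_resolution_def injective_module_def)

lemma baerI: "baer_module R (I i)"
  using inj by (intro injective_imp_baer) (simp add: injective_resolution_def)

lemma d_hom: "d i \<in> module_hom R (I i) (I (Suc i))"
  using inj by (simp add: injective_resolution_def)

lemma torsion_part_I: "torsion_part R \<aa> (I i) = sub i (\<Gamma> i)"
  unfolding S(3) \<Gamma>_def by (rule torsion_part_eq[OF R(1) mI S(1,2)])

lemma \<Gamma>_submodule: "submodule (\<Gamma> i) R (I i)"
  unfolding \<Gamma>_def by (rule power_torsion_submodule[OF mI S(2)])

lemma \<Gamma>_carrier: "\<Gamma> i \<subseteq> carrier (I i)" by (rule submoduleD(1)[OF mI \<Gamma>_submodule])

lemma m\<Gamma>: "module R (sub i (\<Gamma> i))" by (rule submodule_module[OF mI \<Gamma>_submodule])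

lemma baer_\<Gamma>: "baer_module R (sub i (\<Gamma> i))"
  unfolding \<Gamma>_def by (rule baer_power_torsion[OF R mI baerI S(1,2)])

lemma d_\<Gamma>: assumes "x \<in> \<Gamma> i" shows "d i x \<in> \<Gamma> (Suc i)"
proof -
  interpret I': module R "I (Suc i)" by (rule mI)
  have x: "x \<in> carrier (I i)" using assms \<Gamma>_carrier by auto
  have "\<exists>k::nat. (s [^]\<^bsub>R\<^esub> k) \<odot>\<^bsub>I (Suc i)\<^esub> d i x = \<zero>\<^bsub>I (Suc i)\<^esub>" if s: "s \<in> S" for s
  proof -
    from assms s obtain k :: nat where "(s [^]\<^bsub>R\<^esub> k) \<odot>\<^bsub>I i\<^esub> x = \<zero>\<^bsub>I i\<^esub>" by (auto simp: \<Gamma>_def power_torsion_def)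
    then show ?thesis
      using module_homD(3)[OF d_hom _ x, of "s [^]\<^bsub>R\<^esub> k"] module_hom_zero[OF mI mI d_hom] s S(2) by (auto intro!: exI[of _ k])
  qed
  then show ?thesis using module_homD(1)[OF d_hom x] by (auto simp: \<Gamma>_def power_torsion_def)
qed

lemma d\<Gamma>_hom: "d i \<in> module_hom R (sub i (\<Gamma> i)) (I (Suc i))"
  by (rule module_hom_subset[OF d_hom \<Gamma>_carrier])

lemma \<Omega>_submodule: "submodule (\<Omega> i) R (I i)"
  unfolding \<Omega>_def by (rule submodule_kernel[OF mI mI d_hom])

lemma m\<Omega>: "module R (sub i (\<Omega> i))" by (rule submodule_module[OF mI \<Omega>_submodule])

lemma \<Omega>_0: "\<Omega> 0 = \<eta> ` carrier M"
  and \<Omega>_Suc: "\<Omega> (Suc i) = d i ` carrier (I i)"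
  using inj by (auto simp: injective_resolution_def a_kernel_def kernel_def \<Omega>_def)

lemma \<Gamma>Z_eq: "\<Gamma>Z i = \<Gamma> i \<inter> \<Omega> i"
  using \<Gamma>_carrier[of i] by (auto simp: \<Gamma>Z_def \<Omega>_def)

lemma \<Gamma>Z_submodule: "submodule (\<Gamma>Z i) R (I i)"
  unfolding \<Gamma>Z_eq by (rule submodule_Int[OF mI \<Gamma>_submodule \<Omega>_submodule])

lemma m\<Gamma>Z: "module R (sub i (\<Gamma>Z i))" by (rule submodule_module[OF mI \<Gamma>Z_submodule])

lemma \<Gamma>B_submodule: "submodule (\<Gamma>B i) R (I i)"
  using submodule_zero[OF mI] submodule_image_submodule[OF mI mI d_hom \<Gamma>_submodule]
  by (auto simp: \<Gamma>B_def split: nat.split)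

lemma m\<Gamma>B: "module R (sub i (\<Gamma>B i))" by (rule submodule_module[OF mI \<Gamma>B_submodule])

lemma \<Gamma>B_subset: "\<Gamma>B i \<subseteq> \<Gamma>Z i"
proof (cases i)
  case 0
  then show ?thesis using submoduleD(2)[OF mI \<Gamma>Z_submodule] by (simp add: \<Gamma>B_def)
next
  case (Suc k)
  have "d k x \<in> \<Omega> i" if "x \<in> \<Gamma> k" for x using that \<Gamma>_carrier \<Omega>_Suc Suc by blast
  then show ?thesis using d_\<Gamma>[of _ k] Suc by (auto simp: \<Gamma>B_def \<Gamma>Z_eq)
qed

lemma H_eq: "H i = quotient_module R (sub i (\<Gamma>Z i)) (\<Gamma>B i)"
proof -
  have "cocycles (\<lambda>k. torsion_part R \<aa> (I k)) d i = \<Gamma>Z i"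
    by (auto simp: cocycles_def torsion_part_I \<Gamma>Z_def)
  moreover have "coboundaries (\<lambda>k. torsion_part R \<aa> (I k)) d i = \<Gamma>B i"
    by (auto simp: coboundaries_def torsion_part_I \<Gamma>B_def split: nat.split)
  ultimately show ?thesis by (simp add: local_cohomology_def cohomology_def torsion_part_I)
qed

lemma B_submodule_Z: "submodule (\<Gamma>B i) R (sub i (\<Gamma>Z i))"
  using submodule_carrier_update[OF mI \<Gamma>Z_submodule \<Gamma>B_subset] \<Gamma>B_submodule by simp

definition "\<pi> i x = \<Gamma>B i +>\<^bsub>sub i (\<Gamma>Z i)\<^esub> x"

lemma mHc: "module R (H i)"
  unfolding H_eq by (rule module_quotient[OF m\<Gamma>Z B_submodule_Z])

lemma \<pi>_hom: "\<pi> i \<in> module_hom R (sub i (\<Gamma>Z i)) (H i)"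
  and \<pi>_surj: "\<pi> i ` \<Gamma>Z i = carrier (H i)"
  and \<pi>_zero: "x \<in> \<Gamma>Z i \<Longrightarrow> \<pi> i x = \<zero>\<^bsub>H i\<^esub> \<longleftrightarrow> x \<in> \<Gamma>B i"
  using coset_hom[OF m\<Gamma>Z[of i] B_submodule_Z[of i]] unfolding H_eq \<pi>_def by auto

lemma \<pi>_kernel: "{x \<in> carrier (sub i (\<Gamma>Z i)). \<pi> i x = \<zero>\<^bsub>H i\<^esub>} = \<Gamma>B i"
  using \<pi>_zero[of _ i] \<Gamma>B_subset[of i] by auto

section \<open>Dimension shifting and Ext of local cohomology\<close>

lemma fg_\<Omega>_0: "fg_mod R (I 0) (\<Omega> 0) {\<zero>\<^bsub>I 0\<^esub>}"
proof -
  have mM: "module R M" using M by (simp add: finitely_generated_module_def)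
  interpret M: module R M by (rule mM)
  have \<eta>: "\<eta> \<in> module_hom R M (I 0)" using inj by (simp add: injective_resolution_def)
  show ?thesis unfolding \<Omega>_0
    by (rule fg_mod_image[OF mM \<eta> fg_mod_module[OF R(1) M]]) (auto simp: module_hom_zero[OF mM mI \<eta>])
qed

text \<open>\<open>\<Omega> 0\<close> is the image of \<open>M\<close>, so its submodules are
  finitely generated. This starts the inductions on the cohomological degree.\<close>

lemma ext_fg_sub_\<Omega>_0:
  assumes "submodule K R (I 0)" "K \<subseteq> \<Omega> 0"
  shows "ext_fg j (sub 0 K)"
  by (rule ext_fg_fg_module[OF submodule_module[OF mI assms(1)]])
    (use fg_mod_submodule[OF R mI assms(1) \<Omega>_submodule fg_\<Omega>_0 assms(2) subset_refl assms(1)] in simp)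

text \<open>Shifting along 0 -> Omega^i -> I^i -> Omega^(i+1) -> 0 lowers the Ext degree by one. The
  statement is confined to positive degrees, where Ext of I^i vanishes.\<close>

lemma ext_fg_\<Omega>: "ext_fg (Suc j) (sub i (\<Omega> i))"
proof (induction i arbitrary: j)
  case 0
  show ?case by (rule ext_fg_sub_\<Omega>_0[OF \<Omega>_submodule subset_refl])
next
  case (Suc i)
  show ?case
  proof (rule ext_fg_right[OF mI m\<Omega>])
    show "d i \<in> module_hom R (I i) (sub (Suc i) (\<Omega> (Suc i)))"
      using d_hom by (auto simp: module_hom_def \<Omega>_Suc)
    show "d i ` carrier (I i) = carrier (sub (Suc i) (\<Omega> (Suc i)))" by (simp add: \<Omega>_Suc)
    show "ext_fg (Suc (Suc j)) (sub i {x \<in> carrier (I i). d i x = \<zero>\<^bsub>sub (Suc i) (\<Omega> (Suc i))\<^esub>})"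
      using Suc by (simp add: \<Omega>_def)
    show "ext_fg (Suc j) (I i)" by (rule ext_fg_baer[OF mI baerI])
  qed
qed

text \<open>Two sequences per step: 0 -> B^i -> Z^i -> H^i -> 0 yields Ext of Z^i from the induction
  hypothesis and the assumption on H^i; then 0 -> Z^i -> Gamma(I^i) -> B^(i+1) -> 0 shifts down,
  since Ext of Gamma(I^i) vanishes in positive degrees.\<close>

lemma ext_fg_\<Gamma>B:
  assumes "\<And>i j. i < t \<Longrightarrow> ext_fg j (H i)" "i \<le> t"
  shows "ext_fg (Suc j) (sub i (\<Gamma>B i))"
  using assms(2)
proof (induction i arbitrary: j)
  case 0
  have "\<Gamma>B 0 \<subseteq> \<Omega> 0" using \<Gamma>B_subset \<Gamma>Z_eq by blast
  then show ?case by (rule ext_fg_sub_\<Omega>_0[OF \<Gamma>B_submodule])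
next
  case (Suc i)
  have Z: "ext_fg (Suc (Suc j)) (sub i (\<Gamma>Z i))"
    by (rule ext_fg_middle[OF m\<Gamma>Z mHc \<pi>_hom])
      (use Suc assms(1) in \<open>simp_all add: \<pi>_surj \<pi>_kernel[simplified]\<close>)
  show ?case
  proof (rule ext_fg_right[OF m\<Gamma> m\<Gamma>B])
    show "d i \<in> module_hom R (sub i (\<Gamma> i)) (sub (Suc i) (\<Gamma>B (Suc i)))"
      using d\<Gamma>_hom[of i] by (auto simp: module_hom_def \<Gamma>B_def)
    show "d i ` carrier (sub i (\<Gamma> i)) = carrier (sub (Suc i) (\<Gamma>B (Suc i)))" by (simp add: \<Gamma>B_def)
    show "ext_fg (Suc (Suc j)) ((sub i (\<Gamma> i))\<lparr>carrier := {x \<in> carrier (sub i (\<Gamma> i)). d i x = \<zero>\<^bsub>sub (Suc i) (\<Gamma>B (Suc i))\<^esub>}\<rparr>)"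
      using Z by (simp add: \<Gamma>Z_def)
    show "ext_fg (Suc j) (sub i (\<Gamma> i))" by (rule ext_fg_baer[OF m\<Gamma> baer_\<Gamma>])
  qed
qed

lemma ann_part_subset_\<Gamma>: "ann_part \<aa> (I i) \<subseteq> \<Gamma> i"
proof
  interpret I: module R "I i" by (rule mI)
  fix u assume u: "u \<in> ann_part \<aa> (I i)"
  have "\<exists>k::nat. (s [^]\<^bsub>R\<^esub> k) \<odot>\<^bsub>I i\<^esub> u = \<zero>\<^bsub>I i\<^esub>" if "s \<in> S" for s
    using that u I.genideal_self[OF S(2)] S(2)
    by (intro exI[of _ 1]) (auto simp: ann_part_def S(3)[symmetric] subset_iff)
  then show "u \<in> \<Gamma> i" using u unfolding \<Gamma>_def power_torsion_def by (auto simp: ann_part_def)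
qed

text \<open>
  Elements of $H^{s+1}$ that lift to cocycles killed by the ideal are controlled by
  $\mathrm{Ext}^1(R/\mathfrak a, \Omega^s)$: a preimage under \<open>d s\<close> that is itself killed by the
  ideal lies in \<open>\<Gamma> s\<close>, so its image is a coboundary.
\<close>

lemma fg_mod_image_\<pi>:
  "fg_mod R (Hom_module R (F 0) (H t)) ((\<lambda>f. \<lambda>x\<in>carrier (F 0). \<pi> t (f x)) ` ext_Z 0 (sub t (\<Gamma>Z t))) (ext_B 0 (H t))"
proof (cases t)
  case 0
  \<comment> \<open>In degree zero the cocycles lie in the copy of \<open>M\<close>, so all of
    Hom(R/a, Z^0) is finitely generated.\<close>
  have "ext_fg 0 (sub 0 (\<Gamma>Z 0))" by (rule ext_fg_sub_\<Omega>_0[OF \<Gamma>Z_submodule]) (simp add: \<Gamma>Z_eq)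
  then have "fg_mod R (Hom_module R (F 0) (sub t (\<Gamma>Z t))) (ext_Z 0 (sub t (\<Gamma>Z t))) (ext_B 0 (sub t (\<Gamma>Z t)))"
    by (simp add: 0 ext_fg_def)
  then show ?thesis
    by (rule fg_mod_image[OF mH[OF m\<Gamma>Z] Hom_postcompose[OF mF m\<Gamma>Z \<pi>_hom] _ _
          submoduleD(1)[OF mH[OF m\<Gamma>Z] ext_Z_submodule[OF m\<Gamma>Z]]
          submoduleD(1)[OF mH[OF m\<Gamma>Z] ext_B_submodule[OF m\<Gamma>Z]]])
      (auto intro!: postcompose_B[OF m\<Gamma>Z mHc \<pi>_hom])
next
  case (Suc s)
  let ?T = "(\<lambda>f. \<lambda>x\<in>carrier (F 0). \<pi> t (f x)) ` ext_Z 0 (sub t (\<Gamma>Z t))"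
  let ?C = "Hom_module R (F 0) (H t)" and ?C' = "Hom_module R (F (Suc 0)) (sub s (\<Omega> s))"
  interpret C: module R ?C by (rule mH[OF mHc])
  interpret C': module R ?C' by (rule mH[OF m\<Omega>])
  interpret Ht: module R "H t" by (rule mHc)
  interpret Is: module R "I s" by (rule mI)
  have \<Omega>c: "\<Omega> s \<subseteq> carrier (I s)" by (auto simp: \<Omega>_def)
  have dh: "d s \<in> module_hom R (I s) (I t)" using d_hom[of s] Suc by simp
  note dc = module_homD(1)[OF delta_hom, of _ 0]
  \<comment> \<open>The connecting relation of 0 -> Omega^s -> I^s -> Omega^t -> 0, read off after
    projection to H^t: \<open>h\<close> lifts a torsion cocycle representing \<open>f\<close> along
    \<open>d s\<close>, and \<open>g\<close> is the coboundary of that lift.\<close>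
  define r where "r f g \<longleftrightarrow> f \<in> carrier ?C \<and> g \<in> carrier ?C' \<and>
    (\<exists>h\<in>module_hom R (F 0) (I s). (\<forall>x\<in>carrier (F 0). d s (h x) \<in> \<Gamma>Z t \<and> f x = \<pi> t (d s (h x))) \<and>
       (\<forall>x\<in>carrier (F (Suc 0)). h (\<delta> 0 x) = g x))" for f g
  have sT: "submodule ?T R ?C"
    by (rule submodule_image_submodule[OF mH[OF m\<Gamma>Z] mH[OF mHc] Hom_postcompose[OF mF m\<Gamma>Z \<pi>_hom] ext_Z_submodule[OF m\<Gamma>Z]])
  show ?thesis
  proof (rule fg_mod_rel[OF R mH[OF mHc] mH[OF m\<Omega>] sT ext_B_submodule[OF mHc] submodule_zero[OF mH[OF mHc]]
        ext_B_submodule[OF m\<Omega>] _ ext_fg_\<Omega>[unfolded ext_fg_def], where \<rho>=r])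
    show "fg_mod R ?C {\<zero>\<^bsub>?C\<^esub>} (ext_B 0 (H t))"
      by (rule fg_mod_zero[OF mH[OF mHc] submoduleD(2)[OF mH[OF mHc] ext_B_submodule[OF mHc]]])
    show "{\<zero>\<^bsub>?C\<^esub>} \<subseteq> ?T" using submoduleD(2)[OF mH[OF mHc] sT] by simp
    show "linear_rel R ?C ?C' r"
    proof (rule linear_relI)
      fix f g f' g' assume 1: "r f g" "r f' g'"
      then obtain h h' where h: "h\<in>module_hom R (F 0) (I s)" "\<And>x. x\<in>carrier (F 0) \<Longrightarrow> d s (h x) \<in> \<Gamma>Z t \<and> f x = \<pi> t (d s (h x))"
          "\<And>x. x\<in>carrier (F (Suc 0)) \<Longrightarrow> h (\<delta> 0 x) = g x"
        and h': "h'\<in>module_hom R (F 0) (I s)" "\<And>x. x\<in>carrier (F 0) \<Longrightarrow> d s (h' x) \<in> \<Gamma>Z t \<and> f' x = \<pi> t (d s (h' x))"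
          "\<And>x. x\<in>carrier (F (Suc 0)) \<Longrightarrow> h' (\<delta> 0 x) = g' x"
        by (auto simp: r_def)
      have "d s (h x \<oplus>\<^bsub>I s\<^esub> h' x) \<in> \<Gamma>Z t \<and> (f \<oplus>\<^bsub>?C\<^esub> f') x = \<pi> t (d s (h x \<oplus>\<^bsub>I s\<^esub> h' x))"
        if x: "x \<in> carrier (F 0)" for x
      proof -
        have "d s (h x \<oplus>\<^bsub>I s\<^esub> h' x) = d s (h x) \<oplus>\<^bsub>I t\<^esub> d s (h' x)"
          by (rule module_homD(2)[OF dh module_homD(1)[OF h(1) x] module_homD(1)[OF h'(1) x]])
        then show ?thesis
          using h(2)[OF x] h'(2)[OF x] x submoduleD(3)[OF mI \<Gamma>Z_submodule, of "d s (h x)" t "d s (h' x)"]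
            module_homD(2)[OF \<pi>_hom, of "d s (h x)" t "d s (h' x)"] by (simp add: Hom_apply)
      qed
      then show "r (f \<oplus>\<^bsub>?C\<^esub> f') (g \<oplus>\<^bsub>?C'\<^esub> g')"
        unfolding r_def using 1 h(3) h'(3)
        by (intro conjI bexI[OF _ module_hom_add[OF mF mI h(1) h'(1)]]) (auto simp: r_def Hom_apply)
    next
      fix a f g assume a: "a \<in> carrier R" and 1: "r f g"
      then obtain h where h: "h\<in>module_hom R (F 0) (I s)" "\<And>x. x\<in>carrier (F 0) \<Longrightarrow> d s (h x) \<in> \<Gamma>Z t \<and> f x = \<pi> t (d s (h x))"
          "\<And>x. x\<in>carrier (F (Suc 0)) \<Longrightarrow> h (\<delta> 0 x) = g x" by (auto simp: r_def)
      have "d s (a \<odot>\<^bsub>I s\<^esub> h x) \<in> \<Gamma>Z t \<and> (a \<odot>\<^bsub>?C\<^esub> f) x = \<pi> t (d s (a \<odot>\<^bsub>I s\<^esub> h x))"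
        if x: "x \<in> carrier (F 0)" for x
      proof -
        have "d s (a \<odot>\<^bsub>I s\<^esub> h x) = a \<odot>\<^bsub>I t\<^esub> d s (h x)"
          by (rule module_homD(3)[OF dh a module_homD(1)[OF h(1) x]])
        then show ?thesis
          using h(2)[OF x] x a submoduleD(4)[OF mI \<Gamma>Z_submodule, of a "d s (h x)" t]
            module_homD(3)[OF \<pi>_hom, of a "d s (h x)" t] by (simp add: Hom_apply)
      qed
      then show "r (a \<odot>\<^bsub>?C\<^esub> f) (a \<odot>\<^bsub>?C'\<^esub> g)"
        unfolding r_def using 1 a h(3)
        by (intro conjI bexI[OF _ module_hom_comp[OF h(1) module_hom_smult[OF mI a]]]) (auto simp: r_def Hom_apply)
    qed (simp add: r_def)
    show "\<exists>z'\<in>ext_Z (Suc 0) (sub s (\<Omega> s)). r z z'" if z: "z \<in> ?T" for z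
    proof -
      from z obtain f where f: "f \<in> ext_Z 0 (sub t (\<Gamma>Z t))" "z = (\<lambda>x\<in>carrier (F 0). \<pi> t (f x))" by auto
      have fZ: "\<And>x. x \<in> carrier (F 0) \<Longrightarrow> f x \<in> \<Gamma>Z t" and fm: "f \<in> module_hom R (F 0) (sub t (\<Gamma>Z t))"
        using f(1) by (auto simp: ext_Z_def Hom_carrier module_hom_def)
      have f\<Omega>: "f \<in> module_hom R (F 0) (sub t (\<Omega> t))"
        using fm by (auto simp: module_hom_def \<Gamma>Z_eq)
      have ds: "d s \<in> module_hom R (I s) (sub t (\<Omega> t))" using dh Suc by (auto simp: module_hom_def \<Omega>_Suc)
      have "d s ` carrier (I s) = carrier (sub t (\<Omega> t))" using Suc by (simp add: \<Omega>_Suc)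
      from free_lift_surj[OF mI m\<Omega> ds this f\<Omega>] obtain h where
        h: "h \<in> module_hom R (F 0) (I s)" "\<And>x. x \<in> carrier (F 0) \<Longrightarrow> d s (h x) = f x" by auto
      have f0: "f (\<delta> 0 x) = \<zero>\<^bsub>I t\<^esub>" if "x \<in> carrier (F (Suc 0))" for x
        using f(1) that by (auto simp: ext_Z_def)
      define g where "g = (\<lambda>x\<in>carrier (F (Suc 0)). h (\<delta> 0 x))"
      have "h (\<delta> 0 x) \<in> \<Omega> s" if x: "x \<in> carrier (F (Suc 0))" for x
        using h(2)[OF dc[OF x]] f0[OF x] module_homD(1)[OF h(1) dc[OF x]] Suc by (simp add: \<Omega>_def)
      moreover have "g \<in> carrier (Hom_module R (F (Suc 0)) (I s))" unfolding g_def
        by (rule Hom_restrict[OF mF module_hom_comp[OF delta_hom h(1)]])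
      ultimately have gc: "g \<in> carrier ?C'" by (auto simp: Hom_submodule_iff[OF \<Omega>c] g_def)
      then have "g \<in> ext_Z (Suc 0) (sub s (\<Omega> s))"
        using module_homD(1)[OF delta_hom] module_hom_zero[OF mF mI h(1)] by (auto simp: ext_Z_def g_def delta_delta)
      moreover have "r z g" unfolding r_def
        using gc h fZ f(2) submoduleD(1)[OF mH[OF mHc] sT] z by (auto simp: g_def intro!: bexI[of _ h])
      ultimately show ?thesis by blast
    qed
    show "\<exists>y\<in>{\<zero>\<^bsub>?C\<^esub>}. \<exists>b\<in>ext_B 0 (H t). z = y \<oplus>\<^bsub>?C\<^esub> b"
      if z: "z \<in> ?T" "r z b'" "b' \<in> ext_B (Suc 0) (sub s (\<Omega> s))" for z b'
    proof -
      from z(2) obtain h where h: "h\<in>module_hom R (F 0) (I s)" "\<And>x. x\<in>carrier (F 0) \<Longrightarrow> d s (h x) \<in> \<Gamma>Z t \<and> z x = \<pi> t (d s (h x))"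
          "\<And>x. x\<in>carrier (F (Suc 0)) \<Longrightarrow> h (\<delta> 0 x) = b' x" by (auto simp: r_def)
      from z(3) obtain g where g: "g \<in> module_hom R (F 0) (sub s (\<Omega> s))"
        "\<And>x. x\<in>carrier (F (Suc 0)) \<Longrightarrow> b' x = g (\<delta> 0 x)" by (auto simp: ext_B_Suc)
      have g': "g \<in> module_hom R (F 0) (I s)" by (rule module_hom_supermodule[OF g(1) \<Omega>c])
      \<comment> \<open>Subtracting the bounding map \<open>g\<close>, which \<open>d s\<close>
        kills, makes the lift a degree-zero cocycle without changing its image under
        \<open>d s\<close>. Its values are then annihilated by the ideal.\<close>
      define u where "u = (\<lambda>x\<in>carrier (F 0). h x \<ominus>\<^bsub>I s\<^esub> g x)"
      have "u \<in> carrier (Hom_module R (F 0) (I s))" unfolding u_def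
        by (rule Hom_restrict[OF mF module_hom_minus[OF mF mI h(1) g']])
      then have uZ: "u \<in> ext_Z 0 (I s)"
        using h(3) g(2) dc module_homD(1)[OF g'] by (auto simp: ext_Z_def u_def a_minus_def Is.r_neg)
      have "z x = \<zero>\<^bsub>H t\<^esub>" if x: "x \<in> carrier (F 0)" for x
      proof -
        interpret It: module R "I t" by (rule mI)
        have "u x \<in> \<Gamma> s" using ext_Z_0_annihilated[OF mI uZ x] ann_part_subset_\<Gamma> by blast
        then have "d s (u x) \<in> \<Gamma>B t" using Suc by (simp add: \<Gamma>B_def)
        moreover have "d s (u x) = d s (h x) \<ominus>\<^bsub>I t\<^esub> d s (g x)"
          using module_hom_diff[OF mI mI dh module_homD(1)[OF h(1) x] module_homD(1)[OF g' x]] x by (simp add: u_def)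
        moreover have "d s (g x) = \<zero>\<^bsub>I t\<^esub>" using module_homD(1)[OF g(1) x] Suc by (simp add: \<Omega>_def)
        moreover have "d s (h x) \<in> carrier (I t)" by (rule module_homD(1)[OF dh module_homD(1)[OF h(1) x]])
        ultimately have "d s (h x) \<in> \<Gamma>B t" using It.add.inv_one by (simp add: a_minus_def a_inv_def)
        then show ?thesis using h(2)[OF x] \<pi>_zero by simp
      qed
      moreover have zc: "z \<in> carrier ?C" using z(2) by (simp add: r_def)
      ultimately have "z \<in> ext_B 0 (H t)" by (simp add: ext_B_0)
      then show ?thesis using zc by (intro bexI[of _ "\<zero>\<^bsub>?C\<^esub>"] bexI[of _ z]) auto
    qed
  qed
qed

text \<open>\<open>T\<close> is the image of Hom(R/a, Z^t), finite by the preceding lemma; the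
  cokernel is controlled by Ext^1 of B^t.\<close>

lemma ext_fg_0_H:
  assumes "\<And>i j. i < t \<Longrightarrow> ext_fg j (H i)"
  shows "ext_fg 0 (H t)"
proof (rule ext_fg_quotient[OF m\<Gamma>Z mHc \<pi>_hom])
  show "\<pi> t ` carrier (sub t (\<Gamma>Z t)) = carrier (H t)" by (simp add: \<pi>_surj)
  show "ext_fg (Suc 0) ((sub t (\<Gamma>Z t))\<lparr>carrier := {x \<in> carrier (sub t (\<Gamma>Z t)). \<pi> t x = \<zero>\<^bsub>H t\<^esub>}\<rparr>)"
    unfolding \<pi>_kernel using ext_fg_\<Gamma>B[of t t 0] assms by simp
  show "submodule ((\<lambda>f. \<lambda>x\<in>carrier (F 0). \<pi> t (f x)) ` ext_Z 0 (sub t (\<Gamma>Z t))) R (Hom_module R (F 0) (H t))"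
    by (rule submodule_image_submodule[OF mH[OF m\<Gamma>Z] mH[OF mHc] Hom_postcompose[OF mF m\<Gamma>Z \<pi>_hom] ext_Z_submodule[OF m\<Gamma>Z]])
qed (use fg_mod_image_\<pi> in auto)

text \<open>The Artinian induction is started with \<open>T\<close> = \<open>S\<close>, where no
  generator is assumed to act nilpotently.\<close>

lemma ext_fg_H:
  assumes "\<And>i j. i < t \<Longrightarrow> ext_fg j (H i)" "artinian_module R (H t)"
  shows "ext_fg j (H t)"
  by (rule ext_fg_artinian[OF S S(1) subset_refl assms(2) _ ext_fg_0[OF mHc ext_fg_0_H[OF assms(1)]]]) auto

lemma Supp_H: "Supp R (H i) \<subseteq> zero_locus R \<aa>"
proof (rule Supp_torsion[OF mHc])
  interpret I: module R "I i" by (rule mI)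
  interpret a: ideal \<aa> R by (rule ideal)
  show "\<aa> \<subseteq> carrier R" by (rule a.a_subset)
  fix r u assume r: "r \<in> \<aa>" and "u \<in> carrier (H i)"
  then obtain x where x: "x \<in> \<Gamma>Z i" "u = \<pi> i x" using \<pi>_surj[of i] by auto
  then have "x \<in> carrier (torsion_part R \<aa> (I i))" by (simp add: torsion_part_I \<Gamma>Z_eq)
  then obtain k :: nat where k: "\<forall>r \<in> \<aa> [^]\<^bsub>ideals_set R\<^esub> k. r \<odot>\<^bsub>I i\<^esub> x = \<zero>\<^bsub>I i\<^esub>"
    by (auto simp: torsion_part_def)
  have "(r [^]\<^bsub>R\<^esub> k) \<odot>\<^bsub>H i\<^esub> u = \<pi> i ((r [^]\<^bsub>R\<^esub> k) \<odot>\<^bsub>I i\<^esub> x)"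
    using module_homD(3)[OF \<pi>_hom, of "r [^]\<^bsub>R\<^esub> k" x i] x r by simp
  also have "(r [^]\<^bsub>R\<^esub> k) \<odot>\<^bsub>I i\<^esub> x = \<zero>\<^bsub>I i\<^esub>"
    using k element_pow_in_ideal_pow[OF R(1) ideal r] by blast
  also have "\<pi> i \<zero>\<^bsub>I i\<^esub> = \<zero>\<^bsub>H i\<^esub>" using module_hom_zero[OF m\<Gamma>Z mHc \<pi>_hom, of i] by simp
  finally show "\<exists>k::nat. (r [^]\<^bsub>R\<^esub> k) \<odot>\<^bsub>H i\<^esub> u = \<zero>\<^bsub>H i\<^esub>" ..
qed

end

section \<open>Passage to the resolution selected by \<open>Ext_module\<close>\<close>

lemma finitely_generated_quotient_regular:
  assumes "cring R" "noetherian_ring R" "ideal \<aa> R"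
  shows "finitely_generated_module R (quotient_module R (regular_module R) \<aa>)"
proof -
  interpret cring R by fact
  interpret a: ideal \<aa> R by fact
  have "(\<lambda>v. v 0) \<in> module_hom R (free_module R 1) (regular_module R)"
    by (auto simp: module_hom_def free_module_def)
  moreover have "\<exists>v\<in>carrier (free_module R 1). \<exists>b\<in>\<aa>. z = v 0 \<oplus>\<^bsub>R\<^esub> b" if "z \<in> carrier R" for z
    using that by (intro bexI[of _ "(\<lambda>_. \<zero>\<^bsub>R\<^esub>)(0 := z)"] bexI[of _ "\<zero>\<^bsub>R\<^esub>"]) (auto simp: free_module_def)
  moreover have "(\<lambda>v. v 0) ` carrier (free_module R 1) \<subseteq> carrier R" by (auto simp: free_module_def)
  ultimately have "fg_mod R (regular_module R) (carrier (regular_module R)) \<aa>"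
    unfolding fg_mod_def regular_module_simps by blast
  then show ?thesis
    using fg_mod_quotient[OF assms(1,2) module_regular[OF assms(1)] ideal_submodule_regular[OF assms(1,3)]] by simp
qed

theorem theorem2p1:
  fixes R :: "('a, 'r) ring_scheme"
    and \<aa> :: "'a set"
    and M :: "('a, 'b, 'm) module_scheme"
    and t :: nat
    and I :: "nat \<Rightarrow> ('a, 'c) module"
    and d :: "nat \<Rightarrow> 'c \<Rightarrow> 'c"
    and \<eta> :: "'b \<Rightarrow> 'c"
  assumes "cring R" and "noetherian_ring R"
    and "ideal \<aa> R"
    and "finitely_generated_module R M"
    and "injective_resolution R M I d \<eta>"
    and "artinian_module R (local_cohomology R \<aa> I d t)"
    and "\<And>i. i < t \<Longrightarrow> cofinite_module R \<aa> (local_cohomology R \<aa> I d i)"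
  shows "cofinite_module R \<aa> (local_cohomology R \<aa> I d t)"
proof -
  let ?Q = "quotient_module R (regular_module R) \<aa>"
  obtain S where S: "S \<subseteq> carrier R" "finite S" "\<aa> = Idl\<^bsub>R\<^esub> S"
    using noetherian_ring.finetely_gen[OF assms(2,3)] by auto
  \<comment> \<open>This is the choice made inside \<open>Ext_module\<close>. It depends only on R
    and the ideal, so one pair computes Ext for every local cohomology module.\<close>
  define n\<delta> where "n\<delta> = (SOME (n, \<delta>). \<exists>\<epsilon>. finite_free_resolution R ?Q n \<delta> \<epsilon>)"
  obtain n \<delta> where n\<delta>: "n\<delta> = (n, \<delta>)" by (cases n\<delta>)
  have "\<exists>n\<delta>. case n\<delta> of (n, \<delta>) \<Rightarrow> \<exists>\<epsilon>. finite_free_resolution R ?Q n \<delta> \<epsilon>"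
    using finite_free_resolution_exists[OF assms(1,2) finitely_generated_quotient_regular[OF assms(1-3)]] by auto
  from someI_ex[OF this, folded n\<delta>_def] obtain \<epsilon> where \<epsilon>: "finite_free_resolution R ?Q n \<delta> \<epsilon>"
    by (auto simp: n\<delta>)
  have Ext: "Ext_module R ?Q N j = Ext_of_resolution R n \<delta> N j" for N :: "('a, 'c set) module" and j
    unfolding Ext_module_def n\<delta>_def[symmetric] by (simp add: n\<delta>)
  interpret local_cohomology_context R \<aa> n \<delta> \<epsilon> S M I d \<eta>
    by (intro local_cohomology_context.intro ext_context.intro local_cohomology_context_axioms.intro)
      (fact assms S \<epsilon>)+
  \<comment> \<open>The support condition holds for every \<open>H i\<close>, so cofiniteness
    amounts to finiteness of Ext in the fixed resolution.\<close>
  have cof: "cofinite_module R \<aa> (H i) \<longleftrightarrow> (\<forall>j. ext_fg j (H i))" for i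
    using mHc Supp_H ext_fg_iff[OF mHc] by (auto simp: cofinite_module_def Ext)
  have "ext_fg j (H t)" for j
    by (rule ext_fg_H[OF _ assms(6)]) (use assms(7) cof in blast)
  then show ?thesis by (simp add: cof)
qed

end
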